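(* Let $\Phi_1\in\mathcal C(A_0,A_1)$, $\Phi_2\in\mathcal C(A'_0,A_1)$ and $\epsilon\ge0$, and let $\delta_{\rm pre}(\Phi_1\|\Phi_2)=\min_{\Lambda\in\mathcal C(A'_0,A_0)}\|\Phi_1\circ\Lambda-\Phi_2\|_\diamond$. The following are equivalent. (i) $\delta_{\rm pre}(\Phi_1\|\Phi_2)\le\epsilon$. (ii) For every finite-dimensional ancilla $R_0$ and every $\rho\in\mathfrak S(R_0A_1)$, $$\|(\mathrm{id}_{R_0}\otimes\Phi_2^{\mathsf T})(\rho)\|^\diamond_{A'_0|R_0}\le\|(\mathrm{id}_{R_0}\otimes\Phi_1^{\mathsf T})(\rho)\|^\diamond_{A_0|R_0}+\frac{\epsilon}{2}\|\rho\|^\diamond_{A_1|R_0}.$$ (iii) For every ancilla $R_0$, every ensemble $\mathcal E=\{\lambda_i,\rho_i\}_{i=1}^k$ on $R_0A_1$ and every measurement $M=(M_1,\dots,M_k)$ on $A_1A_1$, $$\sup_{\alpha\in\mathcal C(R_0,A'_0)}P_{\rm succ}\big(((\Phi_2\circ\alpha)\otimes\mathrm{id}_{A_1})(\mathcal E),M\big)\le\sup_{\alpha\in\mathcal C(R_0,A_0)}P_{\rm succ}\big(((\Phi_1\circ\alpha)\otimes\mathrm{id}_{A_1})(\mathcal E),M\big)+\frac{\epsilon}{2}P_{\rm succ}(\mathcal E).$$ Moreover, (i) is also equivalent to (ii), resp. (iii), required only for $R_0=A'_0$.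
   Context: Finite-dimensional systems; $\mathcal C(X,Y)$ channels; $\|\cdot\|_\diamond$ diamond norm. For $\phi:\mathcal B(X)\to\mathcal B(Y)$ hermitian linear, $\phi^*$ is its Hilbert–Schmidt adjoint and $\phi^{\mathsf T}(Z)=(\phi^*(Z^{\mathsf T}))^{\mathsf T}$ (transpose in fixed standard bases), so $\Phi^{\mathsf T}$ maps $\mathcal B(A_1)$ to the input space of $\Phi$. For $X\in\mathcal B_h(R_0B)$ and $\phi\in\mathcal L(R_0,B)$ set $\langle X,\phi\rangle={\rm Tr}[XC_{\phi^*}]$, where $C_{\psi}=(\psi\otimes\mathrm{id})(|I\rangle\rangle\langle\langle I|)$ is the Choi matrix, $|I\rangle\rangle=\sum_i|i\rangle|i\rangle$. For $\rho\in\mathcal B_+(R_0B)$, $\|\rho\|^\diamond_{B|R_0}=\max_{\alpha\in\mathcal C(R_0,B)}\langle\rho,\alpha\rangle=\min\{\lambda>0:\rho\le\lambda\sigma\otimes I_B,\ \sigma\in\mathfrak S(R_0)\}$. An ensemble $\mathcal E=\{\lambda_i,\rho_i\}_{i=1}^k$ on $X$: states $\rho_i$ with probabilities $\lambda_i$; for a map $\Psi$, $\Psi(\mathcal E)=\{\lambda_i,\Psi(\rho_i)\}$; a $k$-outcome measurement $M$: $M_i\ge0$, $\sum M_i=I$; $P_{\rm succ}(\mathcal E,M)=\sum_i\lambda_i{\rm Tr}[\rho_iM_i]$, $P_{\rm succ}(\mathcal E)=\max_MP_{\rm succ}(\mathcal E,M)$. In (iii), $\Phi\circ\alpha$ acts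 on the $R_0$ part and the output is measured together with the $A_1$ part of the ensemble. *)

theory Defs
  imports "Jordan_Normal_Form.Schur_Decomposition"
begin

(* Finite-dimensional quantum systems are identified with their dimensions
   (positive naturals). Operators on a d-dimensional system are complex d x d
   matrices. Linear maps B(X) -> B(Y) are HOL functions on complex matrices,
   only their behaviour on carrier_mat dX dX matters.
   Composite systems X Y have dimension dX * dY, with the standard
   (lexicographic) tensor basis |i>|j> = e_(i*dY + j). *)

type_synonym cmap = "complex mat \<Rightarrow> complex mat"

definition mtrace :: "complex mat \<Rightarrow> complex" where
  "mtrace A = (\<Sum>i<dim_row A. A $$ (i,i))"

definition transp :: "complex mat \<Rightarrow> complex mat" where
  "transp A = transpose_mat A"

definition munit :: "nat \<Rightarrow> nat \<Rightarrow> nat \<Rightarrow> complex mat" where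
  "munit d i j = mat d d (\<lambda>(a,b). if a = i \<and> b = j then 1 else 0)"

definition psd :: "nat \<Rightarrow> complex mat \<Rightarrow> bool" where
  "psd d A \<longleftrightarrow> A \<in> carrier_mat d d \<and>
     (\<forall>v \<in> carrier_vec d. ((A *\<^sub>v v) \<bullet> conjugate v) \<in> \<real> \<and> 0 \<le> Re ((A *\<^sub>v v) \<bullet> conjugate v))"

definition state :: "nat \<Rightarrow> complex mat \<Rightarrow> bool" where
  "state d \<rho> \<longleftrightarrow> psd d \<rho> \<and> mtrace \<rho> = 1"

definition trace_norm :: "complex mat \<Rightarrow> real" where
  "trace_norm A = Re (mtrace (THE B. psd (dim_col A) B \<and> B * B = mat_adjoint A * A))"

definition lin_map :: "nat \<Rightarrow> nat \<Rightarrow> cmap \<Rightarrow> bool" where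
  "lin_map dX dY \<phi> \<longleftrightarrow>
     (\<forall>A \<in> carrier_mat dX dX. \<phi> A \<in> carrier_mat dY dY) \<and>
     (\<forall>A \<in> carrier_mat dX dX. \<forall>B \<in> carrier_mat dX dX. \<phi> (A + B) = \<phi> A + \<phi> B) \<and>
     (\<forall>A \<in> carrier_mat dX dX. \<forall>c. \<phi> (c \<cdot>\<^sub>m A) = c \<cdot>\<^sub>m \<phi> A)"

definition id_tensor :: "nat \<Rightarrow> nat \<Rightarrow> nat \<Rightarrow> cmap \<Rightarrow> cmap" where
  "id_tensor dR dX dY \<phi> M = mat (dR * dY) (dR * dY) (\<lambda>(p,q).
      \<phi> (mat dX dX (\<lambda>(i,j). M $$ ((p div dY) * dX + i, (q div dY) * dX + j)))
        $$ (p mod dY, q mod dY))"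

definition tensor_id :: "nat \<Rightarrow> nat \<Rightarrow> nat \<Rightarrow> cmap \<Rightarrow> cmap" where
  "tensor_id dX dY dR \<phi> M = mat (dY * dR) (dY * dR) (\<lambda>(p,q).
      \<phi> (mat dX dX (\<lambda>(i,j). M $$ (i * dR + p mod dR, j * dR + q mod dR)))
        $$ (p div dR, q div dR))"

definition CP_map :: "nat \<Rightarrow> nat \<Rightarrow> cmap \<Rightarrow> bool" where
  "CP_map dX dY \<phi> \<longleftrightarrow>
     (\<forall>n>0. \<forall>P. psd (n * dX) P \<longrightarrow> psd (n * dY) (id_tensor n dX dY \<phi> P))"

definition TP_map :: "nat \<Rightarrow> nat \<Rightarrow> cmap \<Rightarrow> bool" where
  "TP_map dX dY \<phi> \<longleftrightarrow> (\<forall>A \<in> carrier_mat dX dX. mtrace (\<phi> A) = mtrace A)"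

definition channel :: "nat \<Rightarrow> nat \<Rightarrow> cmap \<Rightarrow> bool" where
  "channel dX dY \<phi> \<longleftrightarrow> lin_map dX dY \<phi> \<and> CP_map dX dY \<phi> \<and> TP_map dX dY \<phi>"

(* Hilbert-Schmidt adjoint \<phi>^dag : B(Y) -> B(X) of \<phi> : B(X) -> B(Y):
   <A, \<phi>^dag(Z)> = <\<phi>(A), Z>, so \<phi>^dag(Z)_(i,j) = <\<phi>(|i><j|), Z> *)
definition hs_adj :: "nat \<Rightarrow> nat \<Rightarrow> cmap \<Rightarrow> cmap" where
  "hs_adj dX dY \<phi> Z = mat dX dX (\<lambda>(i,j). mtrace (mat_adjoint (\<phi> (munit dX i j)) * Z))"

definition map_transp :: "nat \<Rightarrow> nat \<Rightarrow> cmap \<Rightarrow> cmap" where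
  "map_transp dX dY \<phi> Z = transp (hs_adj dX dY \<phi> (transp Z))"

(* |I>> = \<Sum>_i |i>|i> as a column matrix, and |I>><<I| *)
definition max_ent :: "nat \<Rightarrow> complex mat" where
  "max_ent d = mat (d * d) (d * d) (\<lambda>(p,q).
      if p div d = p mod d \<and> q div d = q mod d then 1 else 0)"

definition choi :: "nat \<Rightarrow> nat \<Rightarrow> cmap \<Rightarrow> complex mat" where
  "choi dX dY \<psi> = tensor_id dX dY dX \<psi> (max_ent dX)"

definition pairing :: "nat \<Rightarrow> nat \<Rightarrow> complex mat \<Rightarrow> cmap \<Rightarrow> complex" where
  "pairing dR dB X \<phi> = mtrace (X * choi dB dR (hs_adj dR dB \<phi>))"

definition cond_dnorm :: "nat \<Rightarrow> nat \<Rightarrow> complex mat \<Rightarrow> real" where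
  "cond_dnorm dR dB \<rho> = Sup {Re (pairing dR dB \<rho> \<alpha>) | \<alpha>. channel dR dB \<alpha>}"

definition dnorm :: "nat \<Rightarrow> nat \<Rightarrow> cmap \<Rightarrow> real" where
  "dnorm dX dY \<phi> = Sup {trace_norm (tensor_id dX dY dX \<phi> X) | X.
      X \<in> carrier_mat (dX * dX) (dX * dX) \<and> trace_norm X \<le> 1}"

definition delta_pre :: "nat \<Rightarrow> nat \<Rightarrow> nat \<Rightarrow> cmap \<Rightarrow> cmap \<Rightarrow> real" where
  "delta_pre dA0 dA0' dA1 \<Phi>1 \<Phi>2 =
     Inf {dnorm dA0' dA1 (\<lambda>X. \<Phi>1 (\<Lambda> X) - \<Phi>2 X) | \<Lambda>. channel dA0' dA0 \<Lambda>}"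

definition ensemble :: "nat \<Rightarrow> nat \<Rightarrow> (nat \<Rightarrow> real) \<Rightarrow> (nat \<Rightarrow> complex mat) \<Rightarrow> bool" where
  "ensemble d k lam rho \<longleftrightarrow>
     (\<forall>i<k. 0 \<le> lam i \<and> state d (rho i)) \<and> (\<Sum>i<k. lam i) = 1"

definition measurement :: "nat \<Rightarrow> nat \<Rightarrow> (nat \<Rightarrow> complex mat) \<Rightarrow> bool" where
  "measurement d k M \<longleftrightarrow> (\<forall>i<k. psd d (M i)) \<and> (\<forall>a<d. \<forall>b<d. (\<Sum>i<k. M i $$ (a,b)) = 1\<^sub>m d $$ (a,b))"

definition psucc :: "nat \<Rightarrow> (nat \<Rightarrow> real) \<Rightarrow> (nat \<Rightarrow> complex mat) \<Rightarrow> (nat \<Rightarrow> complex mat) \<Rightarrow> real" where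
  "psucc k lam rho M = (\<Sum>i<k. lam i * Re (mtrace (rho i * M i)))"

definition psucc_opt :: "nat \<Rightarrow> nat \<Rightarrow> (nat \<Rightarrow> real) \<Rightarrow> (nat \<Rightarrow> complex mat) \<Rightarrow> real" where
  "psucc_opt d k lam rho = Sup {psucc k lam rho M | M. measurement d k M}"

definition cond_ii :: "nat \<Rightarrow> nat \<Rightarrow> nat \<Rightarrow> cmap \<Rightarrow> cmap \<Rightarrow> real \<Rightarrow> nat \<Rightarrow> bool" where
  "cond_ii dA0 dA0' dA1 \<Phi>1 \<Phi>2 \<epsilon> dR \<longleftrightarrow>
     (\<forall>\<rho>. state (dR * dA1) \<rho> \<longrightarrow>
        cond_dnorm dR dA0' (id_tensor dR dA1 dA0' (map_transp dA0' dA1 \<Phi>2) \<rho>)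
        \<le> cond_dnorm dR dA0 (id_tensor dR dA1 dA0 (map_transp dA0 dA1 \<Phi>1) \<rho>)
           + \<epsilon> / 2 * cond_dnorm dR dA1 \<rho>)"

definition cond_iii :: "nat \<Rightarrow> nat \<Rightarrow> nat \<Rightarrow> cmap \<Rightarrow> cmap \<Rightarrow> real \<Rightarrow> nat \<Rightarrow> bool" where
  "cond_iii dA0 dA0' dA1 \<Phi>1 \<Phi>2 \<epsilon> dR \<longleftrightarrow>
     (\<forall>k lam rho M. ensemble (dR * dA1) k lam rho \<longrightarrow> measurement (dA1 * dA1) k M \<longrightarrow>
        Sup {psucc k lam (\<lambda>i. tensor_id dR dA1 dA1 (\<lambda>X. \<Phi>2 (\<alpha> X)) (rho i)) M
               | \<alpha>. channel dR dA0' \<alpha>}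
        \<le> Sup {psucc k lam (\<lambda>i. tensor_id dR dA1 dA1 (\<lambda>X. \<Phi>1 (\<alpha> X)) (rho i)) M
               | \<alpha>. channel dR dA0 \<alpha>}
          + \<epsilon> / 2 * psucc_opt (dR * dA1) k lam rho)"

end

theory Submission
  imports Defs "HOL-Analysis.Function_Topology" "HOL-Analysis.Convex"
    "HOL-Analysis.Topology_Euclidean_Space" "HOL-Library.Function_Algebras"
begin

text \<open>
  Linear maps are represented by their Choi kernels, and composition by the link product. Separating
  a convex set from the positive cone shows that \<open>\<parallel>\<rho>\<parallel>\<^sup>\<diamond>\<close> is the infimum of all \<open>l\<close> with
  \<open>\<rho> \<le> l \<sigma> \<otimes> 1\<close> for some density \<open>\<sigma>\<close>. For a difference \<open>\<Delta>\<close> of channels with Choi kernel \<open>J\<close>,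
  conjugation by \<open>\<sigma>\<close> to the power \<open>-1/2\<close> turns \<open>\<rho>\<close> into an effect, so that \<open>\<bar>\<langle>\<rho>, J\<rangle>\<bar>\<close> is at most
  \<open>\<parallel>\<rho>\<parallel>\<^sup>\<diamond> / 2\<close> times the diamond norm of \<open>\<Delta>\<close>; with \<open>\<Delta> = \<Phi>\<^sub>1 \<circ> \<Lambda> - \<Phi>\<^sub>2\<close> this derives (ii) and (iii)
  from (i). Conversely, if no \<open>\<Lambda>\<close> is good enough, the convex set of the kernels of
  \<open>\<Phi>\<^sub>1 \<circ> \<Lambda> + (\<epsilon>/2) \<gamma> - \<Phi>\<^sub>2\<close>, with \<open>\<gamma>\<close> a channel, stays away from the positive cone, and a separating
  density violates (ii) on the reference system of \<open>\<Phi>\<^sub>2\<close>. An ensemble together with a measurement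
  amounts to a kernel whose conditional norm is at most the guessing probability of the ensemble, and
  teleportation shows that every density arises in this way up to a factor, with equality.
\<close>

hide_const (open) Finite_Cartesian_Product.mat Finite_Cartesian_Product.vec
hide_type (open) Finite_Cartesian_Product.vec
unbundle no inner_syntax

instantiation "fun" :: (type, real_vector) real_vector
begin

definition scaleR_fun :: "real \<Rightarrow> ('a \<Rightarrow> 'b) \<Rightarrow> 'a \<Rightarrow> 'b" where
  "scaleR_fun c f = (\<lambda>x. c *\<^sub>R f x)"

instance
  by standard (simp_all add: scaleR_fun_def fun_eq_iff algebra_simps)

end

lemma scaleR_fun_apply [simp]: "(c *\<^sub>R f) x = c *\<^sub>R f x"
  by (simp add: scaleR_fun_def)

lemma sum_fun_apply [simp]: "(\<Sum>k\<in>K. f k) x = (\<Sum>k\<in>K. f k x)"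
  by (induction K rule: infinite_finite_induct) auto

section \<open>Kernels on finite sets\<close>

type_synonym 'i kernel = "'i \<Rightarrow> 'i \<Rightarrow> complex"

definition kernel_eq :: "'i kernel \<Rightarrow> 'i set \<Rightarrow> 'i kernel \<Rightarrow> bool"
    ("(_/ \<simeq>\<^bsub>_\<^esub> _)" [51, 0, 51] 50) where
  "A \<simeq>\<^bsub>I\<^esub> B \<longleftrightarrow> (\<forall>p\<in>I. \<forall>q\<in>I. A p q = B p q)"

definition inner_on :: "'i set \<Rightarrow> ('i \<Rightarrow> complex) \<Rightarrow> ('i \<Rightarrow> complex) \<Rightarrow> complex" where
  "inner_on I u v = (\<Sum>p\<in>I. cnj (u p) * v p)"

definition kernel_app :: "'i set \<Rightarrow> 'i kernel \<Rightarrow> ('i \<Rightarrow> complex) \<Rightarrow> 'i \<Rightarrow> complex" where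
  "kernel_app I A v p = (\<Sum>q\<in>I. A p q * v q)"

definition sesq :: "'i set \<Rightarrow> 'i kernel \<Rightarrow> ('i \<Rightarrow> complex) \<Rightarrow> ('i \<Rightarrow> complex) \<Rightarrow> complex" where
  "sesq I A u v = (\<Sum>p\<in>I. \<Sum>q\<in>I. cnj (u p) * A p q * v q)"

definition kernel_trace :: "'i set \<Rightarrow> 'i kernel \<Rightarrow> complex" where
  "kernel_trace I A = (\<Sum>p\<in>I. A p p)"

text \<open>The pairing is bilinear: \<open>kernel_pair I A B\<close> is the trace of \<open>A\<close> times the transpose of \<open>B\<close>.\<close>

definition kernel_pair :: "'i set \<Rightarrow> 'i kernel \<Rightarrow> 'i kernel \<Rightarrow> complex" where
  "kernel_pair I A B = (\<Sum>p\<in>I. \<Sum>q\<in>I. A p q * B p q)"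

definition kernel_mult :: "'i set \<Rightarrow> 'i kernel \<Rightarrow> 'i kernel \<Rightarrow> 'i kernel" where
  "kernel_mult I A B p q = (\<Sum>r\<in>I. A p r * B r q)"

definition kernel_transpose :: "'i kernel \<Rightarrow> 'i kernel" where
  "kernel_transpose A p q = A q p"

definition kernel_adjoint :: "'i kernel \<Rightarrow> 'i kernel" where
  "kernel_adjoint A p q = cnj (A q p)"

definition one_kernel :: "'i kernel" where
  "one_kernel p q = of_bool (p = q)"

definition outer :: "('i \<Rightarrow> complex) \<Rightarrow> ('i \<Rightarrow> complex) \<Rightarrow> 'i kernel" where
  "outer u v p q = u p * cnj (v q)"

definition herm_kernel :: "'i set \<Rightarrow> 'i kernel \<Rightarrow> bool" where
  "herm_kernel I A \<longleftrightarrow> A \<simeq>\<^bsub>I\<^esub> kernel_adjoint A"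

definition pos_kernel :: "'i set \<Rightarrow> 'i kernel \<Rightarrow> bool" where
  "pos_kernel I A \<longleftrightarrow> (\<forall>v. 0 \<le> sesq I A v v)"

definition density_kernel :: "'i set \<Rightarrow> 'i kernel \<Rightarrow> bool" where
  "density_kernel I A \<longleftrightarrow> pos_kernel I A \<and> kernel_trace I A = 1"

definition orthonormal_on :: "'i set \<Rightarrow> 'j set \<Rightarrow> ('j \<Rightarrow> 'i \<Rightarrow> complex) \<Rightarrow> bool" where
  "orthonormal_on I J v \<longleftrightarrow> (\<forall>j\<in>J. \<forall>k\<in>J. inner_on I (v j) (v k) = of_bool (j = k))"

subsection \<open>Equality on a set\<close>

lemma kernel_eqI: "(\<And>p q. p \<in> I \<Longrightarrow> q \<in> I \<Longrightarrow> A p q = B p q) \<Longrightarrow> A \<simeq>\<^bsub>I\<^esub> B"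
  by (simp add: kernel_eq_def)

lemma kernel_eqD: "A \<simeq>\<^bsub>I\<^esub> B \<Longrightarrow> p \<in> I \<Longrightarrow> q \<in> I \<Longrightarrow> A p q = B p q"
  by (simp add: kernel_eq_def)

lemma kernel_eq_refl [simp, intro]: "A \<simeq>\<^bsub>I\<^esub> A"
  by (simp add: kernel_eq_def)

lemma kernel_eq_sym: "A \<simeq>\<^bsub>I\<^esub> B \<Longrightarrow> B \<simeq>\<^bsub>I\<^esub> A"
  by (simp add: kernel_eq_def)

lemma kernel_eq_trans [trans]: "A \<simeq>\<^bsub>I\<^esub> B \<Longrightarrow> B \<simeq>\<^bsub>I\<^esub> C \<Longrightarrow> A \<simeq>\<^bsub>I\<^esub> C"
  by (simp add: kernel_eq_def)

lemma kernel_eq_cong: "A \<simeq>\<^bsub>I\<^esub> A' \<Longrightarrow> B \<simeq>\<^bsub>I\<^esub> B' \<Longrightarrow> A \<simeq>\<^bsub>I\<^esub> B \<longleftrightarrow> A' \<simeq>\<^bsub>I\<^esub> B'"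
  by (simp add: kernel_eq_def)

lemma kernel_eq_add: "A \<simeq>\<^bsub>I\<^esub> A' \<Longrightarrow> B \<simeq>\<^bsub>I\<^esub> B' \<Longrightarrow> A + B \<simeq>\<^bsub>I\<^esub> A' + B'"
  by (simp add: kernel_eq_def)

lemma kernel_eq_diff: "A \<simeq>\<^bsub>I\<^esub> A' \<Longrightarrow> B \<simeq>\<^bsub>I\<^esub> B' \<Longrightarrow> A - B \<simeq>\<^bsub>I\<^esub> A' - B'"
  by (simp add: kernel_eq_def)

lemma kernel_eq_scaleR: "A \<simeq>\<^bsub>I\<^esub> B \<Longrightarrow> c *\<^sub>R A \<simeq>\<^bsub>I\<^esub> c *\<^sub>R B"
  by (simp add: kernel_eq_def)

lemma kernel_eq_sum: "(\<And>k. k \<in> K \<Longrightarrow> A k \<simeq>\<^bsub>I\<^esub> B k) \<Longrightarrow> (\<Sum>k\<in>K. A k) \<simeq>\<^bsub>I\<^esub> (\<Sum>k\<in>K. B k)"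
  by (simp add: kernel_eq_def)

lemma sesq_cong: "A \<simeq>\<^bsub>I\<^esub> B \<Longrightarrow> sesq I A u v = sesq I B u v"
  by (simp add: kernel_eq_def sesq_def)

lemma kernel_app_cong: "A \<simeq>\<^bsub>I\<^esub> B \<Longrightarrow> p \<in> I \<Longrightarrow> kernel_app I A v p = kernel_app I B v p"
  by (simp add: kernel_eq_def kernel_app_def)

lemma kernel_trace_cong: "A \<simeq>\<^bsub>I\<^esub> B \<Longrightarrow> kernel_trace I A = kernel_trace I B"
  by (simp add: kernel_eq_def kernel_trace_def)

lemma kernel_pair_cong: "A \<simeq>\<^bsub>I\<^esub> A' \<Longrightarrow> B \<simeq>\<^bsub>I\<^esub> B' \<Longrightarrow> kernel_pair I A B = kernel_pair I A' B'"
  by (simp add: kernel_eq_def kernel_pair_def)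

lemma kernel_mult_cong: "A \<simeq>\<^bsub>I\<^esub> A' \<Longrightarrow> B \<simeq>\<^bsub>I\<^esub> B' \<Longrightarrow> kernel_mult I A B \<simeq>\<^bsub>I\<^esub> kernel_mult I A' B'"
  by (simp add: kernel_eq_def kernel_mult_def)

lemma kernel_transpose_cong: "A \<simeq>\<^bsub>I\<^esub> B \<Longrightarrow> kernel_transpose A \<simeq>\<^bsub>I\<^esub> kernel_transpose B"
  by (simp add: kernel_eq_def kernel_transpose_def)

lemma kernel_adjoint_cong: "A \<simeq>\<^bsub>I\<^esub> B \<Longrightarrow> kernel_adjoint A \<simeq>\<^bsub>I\<^esub> kernel_adjoint B"
  by (simp add: kernel_eq_def kernel_adjoint_def)

lemma herm_kernel_cong: "A \<simeq>\<^bsub>I\<^esub> B \<Longrightarrow> herm_kernel I A \<longleftrightarrow> herm_kernel I B"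
  unfolding herm_kernel_def by (intro kernel_eq_cong kernel_adjoint_cong)

lemma pos_kernel_cong: "A \<simeq>\<^bsub>I\<^esub> B \<Longrightarrow> pos_kernel I A \<longleftrightarrow> pos_kernel I B"
  by (simp add: pos_kernel_def sesq_cong)

subsection \<open>Linearity\<close>

lemma inner_on_diff_right: "inner_on I u (v - w) = inner_on I u v - inner_on I u w"
  by (simp add: inner_on_def algebra_simps sum_subtractf)

lemma inner_on_mult_right: "inner_on I u (\<lambda>p. c * v p) = c * inner_on I u v"
  by (simp add: inner_on_def algebra_simps sum_distrib_left)

lemma inner_on_cnj: "cnj (inner_on I u v) = inner_on I v u"
  by (simp add: inner_on_def mult.commute)

lemma inner_on_mult_left: "inner_on I (\<lambda>p. c * u p) v = cnj c * inner_on I u v"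
  by (simp add: inner_on_def algebra_simps sum_distrib_left)

lemma sesq_eq_inner_on: "sesq I A u v = inner_on I u (kernel_app I A v)"
  by (simp add: sesq_def inner_on_def kernel_app_def sum_distrib_left mult.assoc)

lemma sesq_add: "sesq I (A + B) u v = sesq I A u v + sesq I B u v"
  by (simp add: sesq_def algebra_simps sum.distrib)

lemma sesq_diff: "sesq I (A - B) u v = sesq I A u v - sesq I B u v"
  by (simp add: sesq_def algebra_simps sum_subtractf)

lemma sesq_minus: "sesq I (- A) u v = - sesq I A u v"
  by (simp add: sesq_def sum_negf)

lemma sesq_scaleR: "sesq I (c *\<^sub>R A) u v = c *\<^sub>R sesq I A u v"
  by (simp add: sesq_def scaleR_conv_of_real sum_distrib_left mult_ac)

lemma sesq_sum: "sesq I (\<Sum>k\<in>K. A k) u v = (\<Sum>k\<in>K. sesq I (A k) u v)"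
  by (induction K rule: infinite_finite_induct) (simp_all add: sesq_def algebra_simps sum.distrib)

lemma sesq_mult_left: "sesq I A (\<lambda>p. c * u p) v = cnj c * sesq I A u v"
  by (simp add: sesq_def algebra_simps sum_distrib_left)

lemma sesq_mult_right: "sesq I A u (\<lambda>p. c * v p) = c * sesq I A u v"
  by (simp add: sesq_def algebra_simps sum_distrib_left)

lemma sesq_add_left: "sesq I A (u + u') v = sesq I A u v + sesq I A u' v"
  by (simp add: sesq_def algebra_simps sum.distrib)

lemma sesq_add_right: "sesq I A u (v + v') = sesq I A u v + sesq I A u v'"
  by (simp add: sesq_def algebra_simps sum.distrib)

lemma sesq_outer: "sesq I (outer a b) u v = inner_on I u a * inner_on I b v"
  by (simp add: sesq_def inner_on_def outer_def sum_product mult.assoc)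

lemma kernel_app_diff: "kernel_app I (A - B) v = kernel_app I A v - kernel_app I B v"
  by (rule ext) (simp add: kernel_app_def algebra_simps sum_subtractf)

lemma kernel_app_scaleR: "kernel_app I (c *\<^sub>R A) v = c *\<^sub>R kernel_app I A v"
  by (rule ext) (simp add: kernel_app_def scaleR_conv_of_real sum_distrib_left mult_ac)

lemma kernel_app_sum: "kernel_app I (\<Sum>k\<in>K. A k) v = (\<Sum>k\<in>K. kernel_app I (A k) v)"
  by (rule ext, induction K rule: infinite_finite_induct)
    (simp_all add: kernel_app_def algebra_simps sum.distrib)

lemma kernel_app_outer: "kernel_app I (outer a b) v = (\<lambda>p. inner_on I b v * a p)"
  by (rule ext) (simp add: kernel_app_def inner_on_def outer_def sum_distrib_left mult_ac)

lemma kernel_trace_add: "kernel_trace I (A + B) = kernel_trace I A + kernel_trace I B"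
  by (simp add: kernel_trace_def sum.distrib)

lemma kernel_trace_diff: "kernel_trace I (A - B) = kernel_trace I A - kernel_trace I B"
  by (simp add: kernel_trace_def sum_subtractf)

lemma kernel_trace_scaleR: "kernel_trace I (c *\<^sub>R A) = c *\<^sub>R kernel_trace I A"
  by (simp add: kernel_trace_def scaleR_sum_right)

lemma kernel_trace_sum: "kernel_trace I (\<Sum>k\<in>K. A k) = (\<Sum>k\<in>K. kernel_trace I (A k))"
  unfolding kernel_trace_def sum_fun_apply by (rule sum.swap)

lemma kernel_trace_outer: "kernel_trace I (outer u v) = inner_on I v u"
  by (simp add: kernel_trace_def inner_on_def outer_def mult.commute)

lemma kernel_trace_one: "kernel_trace I one_kernel = of_nat (card I)"
  by (simp add: kernel_trace_def one_kernel_def)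

lemma kernel_trace_transpose: "kernel_trace I (kernel_transpose A) = kernel_trace I A"
  by (simp add: kernel_trace_def kernel_transpose_def)

lemma kernel_pair_commute: "kernel_pair I A B = kernel_pair I B A"
  by (simp add: kernel_pair_def mult.commute)

lemma kernel_pair_add_right: "kernel_pair I A (B + C) = kernel_pair I A B + kernel_pair I A C"
  by (simp add: kernel_pair_def algebra_simps sum.distrib)

lemma kernel_pair_diff_right: "kernel_pair I A (B - C) = kernel_pair I A B - kernel_pair I A C"
  by (simp add: kernel_pair_def algebra_simps sum_subtractf)

lemma kernel_pair_scaleR_right: "kernel_pair I A (c *\<^sub>R B) = c *\<^sub>R kernel_pair I A B"
  by (simp add: kernel_pair_def scaleR_sum_right)

lemma kernel_pair_scaleR_left: "kernel_pair I (c *\<^sub>R A) B = c *\<^sub>R kernel_pair I A B"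
  by (simp add: kernel_pair_def scaleR_sum_right)

lemma kernel_pair_sum_right: "kernel_pair I A (\<Sum>k\<in>K. B k) = (\<Sum>k\<in>K. kernel_pair I A (B k))"
  by (induction K rule: infinite_finite_induct)
    (simp_all add: kernel_pair_def algebra_simps sum.distrib)

lemma kernel_pair_sum_left: "kernel_pair I (\<Sum>k\<in>K. A k) B = (\<Sum>k\<in>K. kernel_pair I (A k) B)"
  by (simp add: kernel_pair_commute[of I _ B] kernel_pair_sum_right)

lemma kernel_pair_outer: "kernel_pair I A (outer u v) = sesq I A (cnj \<circ> u) (cnj \<circ> v)"
  by (simp add: kernel_pair_def sesq_def outer_def mult_ac)

lemma sesq_eq_kernel_pair: "sesq I A u v = kernel_pair I A (outer (cnj \<circ> u) (cnj \<circ> v))"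
  by (simp add: kernel_pair_outer o_def)

lemma kernel_pair_one:
  assumes "finite I"
  shows "kernel_pair I A one_kernel = kernel_trace I A"
  using assms by (simp add: kernel_pair_def kernel_trace_def one_kernel_def sum_mult_of_bool_eq)

lemma kernel_transpose_transpose [simp]: "kernel_transpose (kernel_transpose A) = A"
  by (simp add: kernel_transpose_def fun_eq_iff)

lemma kernel_transpose_one [simp]: "kernel_transpose one_kernel = one_kernel"
  by (auto simp: kernel_transpose_def one_kernel_def fun_eq_iff)

lemma kernel_transpose_scaleR: "kernel_transpose (c *\<^sub>R A) = c *\<^sub>R kernel_transpose A"
  by (simp add: kernel_transpose_def fun_eq_iff)

lemma kernel_transpose_sum: "kernel_transpose (\<Sum>k\<in>K. A k) = (\<Sum>k\<in>K. kernel_transpose (A k))"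
  by (simp add: kernel_transpose_def fun_eq_iff)

lemma kernel_app_one: "finite I \<Longrightarrow> p \<in> I \<Longrightarrow> kernel_app I one_kernel v p = v p"
  by (simp add: kernel_app_def one_kernel_def sum_of_bool_mult_eq)

lemma sesq_one: "finite I \<Longrightarrow> sesq I one_kernel u v = inner_on I u v"
  by (simp add: sesq_eq_inner_on inner_on_def kernel_app_one)

lemma kernel_app_delta: "finite I \<Longrightarrow> q \<in> I \<Longrightarrow> kernel_app I A (\<lambda>x. of_bool (x = q)) p = A p q"
  by (simp add: kernel_app_def sum_mult_of_bool_eq)

lemma complex_cnj_of_bool [simp]: "cnj (of_bool P) = of_bool P"
  by simp

lemma sesq_delta:
  assumes "finite I" "p \<in> I" "q \<in> I"
  shows "sesq I A (\<lambda>x. of_bool (x = p)) (\<lambda>x. of_bool (x = q)) = A p q"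
  using assms
  by (simp add: sesq_eq_inner_on kernel_app_delta inner_on_def sum_of_bool_mult_eq)

subsection \<open>Hermitian and positive kernels\<close>

lemma inner_on_self: "inner_on I u u = of_real (\<Sum>p\<in>I. (cmod (u p))\<^sup>2)"
  unfolding inner_on_def by (simp add: complex_norm_square mult.commute del: of_real_power)

lemma inner_on_nonneg: "0 \<le> inner_on I u u"
  unfolding inner_on_self by (simp add: less_eq_complex_def sum_nonneg)

lemma inner_on_self_eq_0D:
  assumes "finite I" "inner_on I u u = 0" "p \<in> I"
  shows "u p = 0"
proof -
  have "(\<Sum>p\<in>I. (cmod (u p))\<^sup>2) = 0"
    using assms(2) unfolding inner_on_self of_real_eq_0_iff .
  then show ?thesis using assms by (simp add: sum_nonneg_eq_0_iff)
qed

lemma herm_kernelD: "herm_kernel I A \<Longrightarrow> p \<in> I \<Longrightarrow> q \<in> I \<Longrightarrow> cnj (A q p) = A p q"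
  by (metis herm_kernel_def kernel_adjoint_def kernel_eqD)

lemma herm_kernelI: "(\<And>p q. p \<in> I \<Longrightarrow> q \<in> I \<Longrightarrow> cnj (A q p) = A p q) \<Longrightarrow> herm_kernel I A"
  by (simp add: herm_kernel_def kernel_eq_def kernel_adjoint_def)

lemma sesq_cnj:
  assumes "herm_kernel I A"
  shows "cnj (sesq I A u v) = sesq I A v u"
  unfolding sesq_def using herm_kernelD[OF assms]
  by (subst sum.swap) (simp add: mult_ac)

lemma inner_on_kernel_app:
  assumes "herm_kernel I A"
  shows "inner_on I (kernel_app I A u) v = sesq I A u v"
  by (metis assms inner_on_cnj sesq_cnj sesq_eq_inner_on)

lemma herm_kernel_diff: "herm_kernel I A \<Longrightarrow> herm_kernel I B \<Longrightarrow> herm_kernel I (A - B)"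
  by (rule herm_kernelI) (simp add: herm_kernelD)

lemma herm_kernel_scaleR: "herm_kernel I A \<Longrightarrow> herm_kernel I (c *\<^sub>R A)"
  by (rule herm_kernelI) (simp add: herm_kernelD)

lemma herm_kernel_sum: "(\<And>k. k \<in> K \<Longrightarrow> herm_kernel I (A k)) \<Longrightarrow> herm_kernel I (\<Sum>k\<in>K. A k)"
proof (rule herm_kernelI)
  fix p q assume herm: "\<And>k. k \<in> K \<Longrightarrow> herm_kernel I (A k)" and indices: "p \<in> I" "q \<in> I"
  show "cnj ((\<Sum>k\<in>K. A k) q p) = (\<Sum>k\<in>K. A k) p q"
    using herm_kernelD[OF herm indices] by simp
qed

lemma herm_kernel_add: "herm_kernel I A \<Longrightarrow> herm_kernel I B \<Longrightarrow> herm_kernel I (A + B)"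
  by (rule herm_kernelI) (simp add: herm_kernelD)

lemma herm_kernel_outer: "herm_kernel I (outer u u)"
  by (rule herm_kernelI) (simp add: outer_def)

lemma herm_kernel_one: "herm_kernel I one_kernel"
  by (rule herm_kernelI) (auto simp: one_kernel_def)

lemma pos_kernelD: "pos_kernel I A \<Longrightarrow> 0 \<le> sesq I A v v"
  by (simp add: pos_kernel_def)

lemma pos_kernelI_herm:
  assumes "herm_kernel I A" "\<And>v. 0 \<le> Re (sesq I A v v)"
  shows "pos_kernel I A"
proof -
  have "Im (sesq I A v v) = 0" for v
    using sesq_cnj[OF assms(1), of v v] by (simp add: complex_eq_iff)
  then show ?thesis using assms(2) by (simp add: pos_kernel_def less_eq_complex_def)
qed

lemma pos_kernel_herm:
  assumes "finite I" "pos_kernel I A"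
  shows "herm_kernel I A"
  unfolding herm_kernel_def
proof (rule kernel_eqI)
  fix p q assume "p \<in> I" "q \<in> I"
  define e where "e p = (\<lambda>x. of_bool (x = p) :: complex)" for p :: 'a
  have entry: "sesq I A (e x) (e y) = A x y" if "x \<in> I" "y \<in> I" for x y
    unfolding e_def using sesq_delta[OF assms(1) that] .
  have polar: "0 \<le> A p p + c * A p q + cnj c * (A q p + c * A q q)" for c
    using pos_kernelD[OF assms(2), of "e p + (\<lambda>x. c * e q x)"] \<open>p \<in> I\<close> \<open>q \<in> I\<close>
    by (simp add: sesq_add_left sesq_add_right sesq_mult_left sesq_mult_right entry algebra_simps)
  have diag: "0 \<le> A p p" "0 \<le> A q q"
    using pos_kernelD[OF assms(2), of "e p"] pos_kernelD[OF assms(2), of "e q"] \<open>p \<in> I\<close> \<open>q \<in> I\<close>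
    by (simp_all add: entry)
  show "A p q = kernel_adjoint A p q"
    using polar[of 1] polar[of \<i>] diag
    by (auto simp: kernel_adjoint_def less_eq_complex_def complex_eq_iff)
qed

lemma pos_kernel_zero: "pos_kernel I 0"
  by (simp add: pos_kernel_def sesq_def)

lemma pos_kernel_add: "pos_kernel I A \<Longrightarrow> pos_kernel I B \<Longrightarrow> pos_kernel I (A + B)"
  by (simp add: pos_kernel_def sesq_add)

lemma pos_kernel_scaleR: "pos_kernel I A \<Longrightarrow> 0 \<le> c \<Longrightarrow> pos_kernel I (c *\<^sub>R A)"
  by (simp add: pos_kernel_def sesq_scaleR less_eq_complex_def)

lemma pos_kernel_sum: "(\<And>k. k \<in> K \<Longrightarrow> pos_kernel I (A k)) \<Longrightarrow> pos_kernel I (\<Sum>k\<in>K. A k)"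
  by (simp add: pos_kernel_def sesq_sum sum_nonneg)

lemma pos_kernel_outer: "pos_kernel I (outer u u)"
proof -
  have "sesq I (outer u u) v v = of_real ((cmod (inner_on I u v))\<^sup>2)" for v
    unfolding sesq_outer inner_on_cnj[of I u v, symmetric]
    by (simp add: complex_norm_square mult.commute del: of_real_power)
  then show ?thesis by (simp add: pos_kernel_def less_eq_complex_def)
qed

lemma pos_kernel_one: "finite I \<Longrightarrow> pos_kernel I one_kernel"
  by (simp add: pos_kernel_def sesq_one inner_on_nonneg)

lemma pos_kernel_convex: "convex {A. pos_kernel I A}"
  by (rule convexI) (simp add: pos_kernel_add pos_kernel_scaleR)

lemma pos_kernel_trace_nonneg:
  assumes "finite I" "pos_kernel I A"
  shows "0 \<le> kernel_trace I A"
  unfolding kernel_trace_def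
  by (intro sum_nonneg) (metis assms pos_kernelD sesq_delta)

lemma density_kernel_convex: "convex {A. density_kernel I A}"
proof -
  have "convex {A. kernel_trace I A = 1}"
    by (rule convexI) (simp add: kernel_trace_add kernel_trace_scaleR flip: scaleR_left.add)
  with pos_kernel_convex have "convex ({A. pos_kernel I A} \<inter> {A. kernel_trace I A = 1})"
    by (rule convex_Int)
  then show ?thesis by (simp add: density_kernel_def Collect_conj_eq)
qed

lemma density_kernel_one:
  assumes "finite I" "I \<noteq> {}"
  shows "density_kernel I ((1 / card I) *\<^sub>R one_kernel)"
  using assms by (simp add: density_kernel_def pos_kernel_scaleR pos_kernel_one kernel_trace_scaleR
      kernel_trace_one scaleR_conv_of_real)

lemma nonneg_if_nonneg_perturbation:
  fixes a b :: real
  assumes "\<And>t. 0 < t \<Longrightarrow> t \<le> 1 \<Longrightarrow> 0 \<le> a + t * b"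
  shows "0 \<le> a"
proof (rule LIMSEQ_le_const)
  have "(\<lambda>n. a + inverse (real (Suc n)) * b) \<longlonglongrightarrow> a + 0 * b"
    by (intro tendsto_intros LIMSEQ_inverse_real_of_nat)
  then show "(\<lambda>n. a + inverse (real (Suc n)) * b) \<longlonglongrightarrow> a" by simp
  show "\<exists>N. \<forall>n\<ge>N. 0 \<le> a + inverse (real (Suc n)) * b"
    using assms by (simp add: inverse_le_1_iff)
qed

lemma pos_kernel_null_vector:
  assumes fin: "finite I" and pos: "pos_kernel I A" and null: "sesq I A u u = 0" and "p \<in> I"
  shows "kernel_app I A u p = 0"
proof -
  define z where "z = kernel_app I A u"
  have herm: "herm_kernel I A" by (rule pos_kernel_herm[OF fin pos])
  have sesq_left: "sesq I A z u = inner_on I z z" by (simp add: sesq_eq_inner_on z_def)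
  have sesq_right: "sesq I A u z = inner_on I z z"
    using inner_on_kernel_app[OF herm, of u z] by (simp add: z_def)
  have "0 \<le> - 2 * Re (inner_on I z z) + t * Re (sesq I A z z)" if "0 < t" for t :: real
  proof -
    have "0 \<le> sesq I A (u + (\<lambda>p. of_real (- t) * z p)) (u + (\<lambda>p. of_real (- t) * z p))"
      by (rule pos_kernelD[OF pos])
    also have "\<dots> = of_real (t * t) * sesq I A z z - of_real (2 * t) * inner_on I z z"
      unfolding sesq_add_left sesq_add_right sesq_mult_left sesq_mult_right null sesq_left
        sesq_right
      by (simp add: algebra_simps)
    finally have "0 \<le> t * (t * Re (sesq I A z z) - 2 * Re (inner_on I z z))"
      by (simp add: less_eq_complex_def algebra_simps)
    then show ?thesis using that by (simp add: zero_le_mult_iff)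
  qed
  then have "0 \<le> - 2 * Re (inner_on I z z)"
    by (rule nonneg_if_nonneg_perturbation)
  then have "inner_on I z z = 0"
    using inner_on_nonneg[of I z] by (simp add: less_eq_complex_def complex_eq_iff)
  then show ?thesis using inner_on_self_eq_0D[OF fin _ \<open>p \<in> I\<close>] by (simp add: z_def)
qed

section \<open>The spectral theorem\<close>

lemma inner_on_sum_right: "inner_on I u (\<Sum>j\<in>J. f j) = (\<Sum>j\<in>J. inner_on I u (f j))"
  unfolding inner_on_def sum_fun_apply sum_distrib_left by (rule sum.swap)

lemma compact_PiE_UNIV:
  fixes S :: "'i \<Rightarrow> 'a::topological_space set"
  assumes "\<And>i. compact (S i)"
  shows "compact (Pi\<^sub>E UNIV S)"
  using assms compactin_PiE[of "\<lambda>_. euclidean" UNIV S] by (simp add: euclidean_product_topology)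

lemma continuous_on_sesq: "continuous_on S (\<lambda>u. sesq I A u u)"
proof -
  have "continuous_on S (\<lambda>u. u p)" for p :: 'a and S :: "('a \<Rightarrow> complex) set"
    using continuous_on_product_coordinates subset_UNIV by (rule continuous_on_subset)
  then show ?thesis unfolding sesq_def
    by (intro continuous_on_sum continuous_on_mult continuous_on_cnj continuous_on_const)
qed

lemma compact_unit_sphere_on:
  fixes I :: "'i set"
  assumes "finite I"
  shows "compact {u :: 'i \<Rightarrow> complex. (\<forall>p. p \<notin> I \<longrightarrow> u p = 0) \<and> inner_on I u u = 1}" (is "compact ?S")
proof -
  let ?B = "Pi\<^sub>E UNIV (\<lambda>p. if p \<in> I then cball 0 1 else {0 :: complex})"
  have "compact ?B" by (rule compact_PiE_UNIV) auto
  moreover have "closed {u :: 'i \<Rightarrow> complex. inner_on I u u = 1}"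
    unfolding sesq_one[OF assms, symmetric]
    by (intro closed_Collect_eq continuous_on_sesq continuous_on_const)
  ultimately have "compact (?B \<inter> {u. inner_on I u u = 1})" by (rule compact_Int_closed)
  moreover have "?S = ?B \<inter> {u. inner_on I u u = 1}"
  proof -
    have "cmod (u p) \<le> 1" if "inner_on I u u = 1" "p \<in> I" for u :: "'i \<Rightarrow> complex" and p
    proof -
      have "(\<Sum>p\<in>I. (cmod (u p))\<^sup>2) = 1"
        using that(1) unfolding inner_on_self of_real_eq_1_iff .
      then have "(cmod (u p))\<^sup>2 \<le> 1"
        using member_le_sum[OF that(2), of "\<lambda>p. (cmod (u p))\<^sup>2"] assms by simp
      then show ?thesis by (simp add: power_le_one_iff)
    qed
    then show ?thesis by (auto simp: PiE_iff) (metis singletonD)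
  qed
  ultimately show ?thesis by simp
qed

lemma sesq_normalised_vector:
  assumes "inner_on I x x \<noteq> 0"
  obtains y where "\<And>p. p \<notin> I \<Longrightarrow> y p = 0" "inner_on I y y = 1"
    "Re (sesq I A x x) = Re (sesq I A y y) * Re (inner_on I x x)"
proof -
  define r where "r = Re (inner_on I x x)"
  have norm_eq: "inner_on I x x = of_real r" "0 < r"
    using assms inner_on_nonneg[of I x] by (auto simp: r_def less_eq_complex_def complex_eq_iff)
  define c where "c = complex_of_real (1 / sqrt r)"
  have norm_c: "cnj c * c = of_real (1 / r)"
    using norm_eq(2) by (simp add: c_def flip: of_real_mult)
  define y where "y p = (if p \<in> I then c * x p else 0)" for p
  have "inner_on I y y = cnj c * c * inner_on I x x"
    by (simp add: inner_on_def y_def sum_distrib_left mult_ac)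
  then have "inner_on I y y = 1" using norm_eq by (simp add: norm_c)
  moreover have "sesq I A y y = cnj c * c * sesq I A x x"
    by (simp add: sesq_def y_def sum_distrib_left mult_ac)
  then have "Re (sesq I A x x) = Re (sesq I A y y) * Re (inner_on I x x)"
    using norm_eq by (simp add: norm_c)
  ultimately show ?thesis by (intro that[of y]) (simp_all add: y_def)
qed

lemma herm_kernel_rayleigh_maximum:
  assumes fin: "finite I" and nonzero: "inner_on I w w \<noteq> 0"
  obtains u where "inner_on I u u = 1"
    "\<And>x. Re (sesq I A x x) \<le> Re (sesq I A u u) * Re (inner_on I x x)"
proof -
  define S where "S = {u. (\<forall>p. p \<notin> I \<longrightarrow> u p = 0) \<and> inner_on I u u = 1}"
  have normalise: "\<exists>y\<in>S. Re (sesq I A x x) = Re (sesq I A y y) * Re (inner_on I x x)"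
    if "inner_on I x x \<noteq> 0" for x
    by (rule sesq_normalised_vector[OF that, of A]) (auto simp: S_def)
  have continuous: "continuous_on S (\<lambda>u. Re (sesq I A u u))"
    by (intro continuous_on_Re continuous_on_sesq)
  have "compact S" unfolding S_def by (rule compact_unit_sphere_on[OF fin])
  moreover have "S \<noteq> {}" using normalise[OF nonzero] by blast
  ultimately obtain u where "u \<in> S" and max: "\<And>y. y \<in> S \<Longrightarrow> Re (sesq I A y y) \<le> Re (sesq I A u u)"
    using continuous_attains_sup[OF _ _ continuous] by blast
  have "Re (sesq I A x x) \<le> Re (sesq I A u u) * Re (inner_on I x x)" for x
  proof (cases "inner_on I x x = 0")
    case True
    then have "x p = 0" if "p \<in> I" for p using inner_on_self_eq_0D[OF fin] that by blast
    then show ?thesis using True by (simp add: sesq_def)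
  next
    case False
    then obtain y where "y \<in> S"
      and scaled: "Re (sesq I A x x) = Re (sesq I A y y) * Re (inner_on I x x)"
      using normalise by blast
    have "0 \<le> Re (inner_on I x x)" using inner_on_nonneg[of I x] by (simp add: less_eq_complex_def)
    then show ?thesis unfolding scaled by (rule mult_right_mono[OF max[OF \<open>y \<in> S\<close>]])
  qed
  moreover have "inner_on I u u = 1" using \<open>u \<in> S\<close> by (simp add: S_def)
  ultimately show ?thesis using that by blast
qed

lemma herm_kernel_positive_eigenvector:
  assumes fin: "finite I" and herm: "herm_kernel I A"
    and somewhere_positive: "0 < Re (sesq I A w w)"
  obtains u \<mu> where "0 < \<mu>" "inner_on I u u = 1"
    "\<And>p. p \<in> I \<Longrightarrow> kernel_app I A u p = of_real \<mu> * u p"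
proof -
  have "inner_on I w w \<noteq> 0"
  proof
    assume "inner_on I w w = 0"
    then have "w p = 0" if "p \<in> I" for p using inner_on_self_eq_0D[OF fin] that by blast
    then show False using somewhere_positive by (simp add: sesq_def)
  qed
  then obtain u where unit: "inner_on I u u = 1"
    and max: "\<And>x. Re (sesq I A x x) \<le> Re (sesq I A u u) * Re (inner_on I x x)"
    using herm_kernel_rayleigh_maximum[OF fin] by metis
  define \<mu> where "\<mu> = Re (sesq I A u u)"
  have "0 < \<mu> * Re (inner_on I w w)" using max[of w] somewhere_positive by (simp add: \<mu>_def)
  then have "0 < \<mu>"
    using inner_on_nonneg[of I w] by (simp add: less_eq_complex_def zero_less_mult_iff)
  define B where "B = \<mu> *\<^sub>R one_kernel - A"
  have "pos_kernel I B"
  proof (rule pos_kernelI_herm)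
    show "herm_kernel I B" unfolding B_def
      by (intro herm_kernel_diff herm_kernel_scaleR herm_kernel_one herm)
    show "0 \<le> Re (sesq I B v v)" for v
      using max[of v] by (simp add: B_def sesq_diff sesq_scaleR sesq_one[OF fin] \<mu>_def)
  qed
  moreover have "sesq I B u u = 0"
    using sesq_cnj[OF herm, of u u]
    by (simp add: B_def sesq_diff sesq_scaleR sesq_one[OF fin] unit \<mu>_def complex_eq_iff)
  ultimately have "kernel_app I B u p = 0" if "p \<in> I" for p
    by (rule pos_kernel_null_vector[OF fin _ _ that])
  then have "kernel_app I A u p = of_real \<mu> * u p" if "p \<in> I" for p
    using that by (simp add: B_def kernel_app_diff kernel_app_scaleR kernel_app_one[OF fin]
        scaleR_conv_of_real)
  with \<open>0 < \<mu>\<close> unit show ?thesis using that by blast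
qed

lemma pos_kernel_antisym:
  assumes fin: "finite I" and pos: "pos_kernel I A" "pos_kernel I (- A)"
  shows "A \<simeq>\<^bsub>I\<^esub> 0"
proof (rule kernel_eqI)
  fix p q assume indices: "p \<in> I" "q \<in> I"
  have "sesq I A w w = 0" for w
    using pos_kernelD[OF pos(1), of w] pos_kernelD[OF pos(2), of w] by (simp add: sesq_minus)
  then have "kernel_app I A (\<lambda>x. of_bool (x = q)) p = 0"
    by (rule pos_kernel_null_vector[OF fin pos(1) _ indices(1)])
  then show "A p q = 0 p q" by (simp add: kernel_app_delta[OF fin indices(2)])
qed

lemma herm_kernel_nonzero_eigenvector:
  assumes fin: "finite I" and herm: "herm_kernel I A" and nonzero: "\<not> A \<simeq>\<^bsub>I\<^esub> 0"
  obtains u \<mu> where "\<mu> \<noteq> 0" "inner_on I u u = 1"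
    "\<And>p. p \<in> I \<Longrightarrow> kernel_app I A u p = of_real \<mu> * u p"
proof -
  consider (positive) w where "0 < Re (sesq I A w w)" | (negative) w where "Re (sesq I A w w) < 0"
    | (zero) "\<And>w. Re (sesq I A w w) = 0" by (meson linorder_neqE)
  then show ?thesis
  proof cases
    case positive
    then show ?thesis using herm_kernel_positive_eigenvector[OF fin herm] that
      by (metis less_irrefl)
  next
    case negative
    have minus_A: "- A = (- 1) *\<^sub>R A" by (simp add: fun_eq_iff)
    have "herm_kernel I (- A)" unfolding minus_A by (rule herm_kernel_scaleR[OF herm])
    moreover have "0 < Re (sesq I (- A) w w)" using negative by (simp add: sesq_minus)
    ultimately obtain u \<mu> where eigenvector: "0 < \<mu>" "inner_on I u u = 1"
      "\<And>p. p \<in> I \<Longrightarrow> kernel_app I (- A) u p = of_real \<mu> * u p"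
      using herm_kernel_positive_eigenvector[OF fin] by metis
    then have "kernel_app I A u p = of_real (- \<mu>) * u p" if "p \<in> I" for p
      using that unfolding minus_A kernel_app_scaleR by (simp add: minus_equation_iff)
    then show ?thesis using eigenvector that[of "- \<mu>" u] by simp
  next
    case zero
    have "herm_kernel I (- A)"
      using herm_kernel_diff[OF _ herm, of 0] by (simp add: herm_kernelI)
    then have "pos_kernel I A" "pos_kernel I (- A)"
      using herm by (auto intro!: pos_kernelI_herm simp: zero sesq_minus)
    then show ?thesis using nonzero pos_kernel_antisym[OF fin] by blast
  qed
qed

lemma pos_kernel_orthonormal_complement:
  assumes fin: "finite I" and finite_J: "finite J" and orthonormal: "orthonormal_on I J v"
  shows "pos_kernel I (one_kernel - (\<Sum>j\<in>J. outer (v j) (v j)))"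
  unfolding pos_kernel_def
proof
  fix u
  define c where "c j = inner_on I (v j) u" for j
  define w where "w = u - (\<Sum>j\<in>J. (\<lambda>p. c j * v j p))"
  have orthogonal: "inner_on I (v k) w = 0" if member: "k \<in> J" for k
  proof -
    have "(\<Sum>j\<in>J. c j * inner_on I (v k) (v j)) = (\<Sum>j\<in>J. if j = k then c k else 0)"
      using orthonormal member by (intro sum.cong refl) (auto simp: orthonormal_on_def)
    then show ?thesis
      using member finite_J
      by (simp add: w_def inner_on_diff_right inner_on_sum_right inner_on_mult_right c_def)
  qed
  then have orthogonal_sym: "inner_on I w (v k) = 0" if "k \<in> J" for k
    using that by (metis complex_cnj_zero inner_on_cnj)
  have "inner_on I w w = inner_on I w u - (\<Sum>j\<in>J. c j * inner_on I w (v j))"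
    by (subst (2) w_def) (simp add: inner_on_diff_right inner_on_sum_right inner_on_mult_right)
  also have "\<dots> = inner_on I w u"
    using orthogonal_sym by simp
  also have "\<dots> = cnj (inner_on I u w)" by (simp add: inner_on_cnj)
  also have "\<dots> = sesq I (one_kernel - (\<Sum>j\<in>J. outer (v j) (v j))) u u"
    by (simp add: w_def inner_on_diff_right inner_on_sum_right inner_on_mult_right
        inner_on_mult_left inner_on_cnj c_def sesq_diff sesq_sum sesq_outer sesq_one[OF fin])
  finally show "0 \<le> sesq I (one_kernel - (\<Sum>j\<in>J. outer (v j) (v j))) u u"
    using inner_on_nonneg by metis
qed

lemma orthonormal_on_card_le:
  assumes "finite I" "finite J" "orthonormal_on I J v"
  shows "card J \<le> card I"
proof -
  have "0 \<le> kernel_trace I (one_kernel - (\<Sum>j\<in>J. outer (v j) (v j)))"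
    using assms by (intro pos_kernel_trace_nonneg pos_kernel_orthonormal_complement)
  also have "\<dots> = of_nat (card I) - of_nat (card J)"
    using assms(3)
    by (simp add: kernel_trace_diff kernel_trace_one kernel_trace_sum kernel_trace_outer
        orthonormal_on_def)
  finally show ?thesis by (simp add: less_eq_complex_def)
qed

lemma herm_kernel_eigenvectors_orthogonal:
  assumes "finite I" "herm_kernel I A" "\<And>p. p \<in> I \<Longrightarrow> kernel_app I A v p = 0"
    "\<And>p. p \<in> I \<Longrightarrow> kernel_app I A u p = of_real \<mu> * u p" "\<mu> \<noteq> 0"
  shows "inner_on I v u = 0"
proof -
  have "of_real \<mu> * inner_on I v u = sesq I A v u"
    using assms(4) by (simp add: sesq_eq_inner_on inner_on_def sum_distrib_left mult_ac)
  also have "\<dots> = inner_on I (kernel_app I A v) u" by (simp add: inner_on_kernel_app[OF assms(2)])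
  also have "\<dots> = 0" using assms(3) by (simp add: inner_on_def)
  finally show ?thesis using assms(5) by simp
qed

lemma kernel_app_orthonormal_sum:
  assumes "orthonormal_on I J v" "finite J" "k \<in> J"
  shows "kernel_app I (\<Sum>j\<in>J. c j *\<^sub>R outer (v j) (v j)) (v k) = (\<lambda>p. of_real (c k) * v k p)"
proof
  fix p
  have "kernel_app I (\<Sum>j\<in>J. c j *\<^sub>R outer (v j) (v j)) (v k) p =
      (\<Sum>j\<in>J. c j *\<^sub>R (inner_on I (v j) (v k) * v j p))"
    by (simp add: kernel_app_sum kernel_app_scaleR kernel_app_outer)
  also have "\<dots> = (\<Sum>j\<in>J. if j = k then of_real (c k) * v k p else 0)"
    using assms by (intro sum.cong refl) (auto simp: orthonormal_on_def scaleR_conv_of_real)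
  finally show "kernel_app I (\<Sum>j\<in>J. c j *\<^sub>R outer (v j) (v j)) (v k) p = of_real (c k) * v k p"
    using assms by simp
qed

definition eigenfamily :: "'i set \<Rightarrow> 'i kernel \<Rightarrow> nat \<Rightarrow> (nat \<Rightarrow> 'i \<Rightarrow> complex) \<Rightarrow> (nat \<Rightarrow> real) \<Rightarrow> bool"
  where
  "eigenfamily I A k v d \<longleftrightarrow> orthonormal_on I {..<k} v \<and>
     (\<forall>j<k. \<forall>p\<in>I. kernel_app I A (v j) p = of_real (d j) * v j p)"

lemma eigenfamily_extend:
  assumes "eigenfamily I A k v d" "inner_on I u u = 1" "\<And>j. j < k \<Longrightarrow> inner_on I (v j) u = 0"
    "\<And>p. p \<in> I \<Longrightarrow> kernel_app I A u p = of_real \<mu> * u p"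
  shows "eigenfamily I A (Suc k) (v(k := u)) (d(k := \<mu>))"
proof -
  have "inner_on I u (v j) = 0" if "j < k" for j
    using assms(3)[OF that] by (metis complex_cnj_zero inner_on_cnj)
  then show ?thesis
    using assms unfolding eigenfamily_def orthonormal_on_def by (auto simp: less_Suc_eq)
qed

lemma maximal_eigenfamily:
  assumes fin: "finite I"
  obtains k v d where "eigenfamily I A k v d" "\<And>v' d'. \<not> eigenfamily I A (Suc k) v' d'"
proof -
  let ?ex = "\<lambda>k. \<exists>v d. eigenfamily I A k v d"
  have bound: "k \<le> card I" if "?ex k" for k
    using that orthonormal_on_card_le[OF fin, of "{..<k}"] by (auto simp: eigenfamily_def)
  have "?ex 0" by (simp add: eigenfamily_def orthonormal_on_def)
  then have "?ex (Greatest ?ex)" by (rule GreatestI_nat) (use bound in blast)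
  moreover have "\<not> ?ex (Suc (Greatest ?ex))"
  proof
    assume "?ex (Suc (Greatest ?ex))"
    then have "Suc (Greatest ?ex) \<le> Greatest ?ex" by (rule Greatest_le_nat) (use bound in blast)
    then show False by simp
  qed
  ultimately show ?thesis using that by blast
qed

lemma maximal_eigenfamily_complement:
  assumes fin: "finite I" and eigenfamily: "eigenfamily I A k v d"
    and maximal: "\<And>v' d'. \<not> eigenfamily I A (Suc k) v' d'"
    and herm: "herm_kernel I B" and kernel: "\<And>j p. j < k \<Longrightarrow> p \<in> I \<Longrightarrow> kernel_app I B (v j) p = 0"
    and eigenvector: "\<And>u \<mu>. (\<And>j. j < k \<Longrightarrow> inner_on I (v j) u = 0) \<Longrightarrow>
      (\<And>p. p \<in> I \<Longrightarrow> kernel_app I B u p = of_real \<mu> * u p) \<Longrightarrow>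
      \<exists>\<nu>. \<forall>p\<in>I. kernel_app I A u p = of_real \<nu> * u p"
  shows "B \<simeq>\<^bsub>I\<^esub> 0"
proof (rule ccontr)
  assume "\<not> B \<simeq>\<^bsub>I\<^esub> 0"
  then obtain u \<mu> where new_eigenvector: "\<mu> \<noteq> 0" "inner_on I u u = 1"
    "\<And>p. p \<in> I \<Longrightarrow> kernel_app I B u p = of_real \<mu> * u p"
    using herm_kernel_nonzero_eigenvector[OF fin herm] by metis
  have orthogonal: "inner_on I (v j) u = 0" if "j < k" for j
    by (rule herm_kernel_eigenvectors_orthogonal[OF fin herm kernel[OF that] new_eigenvector(3,1)])
  then obtain \<nu> where "\<And>p. p \<in> I \<Longrightarrow> kernel_app I A u p = of_real \<nu> * u p"
    using eigenvector[OF _ new_eigenvector(3)] by blast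
  then show False using eigenfamily_extend[OF eigenfamily new_eigenvector(2) orthogonal] maximal
    by blast
qed

text \<open>A maximal eigenfamily exhausts \<open>A\<close>: an eigenvector of the remainder \<open>A - \<Sum>\<^sub>j d\<^sub>j v\<^sub>j v\<^sub>j\<^sup>*\<close>, or of the
  complementary projection once the remainder vanishes, would extend it.\<close>

theorem herm_kernel_spectral:
  assumes fin: "finite I" and herm: "herm_kernel I A"
  obtains J :: "nat set" and v d where "finite J" "orthonormal_on I J v"
    "one_kernel \<simeq>\<^bsub>I\<^esub> (\<Sum>j\<in>J. outer (v j) (v j))" "A \<simeq>\<^bsub>I\<^esub> (\<Sum>j\<in>J. d j *\<^sub>R outer (v j) (v j))"
proof -
  obtain k v d where family: "eigenfamily I A k v d"
    and maximal: "\<And>v' d'. \<not> eigenfamily I A (Suc k) v' d'"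
    by (rule maximal_eigenfamily[OF fin]) blast
  then have orthonormal: "orthonormal_on I {..<k} v"
    and eigen: "\<And>j p. j < k \<Longrightarrow> p \<in> I \<Longrightarrow> kernel_app I A (v j) p = of_real (d j) * v j p"
    by (auto simp: eigenfamily_def)
  define S where "S = (\<Sum>j<k. d j *\<^sub>R outer (v j) (v j))"
  define P where "P = (\<Sum>j<k. 1 *\<^sub>R outer (v j) (v j))"
  have vanish: "kernel_app I S u p = 0" "kernel_app I P u p = 0"
    if "\<And>j. j < k \<Longrightarrow> inner_on I (v j) u = 0" for u p
    using that by (simp_all add: S_def P_def kernel_app_sum kernel_app_scaleR kernel_app_outer)
  have remainder: "A - S \<simeq>\<^bsub>I\<^esub> 0"
  proof (rule maximal_eigenfamily_complement[OF fin family maximal])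
    show "herm_kernel I (A - S)"
      unfolding S_def by (intro herm_kernel_diff herm_kernel_sum herm_kernel_scaleR
          herm_kernel_outer herm)
    show "kernel_app I (A - S) (v j) p = 0" if "j < k" "p \<in> I" for j p
      using kernel_app_orthonormal_sum[OF orthonormal, of j] eigen that
      by (simp add: S_def kernel_app_diff)
    show "\<exists>\<nu>. \<forall>p\<in>I. kernel_app I A u p = of_real \<nu> * u p"
      if "\<And>j. j < k \<Longrightarrow> inner_on I (v j) u = 0"
        "\<And>p. p \<in> I \<Longrightarrow> kernel_app I (A - S) u p = of_real \<mu> * u p" for u \<mu>
      using that(2) vanish(1)[OF that(1)] by (auto simp: kernel_app_diff intro!: exI[of _ \<mu>])
  qed
  have complement: "one_kernel - P \<simeq>\<^bsub>I\<^esub> 0"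
  proof (rule maximal_eigenfamily_complement[OF fin family maximal])
    show "herm_kernel I (one_kernel - P)"
      unfolding P_def by (intro herm_kernel_diff herm_kernel_sum herm_kernel_scaleR
          herm_kernel_outer herm_kernel_one)
    show "kernel_app I (one_kernel - P) (v j) p = 0" if "j < k" "p \<in> I" for j p
      using kernel_app_orthonormal_sum[OF orthonormal, of j "\<lambda>_. 1"] that
      by (simp add: P_def kernel_app_diff kernel_app_one[OF fin])
    show "\<exists>\<nu>. \<forall>p\<in>I. kernel_app I A u p = of_real \<nu> * u p"
      if "\<And>j. j < k \<Longrightarrow> inner_on I (v j) u = 0" for u
      using kernel_app_cong[OF remainder, of _ u] vanish(1)[OF that]
      by (intro exI[of _ 0]) (simp add: kernel_app_diff, simp add: kernel_app_def)
  qed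
  show ?thesis
    by (rule that[OF _ orthonormal])
      (use remainder complement in \<open>auto simp: kernel_eq_def S_def P_def\<close>)
qed

subsection \<open>Gram decompositions and traces of positive kernels\<close>

lemma sesq_orthonormal_sum:
  assumes "orthonormal_on I J v" "finite J" "k \<in> J"
  shows "sesq I (\<Sum>j\<in>J. c j *\<^sub>R outer (v j) (v j)) (v k) (v k) = of_real (c k)"
  using assms(1,3) kernel_app_orthonormal_sum[OF assms, of c]
  by (simp add: sesq_eq_inner_on inner_on_mult_right orthonormal_on_def)

lemma kernel_trace_orthonormal_sum:
  assumes "orthonormal_on I J v"
  shows "kernel_trace I (\<Sum>j\<in>J. c j *\<^sub>R outer (v j) (v j)) = of_real (\<Sum>j\<in>J. c j)"
  using assms
  by (simp add: kernel_trace_sum kernel_trace_scaleR kernel_trace_outer orthonormal_on_def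
      scaleR_conv_of_real)

lemma pos_kernel_spectral:
  assumes fin: "finite I" and pos: "pos_kernel I A"
  obtains J :: "nat set" and v d where "finite J" "orthonormal_on I J v"
    "one_kernel \<simeq>\<^bsub>I\<^esub> (\<Sum>j\<in>J. outer (v j) (v j))" "A \<simeq>\<^bsub>I\<^esub> (\<Sum>j\<in>J. d j *\<^sub>R outer (v j) (v j))"
    "\<And>j. j \<in> J \<Longrightarrow> 0 \<le> d j"
proof -
  obtain J :: "nat set" and v d where spectral: "finite J" "orthonormal_on I J v"
    "one_kernel \<simeq>\<^bsub>I\<^esub> (\<Sum>j\<in>J. outer (v j) (v j))" "A \<simeq>\<^bsub>I\<^esub> (\<Sum>j\<in>J. d j *\<^sub>R outer (v j) (v j))"
    by (rule herm_kernel_spectral[OF fin pos_kernel_herm[OF fin pos]])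
  have "0 \<le> d j" if "j \<in> J" for j
    using pos_kernelD[OF pos, of "v j"]
    unfolding sesq_cong[OF spectral(4)] sesq_orthonormal_sum[OF spectral(2,1) that]
    by (simp add: less_eq_complex_def)
  with spectral show ?thesis by (rule that)
qed

lemma pos_kernel_gram:
  assumes "finite I" "pos_kernel I A"
  obtains J :: "nat set" and g where "finite J" "A \<simeq>\<^bsub>I\<^esub> (\<Sum>j\<in>J. outer (g j) (g j))"
proof -
  obtain J :: "nat set" and v d where spectral: "finite J" "A \<simeq>\<^bsub>I\<^esub> (\<Sum>j\<in>J. d j *\<^sub>R outer (v j) (v j))"
    and d_nonneg: "\<And>j. j \<in> J \<Longrightarrow> 0 \<le> d j"
    by (rule pos_kernel_spectral[OF assms]) blast
  define g where "g j p = of_real (sqrt (d j)) * v j p" for j p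
  have "d j *\<^sub>R outer (v j) (v j) = outer (g j) (g j)" if "j \<in> J" for j
  proof (intro ext)
    fix p q
    have "of_real (d j) = of_real (sqrt (d j)) * complex_of_real (sqrt (d j))"
      using d_nonneg[OF that] by (simp flip: of_real_mult)
    then show "(d j *\<^sub>R outer (v j) (v j)) p q = outer (g j) (g j) p q"
      by (simp add: outer_def g_def scaleR_conv_of_real)
  qed
  then have "(\<Sum>j\<in>J. d j *\<^sub>R outer (v j) (v j)) = (\<Sum>j\<in>J. outer (g j) (g j))" by simp
  with spectral that show ?thesis by metis
qed

lemma kernel_pair_nonneg:
  assumes fin: "finite I" and pos: "pos_kernel I A" "pos_kernel I B"
  shows "0 \<le> kernel_pair I A B"
proof -
  obtain J :: "nat set" and g where g_expansion: "B \<simeq>\<^bsub>I\<^esub> (\<Sum>j\<in>J. outer (g j) (g j))"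
    using pos_kernel_gram[OF fin pos(2)] by blast
  show ?thesis
    unfolding kernel_pair_cong[OF kernel_eq_refl g_expansion] kernel_pair_sum_right
      kernel_pair_outer
    by (intro sum_nonneg pos_kernelD[OF pos(1)])
qed

lemma kernel_pair_mono:
  assumes "finite I" "pos_kernel I A" "pos_kernel I (C - B)"
  shows "Re (kernel_pair I A B) \<le> Re (kernel_pair I A C)"
  using kernel_pair_nonneg[OF assms] by (simp add: kernel_pair_diff_right less_eq_complex_def)

lemma pos_kernel_le_trace:
  assumes fin: "finite I" and pos: "pos_kernel I A"
  shows "pos_kernel I (Re (kernel_trace I A) *\<^sub>R one_kernel - A)"
proof -
  obtain J :: "nat set" and v d where basis: "finite J" "orthonormal_on I J v"
    and one: "one_kernel \<simeq>\<^bsub>I\<^esub> (\<Sum>j\<in>J. outer (v j) (v j))"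
    and A_expansion: "A \<simeq>\<^bsub>I\<^esub> (\<Sum>j\<in>J. d j *\<^sub>R outer (v j) (v j))"
    and d_nonneg: "\<And>j. j \<in> J \<Longrightarrow> 0 \<le> d j"
    by (rule pos_kernel_spectral[OF assms]) blast
  define t where "t = Re (kernel_trace I A)"
  have trace_eq: "t = (\<Sum>j\<in>J. d j)"
    unfolding t_def kernel_trace_cong[OF A_expansion] kernel_trace_orthonormal_sum[OF basis(2)]
    by simp
  have "pos_kernel I (\<Sum>j\<in>J. (t - d j) *\<^sub>R outer (v j) (v j))"
    using basis(1) d_nonneg
    by (intro pos_kernel_sum pos_kernel_scaleR pos_kernel_outer)
      (auto simp: trace_eq intro: member_le_sum)
  moreover have "(\<Sum>j\<in>J. (t - d j) *\<^sub>R outer (v j) (v j)) =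
      t *\<^sub>R (\<Sum>j\<in>J. outer (v j) (v j)) - (\<Sum>j\<in>J. d j *\<^sub>R outer (v j) (v j))"
    by (simp add: scaleR_sum_right scaleR_left_diff_distrib sum_subtractf)
  ultimately show ?thesis
    using pos_kernel_cong[OF kernel_eq_diff[OF kernel_eq_scaleR[OF one] A_expansion]]
    by (simp add: t_def)
qed

lemma kernel_pair_le_trace:
  assumes "finite I" "pos_kernel I A" "pos_kernel I B"
  shows "Re (kernel_pair I A B) \<le> Re (kernel_trace I A) * Re (kernel_trace I B)"
  using kernel_pair_mono[OF assms(1,2) pos_kernel_le_trace[OF assms(1,3)]]
  by (simp add: kernel_pair_scaleR_right kernel_pair_one[OF assms(1)] mult.commute)

lemma pos_kernel_trace_eq_0:
  assumes "finite I" "pos_kernel I A" "kernel_trace I A = 0"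
  shows "A \<simeq>\<^bsub>I\<^esub> 0"
  using pos_kernel_antisym[OF assms(1,2)] pos_kernel_le_trace[OF assms(1,2)] assms(3) by simp

lemma density_kernel_normalise:
  assumes "finite I" "pos_kernel I A" "\<not> A \<simeq>\<^bsub>I\<^esub> 0"
  shows "0 < Re (kernel_trace I A)" "density_kernel I ((1 / Re (kernel_trace I A)) *\<^sub>R A)"
proof -
  define t where "t = Re (kernel_trace I A)"
  have trace: "kernel_trace I A = of_real t" "0 \<le> t"
    using pos_kernel_trace_nonneg[OF assms(1,2)]
    by (auto simp: t_def less_eq_complex_def complex_eq_iff)
  have "t \<noteq> 0" using pos_kernel_trace_eq_0[OF assms(1,2)] trace(1) assms(3) by auto
  then have "0 < t" using trace(2) by simp
  then show "0 < Re (kernel_trace I A)" "density_kernel I ((1 / Re (kernel_trace I A)) *\<^sub>R A)"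
    using assms(2)
    by (simp_all add: density_kernel_def pos_kernel_scaleR kernel_trace_scaleR trace(1)
        scaleR_conv_of_real)
qed

lemma pos_kernel_bessel:
  assumes fin: "finite I" "finite J" and pos: "pos_kernel I A"
    and orthonormal: "orthonormal_on I J u"
  shows "(\<Sum>j\<in>J. Re (sesq I A (u j) (u j))) \<le> Re (kernel_trace I A)"
proof -
  have "inner_on I (cnj \<circ> x) (cnj \<circ> y) = cnj (inner_on I x y)" for x y
    by (simp add: inner_on_def)
  then have "orthonormal_on I J (\<lambda>j. cnj \<circ> u j)"
    using orthonormal by (simp add: orthonormal_on_def)
  from kernel_pair_mono[OF fin(1) pos pos_kernel_orthonormal_complement[OF fin this]]
  show ?thesis
    by (simp add: kernel_pair_sum_right kernel_pair_outer kernel_pair_one[OF fin(1)] o_def)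
qed

section \<open>Square roots and singular values\<close>

lemma kernel_app_mult: "kernel_app I (kernel_mult I A B) v = kernel_app I A (kernel_app I B v)"
proof
  fix p
  have "kernel_app I (kernel_mult I A B) v p = (\<Sum>q\<in>I. \<Sum>r\<in>I. A p r * B r q * v q)"
    by (simp add: kernel_app_def kernel_mult_def sum_distrib_right)
  also have "\<dots> = (\<Sum>r\<in>I. \<Sum>q\<in>I. A p r * B r q * v q)" by (rule sum.swap)
  finally show "kernel_app I (kernel_mult I A B) v p = kernel_app I A (kernel_app I B v) p"
    by (simp add: kernel_app_def sum_distrib_left mult.assoc)
qed

lemma inner_on_kernel_app_adjoint:
  "inner_on I (kernel_app I A u) (kernel_app I A v) =
      sesq I (kernel_mult I (kernel_adjoint A) A) u v"
proof -
  have "inner_on I (kernel_app I A u) w = inner_on I u (kernel_app I (kernel_adjoint A) w)" for w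
    unfolding inner_on_def kernel_app_def kernel_adjoint_def cnj_sum sum_distrib_left
      sum_distrib_right
    by (subst sum.swap) (simp add: mult_ac)
  then show ?thesis by (simp add: sesq_eq_inner_on kernel_app_mult)
qed

lemma kernel_adjoint_sum: "kernel_adjoint (\<Sum>k\<in>K. A k) = (\<Sum>k\<in>K. kernel_adjoint (A k))"
  by (simp add: kernel_adjoint_def fun_eq_iff)

lemma kernel_adjoint_scaleR_outer: "kernel_adjoint (c *\<^sub>R outer u v) = c *\<^sub>R outer v u"
  by (simp add: kernel_adjoint_def outer_def fun_eq_iff)

lemma kernel_mult_orthonormal_sum:
  assumes "finite J" "orthonormal_on I J v"
  shows "kernel_mult I (\<Sum>j\<in>J. a j *\<^sub>R outer (u j) (v j)) (\<Sum>j\<in>J. b j *\<^sub>R outer (v j) (w j)) =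
    (\<Sum>j\<in>J. (a j * b j) *\<^sub>R outer (u j) (w j))"
proof (intro ext)
  fix p q
  have "kernel_mult I (\<Sum>j\<in>J. a j *\<^sub>R outer (u j) (v j)) (\<Sum>j\<in>J. b j *\<^sub>R outer (v j) (w j)) p q =
      (\<Sum>r\<in>I. \<Sum>j\<in>J. \<Sum>k\<in>J. of_real (a j * b k) * outer (u j) (w k) p q * (cnj (v j r) * v k r))"
    by (simp add: kernel_mult_def outer_def sum_product scaleR_conv_of_real mult_ac)
  also have "\<dots> = (\<Sum>j\<in>J. \<Sum>k\<in>J. of_real (a j * b k) * outer (u j) (w k) p q * inner_on I (v j) (v k))"
    unfolding inner_on_def sum_distrib_left by (subst sum.swap, intro sum.cong refl sum.swap)
  also have "\<dots> = (\<Sum>j\<in>J. \<Sum>k\<in>J. if k = j then of_real (a j * b j) * outer (u j) (w j) p q else 0)"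
    using assms(2) by (intro sum.cong refl) (auto simp: orthonormal_on_def)
  finally show "kernel_mult I (\<Sum>j\<in>J. a j *\<^sub>R outer (u j) (v j)) (\<Sum>j\<in>J. b j *\<^sub>R outer (v j) (w j)) p
        q =
      (\<Sum>j\<in>J. (a j * b j) *\<^sub>R outer (u j) (w j)) p q"
    using assms(1) by (simp add: scaleR_conv_of_real)
qed

lemma kernel_eq_orthonormal_expansion:
  assumes "finite I" "one_kernel \<simeq>\<^bsub>I\<^esub> (\<Sum>j\<in>J. outer (v j) (v j))"
  shows "A \<simeq>\<^bsub>I\<^esub> (\<Sum>j\<in>J. outer (kernel_app I A (v j)) (v j))"
proof (rule kernel_eqI)
  fix p q assume indices: "p \<in> I" "q \<in> I"
  have "A p q = (\<Sum>r\<in>I. A p r * one_kernel r q)"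
    using assms(1) indices by (simp add: one_kernel_def sum_mult_of_bool_eq)
  also have "\<dots> = (\<Sum>r\<in>I. \<Sum>j\<in>J. A p r * outer (v j) (v j) r q)"
    using kernel_eqD[OF assms(2) _ indices(2)] by (simp add: sum_distrib_left)
  also have "\<dots> = (\<Sum>j\<in>J. \<Sum>r\<in>I. A p r * outer (v j) (v j) r q)" by (rule sum.swap)
  finally show "A p q = (\<Sum>j\<in>J. outer (kernel_app I A (v j)) (v j)) p q"
    by (simp add: kernel_app_def outer_def sum_distrib_right mult.assoc)
qed

lemma pos_kernel_eigenvector_of_square:
  assumes fin: "finite I" and pos: "pos_kernel I B" and "0 \<le> c"
    and square: "\<And>p. p \<in> I \<Longrightarrow> kernel_app I (kernel_mult I B B) w p = of_real (c * c) * w p"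
    and "p \<in> I"
  shows "kernel_app I B w p = of_real c * w p"
proof -
  have herm: "herm_kernel I B" by (rule pos_kernel_herm[OF fin pos])
  define y where "y = kernel_app I B w - (\<lambda>p. of_real c * w p)"
  have negative_eigenvector: "kernel_app I B y p = - of_real c * y p" if "p \<in> I" for p
  proof -
    have "kernel_app I B y p =
        kernel_app I (kernel_mult I B B) w p - of_real c * kernel_app I B w p"
      unfolding kernel_app_mult unfolding y_def
      by (simp add: kernel_app_def algebra_simps sum_subtractf sum_distrib_left)
    then show ?thesis using square[OF that] by (simp add: y_def algebra_simps)
  qed
  have "inner_on I y y = 0"
  proof (cases "c = 0")
    case True
    have "sesq I B w y = inner_on I (kernel_app I B w) y"
      by (simp add: inner_on_kernel_app[OF herm])
    moreover have "sesq I B w y = 0"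
      using negative_eigenvector by (simp add: sesq_eq_inner_on inner_on_def True)
    ultimately show ?thesis by (simp add: True y_def fun_diff_def)
  next
    case False
    have "sesq I B y y = - of_real c * inner_on I y y"
      using negative_eigenvector
      by (simp add: sesq_eq_inner_on inner_on_def sum_distrib_left sum_negf mult_ac)
    moreover have "0 \<le> sesq I B y y" by (rule pos_kernelD[OF pos])
    ultimately show ?thesis
      using inner_on_nonneg[of I y] False \<open>0 \<le> c\<close>
      by (auto simp: less_eq_complex_def complex_eq_iff mult_le_0_iff)
  qed
  then have "y p = 0" by (rule inner_on_self_eq_0D[OF fin _ \<open>p \<in> I\<close>])
  then show ?thesis by (simp add: y_def)
qed

lemma pos_kernel_sqrt_unique:
  assumes fin: "finite I" and pos_B: "pos_kernel I B" and pos_C: "pos_kernel I C"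
    and square: "kernel_mult I B B \<simeq>\<^bsub>I\<^esub> kernel_mult I C C"
  shows "B \<simeq>\<^bsub>I\<^esub> C"
proof -
  obtain J :: "nat set" and v c where basis: "finite J" "orthonormal_on I J v"
    and one: "one_kernel \<simeq>\<^bsub>I\<^esub> (\<Sum>j\<in>J. outer (v j) (v j))"
    and C_sum: "C \<simeq>\<^bsub>I\<^esub> (\<Sum>j\<in>J. c j *\<^sub>R outer (v j) (v j))"
    and c_nonneg: "\<And>j. j \<in> J \<Longrightarrow> 0 \<le> c j"
    by (rule pos_kernel_spectral[OF fin pos_C]) blast
  have "kernel_app I B (v j) p = of_real (c j) * v j p" if "j \<in> J" "p \<in> I" for j p
  proof (rule pos_kernel_eigenvector_of_square[OF fin pos_B c_nonneg[OF that(1)] _ that(2)])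
    have "kernel_mult I B B \<simeq>\<^bsub>I\<^esub> (\<Sum>j\<in>J. (c j * c j) *\<^sub>R outer (v j) (v j))"
      using kernel_eq_trans[OF square kernel_mult_cong[OF C_sum C_sum]]
      unfolding kernel_mult_orthonormal_sum[OF basis] .
    then show "kernel_app I (kernel_mult I B B) (v j) p = of_real (c j * c j) * v j p"
      if "p \<in> I" for p
      using kernel_app_cong[OF _ that]
      by (simp only: kernel_app_orthonormal_sum[OF basis(2,1) \<open>j \<in> J\<close>])
  qed
  then have "(\<Sum>j\<in>J. outer (kernel_app I B (v j)) (v j)) \<simeq>\<^bsub>I\<^esub> (\<Sum>j\<in>J. c j *\<^sub>R outer (v j) (v j))"
    by (intro kernel_eqI) (simp add: outer_def scaleR_conv_of_real mult.assoc)
  from kernel_eq_trans[OF kernel_eq_orthonormal_expansion[OF fin one] this]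
  show ?thesis by (rule kernel_eq_trans[OF _ kernel_eq_sym[OF C_sum]])
qed

lemma orthonormal_on_normalised:
  assumes "\<And>j k. j \<in> J \<Longrightarrow> k \<in> J \<Longrightarrow> inner_on I (w j) (w k) = of_real (d k) * of_bool (j = k)"
    and "\<And>j. j \<in> J \<Longrightarrow> 0 < d j"
  shows "orthonormal_on I J (\<lambda>j p. of_real (1 / sqrt (d j)) * w j p)"
  unfolding orthonormal_on_def
proof (intro ballI)
  fix j k assume "j \<in> J" "k \<in> J"
  then have "inner_on I (\<lambda>p. of_real (1 / sqrt (d j)) * w j p)
        (\<lambda>p. of_real (1 / sqrt (d k)) * w k p) =
      of_real (1 / sqrt (d j)) * (of_real (1 / sqrt (d k)) * (of_real (d k) * of_bool (j = k)))"
    using assms(1) unfolding inner_on_mult_left inner_on_mult_right by simp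
  also have "\<dots> = of_bool (j = k)"
    using assms(2)[OF \<open>k \<in> J\<close>]
    by (cases "j = k") (auto simp: real_div_sqrt simp flip: of_real_mult of_real_divide)
  finally show "inner_on I (\<lambda>p. of_real (1 / sqrt (d j)) * w j p)
        (\<lambda>p. of_real (1 / sqrt (d k)) * w k p) = of_bool (j = k)" .
qed

lemma kernel_svd:
  assumes fin: "finite I"
  obtains J :: "nat set" and u v s where "finite J" "orthonormal_on I J u" "orthonormal_on I J v"
    "\<And>j. j \<in> J \<Longrightarrow> 0 < s j" "A \<simeq>\<^bsub>I\<^esub> (\<Sum>j\<in>J. s j *\<^sub>R outer (u j) (v j))"
proof -
  define N where "N = kernel_mult I (kernel_adjoint A) A"
  have "pos_kernel I N"
    by (simp add: N_def pos_kernel_def inner_on_nonneg flip: inner_on_kernel_app_adjoint)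
  then obtain J0 :: "nat set" and v d where finite: "finite J0"
    and orthonormal: "orthonormal_on I J0 v"
    and one: "one_kernel \<simeq>\<^bsub>I\<^esub> (\<Sum>j\<in>J0. outer (v j) (v j))"
    and N_sum: "N \<simeq>\<^bsub>I\<^esub> (\<Sum>j\<in>J0. d j *\<^sub>R outer (v j) (v j))"
    and d_nonneg: "\<And>j. j \<in> J0 \<Longrightarrow> 0 \<le> d j"
    by (rule pos_kernel_spectral[OF fin]) blast
  define J where "J = {j \<in> J0. 0 < d j}"
  define u where "u j p = of_real (1 / sqrt (d j)) * kernel_app I A (v j) p" for j p
  have gram: "inner_on I (kernel_app I A (v j)) (kernel_app I A (v k)) =
      of_real (d k) * of_bool (j = k)"
    if "j \<in> J0" "k \<in> J0" for j k
    unfolding inner_on_kernel_app_adjoint N_def[symmetric] sesq_cong[OF N_sum]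
    unfolding sesq_eq_inner_on kernel_app_orthonormal_sum[OF orthonormal finite that(2)]
    using orthonormal that by (simp add: inner_on_mult_right orthonormal_on_def)
  have "orthonormal_on I J u"
    unfolding u_def[abs_def] by (rule orthonormal_on_normalised) (auto simp: gram J_def)
  moreover have "orthonormal_on I J v" using orthonormal by (simp add: orthonormal_on_def J_def)
  moreover have "A \<simeq>\<^bsub>I\<^esub> (\<Sum>j\<in>J. sqrt (d j) *\<^sub>R outer (u j) (v j))"
  proof (rule kernel_eqI)
    fix p q assume indices: "p \<in> I" "q \<in> I"
    have "kernel_app I A (v j) p = 0" if "j \<in> J0 - J" for j
    proof (rule inner_on_self_eq_0D[OF fin _ indices(1)])
      show "inner_on I (kernel_app I A (v j)) (kernel_app I A (v j)) = 0"
        using gram[of j j] that d_nonneg[of j] by (simp add: J_def)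
    qed
    then have "(\<Sum>j\<in>J. outer (kernel_app I A (v j)) (v j) p q) =
        (\<Sum>j\<in>J0. outer (kernel_app I A (v j)) (v j) p q)"
      using finite by (intro sum.mono_neutral_left) (auto simp: J_def outer_def)
    also have "\<dots> = A p q"
      using kernel_eqD[OF kernel_eq_orthonormal_expansion[OF fin one, of A] indices] by simp
    finally show "A p q = (\<Sum>j\<in>J. sqrt (d j) *\<^sub>R outer (u j) (v j)) p q"
      by (simp add: outer_def u_def J_def scaleR_conv_of_real)
  qed
  ultimately show ?thesis
    using that[of J u v "\<lambda>j. sqrt (d j)"] finite by (simp add: J_def)
qed

section \<open>Separation from the positive cone\<close>

lemma inner_on_add_scaleR_self:
  "Re (inner_on X (u + t *\<^sub>R z) (u + t *\<^sub>R z)) =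
    Re (inner_on X u u) + t * (2 * Re (inner_on X u z) + t * Re (inner_on X z z))"
proof -
  have "Re (inner_on X z u) = Re (inner_on X u z)" by (metis cnj.sel(1) inner_on_cnj)
  moreover have "inner_on X (u + t *\<^sub>R z) (u + t *\<^sub>R z) =
      inner_on X u u + of_real t * (inner_on X u z + inner_on X z u + of_real t * inner_on X z z)"
    by (simp add: inner_on_def scaleR_conv_of_real algebra_simps sum.distrib sum_distrib_left)
  ultimately show ?thesis by simp
qed

lemma inner_on_parallelogram:
  "Re (inner_on X (x - y) (x - y)) + 4 * Re (inner_on X ((1/2) *\<^sub>R (x + y)) ((1/2) *\<^sub>R (x + y))) =
    2 * Re (inner_on X x x) + 2 * Re (inner_on X y y)"
proof -
  have "4 * inner_on X ((1/2) *\<^sub>R (x + y)) ((1/2) *\<^sub>R (x + y)) = inner_on X (x + y) (x + y)"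
    by (simp add: inner_on_def sum_distrib_left scaleR_conv_of_real)
  then have "4 * Re (inner_on X ((1/2) *\<^sub>R (x + y)) ((1/2) *\<^sub>R (x + y))) =
      Re (inner_on X (x + y) (x + y))"
    by (simp add: complex_eq_iff)
  then show ?thesis
    using inner_on_add_scaleR_self[of X x 1 y] inner_on_add_scaleR_self[of X x "- 1" y] by simp
qed

lemma minimising_sequence:
  fixes C :: "('a \<Rightarrow> complex) set"
  assumes "C \<noteq> {}"
  obtains x \<mu> where "\<And>n. x n \<in> C" "\<And>n. Re (inner_on X (x n) (x n)) \<le> \<mu> + inverse (real (Suc n))"
    "\<And>y. y \<in> C \<Longrightarrow> \<mu> \<le> Re (inner_on X y y)"
proof -
  let ?norms = "(\<lambda>x. Re (inner_on X x x)) ` C"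
  have bounded: "bdd_below ?norms"
    using inner_on_nonneg[of X] by (intro bdd_belowI[of _ 0]) (auto simp: less_eq_complex_def)
  have "\<exists>x\<in>C. Re (inner_on X x x) < Inf ?norms + inverse (real (Suc n))" for n
    using cInf_less_iff[of ?norms "Inf ?norms + inverse (real (Suc n))"] bounded assms by auto
  then obtain x where sequence: "\<And>n. x n \<in> C"
    "\<And>n. Re (inner_on X (x n) (x n)) < Inf ?norms + inverse (real (Suc n))"
    by metis
  show ?thesis
  proof (rule that[OF sequence(1)])
    show "Re (inner_on X (x n) (x n)) \<le> Inf ?norms + inverse (real (Suc n))" for n
      by (rule less_imp_le[OF sequence(2)])
    show "Inf ?norms \<le> Re (inner_on X y y)" if "y \<in> C" for y
      using bounded that by (intro cInf_lower) auto
  qed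
qed

lemma minimising_sequence_close:
  assumes fin: "finite X" and convex: "convex C" and in_C: "\<And>n. x n \<in> C"
    and minimising: "\<And>n. Re (inner_on X (x n) (x n)) \<le> \<mu> + inverse (real (Suc n))"
      "\<And>y. y \<in> C \<Longrightarrow> \<mu> \<le> Re (inner_on X y y)"
    and "N \<le> k" "N \<le> l" "i \<in> X"
  shows "(cmod (x k i - x l i))\<^sup>2 \<le> 4 * inverse (real (Suc N))"
proof -
  have "(1/2) *\<^sub>R (x k + x l) \<in> C"
    using convexD[OF convex in_C in_C, of "1/2" "1/2" k l] by (simp add: scaleR_add_right)
  from minimising(2)[OF this]
  have "Re (inner_on X (x k - x l) (x k - x l)) \<le>
      2 * Re (inner_on X (x k) (x k)) + 2 * Re (inner_on X (x l) (x l)) - 4 * \<mu>"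
    using inner_on_parallelogram[of X "x k" "x l"] by linarith
  also have "\<dots> \<le> 2 * inverse (real (Suc k)) + 2 * inverse (real (Suc l))"
    using minimising(1)[of k] minimising(1)[of l] by simp
  also have "\<dots> \<le> 2 * inverse (real (Suc N)) + 2 * inverse (real (Suc N))"
    using \<open>N \<le> k\<close> \<open>N \<le> l\<close> by (intro add_mono mult_left_mono le_imp_inverse_le) auto
  finally have "Re (inner_on X (x k - x l) (x k - x l)) \<le> 4 * inverse (real (Suc N))" by simp
  moreover have "(cmod (x k i - x l i))\<^sup>2 \<le> Re (inner_on X (x k - x l) (x k - x l))"
    unfolding inner_on_self
    using fin \<open>i \<in> X\<close> member_le_sum[of i X "\<lambda>p. (cmod ((x k - x l) p))\<^sup>2"] by simp
  ultimately show ?thesis by simp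
qed

lemma convex_minimal_norm_limit:
  fixes C :: "('a \<Rightarrow> complex) set"
  assumes fin: "finite X" and nonempty: "C \<noteq> {}" and convex: "convex C"
  obtains x w where "\<And>n. x n \<in> C" "\<And>i. i \<in> X \<Longrightarrow> (\<lambda>n. x n i) \<longlonglongrightarrow> w i"
    "\<And>y. y \<in> C \<Longrightarrow> Re (inner_on X w w) \<le> Re (inner_on X y y)"
proof -
  obtain x \<mu> where sequence: "\<And>n. x n \<in> C"
    "\<And>n. Re (inner_on X (x n) (x n)) \<le> \<mu> + inverse (real (Suc n))"
    and lower: "\<And>y. y \<in> C \<Longrightarrow> \<mu> \<le> Re (inner_on X y y)"
    by (rule minimising_sequence[OF nonempty, of X]) blast
  have "convergent (\<lambda>n. x n i)" if "i \<in> X" for i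
  proof (rule Cauchy_convergent, rule metric_CauchyI)
    fix e :: real assume "0 < e"
    then obtain N where small: "inverse (real (Suc N)) < e\<^sup>2 / 4"
      using reals_Archimedean[of "e\<^sup>2 / 4"] by auto
    have "dist (x k i) (x l i) < e" if "N \<le> k" "N \<le> l" for k l
    proof -
      have "(dist (x k i) (x l i))\<^sup>2 < e\<^sup>2"
        using minimising_sequence_close[OF fin convex sequence lower that \<open>i \<in> X\<close>] small
        by (simp add: dist_norm)
      then show ?thesis using \<open>0 < e\<close> by (simp add: power_less_imp_less_base)
    qed
    then show "\<exists>N. \<forall>k\<ge>N. \<forall>l\<ge>N. dist (x k i) (x l i) < e" by blast
  qed
  then obtain w where limit: "\<And>i. i \<in> X \<Longrightarrow> (\<lambda>n. x n i) \<longlonglongrightarrow> w i" unfolding convergent_def by metis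
  have "Re (inner_on X w w) \<le> \<mu>"
  proof (rule LIMSEQ_le)
    show "(\<lambda>n. Re (inner_on X (x n) (x n))) \<longlonglongrightarrow> Re (inner_on X w w)"
      unfolding inner_on_def by (intro tendsto_intros limit)
    show "(\<lambda>n. \<mu> + inverse (real (Suc n))) \<longlonglongrightarrow> \<mu>" by (rule LIMSEQ_inverse_real_of_nat_add)
  qed (use sequence(2) in blast)
  then have "Re (inner_on X w w) \<le> Re (inner_on X y y)" if "y \<in> C" for y
    using lower[OF that] by simp
  then show ?thesis using that[OF sequence(1) limit] by blast
qed

lemma convex_separation:
  fixes C :: "('a \<Rightarrow> complex) set"
  assumes fin: "finite X" and nonempty: "C \<noteq> {}" and convex: "convex C"
    and lower: "\<And>x. x \<in> C \<Longrightarrow> m \<le> Re (inner_on X x x)"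
  obtains w where "\<And>x. x \<in> C \<Longrightarrow> m \<le> Re (inner_on X w x)"
proof -
  obtain x w where sequence: "\<And>n. x n \<in> C" "\<And>i. i \<in> X \<Longrightarrow> (\<lambda>n. x n i) \<longlonglongrightarrow> w i"
    and minimal: "\<And>y. y \<in> C \<Longrightarrow> Re (inner_on X w w) \<le> Re (inner_on X y y)"
    by (rule convex_minimal_norm_limit[OF fin nonempty convex]) blast
  have "m \<le> Re (inner_on X w y)" if in_C: "y \<in> C" for y
  proof -
    have limit: "b \<le> Re (inner_on X (w + t *\<^sub>R (y - w)) (w + t *\<^sub>R (y - w)))"
      if "0 \<le> t" "t \<le> 1" "\<And>z. z \<in> C \<Longrightarrow> b \<le> Re (inner_on X z z)" for b t
    proof (rule LIMSEQ_le_const)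
      show "(\<lambda>n. Re (inner_on X (x n + t *\<^sub>R (y - x n)) (x n + t *\<^sub>R (y - x n)))) \<longlonglongrightarrow>
          Re (inner_on X (w + t *\<^sub>R (y - w)) (w + t *\<^sub>R (y - w)))"
        unfolding inner_on_def plus_fun_apply scaleR_fun_apply minus_apply
        by (intro tendsto_intros sequence(2))
      have "x n + t *\<^sub>R (y - x n) \<in> C" for n
        using convexD[OF convex sequence(1) in_C, of "1 - t" t n] that(1,2)
        by (simp add: algebra_simps)
      then show "\<exists>N. \<forall>n\<ge>N. b \<le> Re (inner_on X (x n + t *\<^sub>R (y - x n)) (x n + t *\<^sub>R (y - x n)))"
        using that(3) by blast
    qed
    have "0 \<le> 2 * Re (inner_on X w (y - w))"
    proof (rule nonneg_if_nonneg_perturbation)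
      fix t :: real assume unit_interval: "0 < t" "t \<le> 1"
      then have "0 \<le> t * (2 * Re (inner_on X w (y - w)) + t * Re (inner_on X (y - w) (y - w)))"
        using limit[OF _ _ minimal, of t] by (simp add: inner_on_add_scaleR_self)
      then show "0 \<le> 2 * Re (inner_on X w (y - w)) + t * Re (inner_on X (y - w) (y - w))"
        using unit_interval(1) by (simp add: zero_le_mult_iff)
    qed
    moreover have "m \<le> Re (inner_on X w w)" using limit[OF _ _ lower, of 0] by simp
    ultimately show ?thesis by (simp add: inner_on_diff_right)
  qed
  then show ?thesis using that by blast
qed

lemma convex_kernel_separation:
  fixes C :: "'i kernel set"
  assumes fin: "finite I" and nonempty: "C \<noteq> {}" and convex: "convex C"
    and lower: "\<And>A. A \<in> C \<Longrightarrow> m \<le> (\<Sum>p\<in>I. \<Sum>q\<in>I. (cmod (A p q))\<^sup>2)"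
  obtains W where "\<And>A. A \<in> C \<Longrightarrow> m \<le> Re (kernel_pair I W A)"
proof -
  have "linear (case_prod :: 'i kernel \<Rightarrow> 'i \<times> 'i \<Rightarrow> complex)"
    by (rule linearI) (auto simp: fun_eq_iff)
  then have "convex (case_prod ` C)" using convex by (rule convex_linear_image)
  moreover have "m \<le> Re (inner_on (I \<times> I) x x)" if "x \<in> case_prod ` C" for x
    using that lower by (auto simp: inner_on_self sum.cartesian_product' split_def)
  ultimately obtain w where separating: "\<And>x. x \<in> case_prod ` C \<Longrightarrow> m \<le> Re (inner_on (I \<times> I) w x)"
    using convex_separation[of "I \<times> I" "case_prod ` C" m] fin nonempty by blast
  have "inner_on (I \<times> I) w (case_prod A) = kernel_pair I (\<lambda>p q. cnj (w (p, q))) A" for A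
    by (simp add: inner_on_def kernel_pair_def sum.cartesian_product')
  then show ?thesis using separating that[of "\<lambda>p q. cnj (w (p, q))"] by (metis imageI)
qed

lemma pos_kernel_add_one:
  fixes A :: "'a kernel"
  assumes fin: "finite I" and herm: "herm_kernel I A" and "0 \<le> \<eta>"
    and small: "(\<Sum>p\<in>I. \<Sum>q\<in>I. (cmod (A p q))\<^sup>2) \<le> \<eta>\<^sup>2"
  shows "pos_kernel I (A + \<eta> *\<^sub>R one_kernel)"
proof (rule pos_kernelI_herm)
  show "herm_kernel I (A + \<eta> *\<^sub>R one_kernel)"
    by (intro herm_kernel_add herm herm_kernel_scaleR herm_kernel_one)
  fix v :: "'a \<Rightarrow> complex"
  define a where "a z = cmod (A (fst z) (snd z))" for z
  define b where "b z = cmod (v (fst z)) * cmod (v (snd z))" for z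
  define n where "n = (\<Sum>p\<in>I. (cmod (v p))\<^sup>2)"
  have "L2_set a (I \<times> I) \<le> \<eta>"
    using small \<open>0 \<le> \<eta>\<close> by (simp add: L2_set_def a_def sum.cartesian_product' real_le_lsqrt
        sum_nonneg)
  moreover have "(\<Sum>z\<in>I \<times> I. (b z)\<^sup>2) = n\<^sup>2"
    by (simp add: b_def n_def sum.cartesian_product' power_mult_distrib
        power2_eq_square[of "sum _ _"] sum_product)
  then have "L2_set b (I \<times> I) = n" by (simp add: L2_set_def n_def sum_nonneg)
  moreover have "0 \<le> n" by (simp add: n_def sum_nonneg)
  ultimately have cauchy_schwarz: "L2_set a (I \<times> I) * L2_set b (I \<times> I) \<le> \<eta> * n"
    by (simp add: mult_right_mono)
  have "cmod (sesq I A v v) \<le> (\<Sum>p\<in>I. \<Sum>q\<in>I. cmod (cnj (v p) * A p q * v q))"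
    unfolding sesq_def by (intro order_trans[OF norm_sum] sum_mono order_refl)
  also have "\<dots> = (\<Sum>z\<in>I \<times> I. \<bar>a z\<bar> * \<bar>b z\<bar>)"
    by (simp add: sum.cartesian_product' a_def b_def norm_mult mult_ac)
  also have "\<dots> \<le> \<eta> * n" using L2_set_mult_ineq cauchy_schwarz by (rule order_trans)
  finally have "- (\<eta> * n) \<le> Re (sesq I A v v)" using abs_Re_le_cmod[of "sesq I A v v"] by linarith
  then show "0 \<le> Re (sesq I (A + \<eta> *\<^sub>R one_kernel) v v)"
    by (simp add: sesq_add sesq_scaleR sesq_one[OF fin] inner_on_self n_def)
qed

lemma herm_kernel_representer:
  fixes W :: "'i kernel"
  obtains Y where "herm_kernel I Y"
    "\<And>A. herm_kernel I A \<Longrightarrow> Re (kernel_pair I Y A) = Re (kernel_pair I W A)"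
proof -
  define Y where "Y = (1/2) *\<^sub>R (W + kernel_adjoint W)"
  have "Re (kernel_pair I Y A) = Re (kernel_pair I W A)" if herm_A: "herm_kernel I A" for A
  proof -
    have "kernel_pair I (kernel_adjoint W) A = (\<Sum>p\<in>I. \<Sum>q\<in>I. cnj (W q p * A q p))"
      unfolding kernel_pair_def kernel_adjoint_def using herm_kernelD[OF herm_A] by simp
    also have "\<dots> = cnj (kernel_pair I W A)" by (subst sum.swap) (simp add: kernel_pair_def)
    finally show ?thesis
      by (simp add: Y_def kernel_pair_scaleR_left kernel_pair_commute[of I _ A]
          kernel_pair_add_right)
  qed
  moreover have "herm_kernel I Y"
    by (rule herm_kernelI) (simp add: Y_def kernel_adjoint_def add.commute)
  ultimately show ?thesis using that by blast
qed

lemma pos_kernel_if_pairing_nonneg: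
  assumes herm: "herm_kernel I Y" and nonneg: "\<And>u. 0 \<le> Re (kernel_pair I Y (outer u u))"
  shows "pos_kernel I Y"
proof (rule pos_kernelI_herm[OF herm])
  fix v
  show "0 \<le> Re (sesq I Y v v)"
    using nonneg[of "cnj \<circ> v"] by (simp add: kernel_pair_outer o_def)
qed

lemma nonpos_if_multiples_bounded_above:
  fixes a b :: real
  assumes "\<And>s. 0 \<le> s \<Longrightarrow> s * b \<le> a"
  shows "b \<le> 0"
proof (rule ccontr)
  assume "\<not> b \<le> 0"
  then show False using assms[of "(\<bar>a\<bar> + 1) / b"] by simp
qed

lemma convex_pos_kernel_gap:
  assumes fin: "finite I" and nonempty: "C \<noteq> {}" and herm: "\<And>A. A \<in> C \<Longrightarrow> herm_kernel I A"
    and convex: "convex C"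
    and far: "\<And>A P. A \<in> C \<Longrightarrow> pos_kernel I P \<Longrightarrow> m \<le> (\<Sum>p\<in>I. \<Sum>q\<in>I. (cmod ((A - P) p q))\<^sup>2)"
  obtains Y where "herm_kernel I Y"
    "\<And>A P. A \<in> C \<Longrightarrow> pos_kernel I P \<Longrightarrow> m \<le> Re (kernel_pair I Y A) - Re (kernel_pair I Y P)"
proof -
  define D where "D = (\<Union>A\<in>C. \<Union>P\<in>{P. pos_kernel I P}. {A - P})"
  have "convex D" unfolding D_def by (rule convex_differences[OF convex pos_kernel_convex])
  moreover have "D \<noteq> {}" using nonempty pos_kernel_zero by (auto simp: D_def)
  moreover have "m \<le> (\<Sum>p\<in>I. \<Sum>q\<in>I. (cmod (B p q))\<^sup>2)" if "B \<in> D" for B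
    using that far by (auto simp: D_def)
  ultimately obtain W where separating: "\<And>B. B \<in> D \<Longrightarrow> m \<le> Re (kernel_pair I W B)"
    using convex_kernel_separation[OF fin] by metis
  obtain Y where Y: "herm_kernel I Y"
    and representer: "\<And>A. herm_kernel I A \<Longrightarrow> Re (kernel_pair I Y A) = Re (kernel_pair I W A)"
    by (rule herm_kernel_representer[of I W]) blast
  have "m \<le> Re (kernel_pair I Y A) - Re (kernel_pair I Y P)" if "A \<in> C" "pos_kernel I P" for A P
  proof -
    have "m \<le> Re (kernel_pair I W (A - P))" using that by (intro separating) (auto simp: D_def)
    also have "\<dots> = Re (kernel_pair I Y (A - P))"
      using that herm pos_kernel_herm[OF fin]
      by (intro representer[symmetric] herm_kernel_diff) auto
    finally show ?thesis by (simp add: kernel_pair_diff_right)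
  qed
  with Y show ?thesis by (rule that)
qed

lemma convex_pos_kernel_separation:
  assumes fin: "finite I" and nonempty: "C \<noteq> {}" and herm: "\<And>A. A \<in> C \<Longrightarrow> herm_kernel I A"
    and convex: "convex C" and "0 < m"
    and far: "\<And>A P. A \<in> C \<Longrightarrow> pos_kernel I P \<Longrightarrow> m \<le> (\<Sum>p\<in>I. \<Sum>q\<in>I. (cmod ((A - P) p q))\<^sup>2)"
  obtains Y where "pos_kernel I Y" "\<And>A. A \<in> C \<Longrightarrow> Re (kernel_pair I Y A) \<le> - m"
proof -
  obtain Y where herm_Y: "herm_kernel I Y"
    and gap: "\<And>A P. A \<in> C \<Longrightarrow> pos_kernel I P \<Longrightarrow> m \<le> Re (kernel_pair I Y A) - Re (kernel_pair I Y P)"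
    using convex_pos_kernel_gap[OF fin nonempty herm convex far] by metis
  obtain A0 where "A0 \<in> C" using nonempty by blast
  have nonpos: "Re (kernel_pair I Y P) \<le> 0" if pos_P: "pos_kernel I P" for P
  proof (rule nonpos_if_multiples_bounded_above)
    show "s * Re (kernel_pair I Y P) \<le> Re (kernel_pair I Y A0)" if "0 \<le> s" for s
      using gap[OF \<open>A0 \<in> C\<close> pos_kernel_scaleR[OF pos_P that]] \<open>0 < m\<close>
      by (simp add: kernel_pair_scaleR_right)
  qed
  have minus_Y: "Re (kernel_pair I ((- 1) *\<^sub>R Y) A) = - Re (kernel_pair I Y A)" for A
    unfolding kernel_pair_scaleR_left by simp
  show ?thesis
  proof (rule that)
    show "pos_kernel I ((- 1) *\<^sub>R Y)"
    proof (rule pos_kernel_if_pairing_nonneg)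
      show "herm_kernel I ((- 1) *\<^sub>R Y)" by (rule herm_kernel_scaleR[OF herm_Y])
      show "0 \<le> Re (kernel_pair I ((- 1) *\<^sub>R Y) (outer u u))" for u
        unfolding minus_Y using nonpos[OF pos_kernel_outer] by simp
    qed
    show "Re (kernel_pair I ((- 1) *\<^sub>R Y) A) \<le> - m" if "A \<in> C" for A
      using gap[OF that pos_kernel_zero] unfolding minus_Y by (simp add: kernel_pair_def)
  qed
qed

text \<open>No closedness is needed, since the first alternative only asks for positivity up to an
  arbitrarily small multiple of the identity.\<close>

lemma pos_kernel_alternative:
  assumes fin: "finite I" and nonempty: "C \<noteq> {}" and herm: "\<And>A. A \<in> C \<Longrightarrow> herm_kernel I A"
    and convex: "convex C" and "0 < \<eta>"
  obtains (pos) A where "A \<in> C" "pos_kernel I (A + \<eta> *\<^sub>R one_kernel)"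
    | (sep) Y m where "density_kernel I Y" "0 < m" "\<And>A. A \<in> C \<Longrightarrow> Re (kernel_pair I Y A) \<le> - m"
proof (cases "\<exists>A\<in>C. \<exists>P. pos_kernel I P \<and> (\<Sum>p\<in>I. \<Sum>q\<in>I. (cmod ((A - P) p q))\<^sup>2) < \<eta>\<^sup>2")
  case True
  then obtain A P where in_C: "A \<in> C" and pos_P: "pos_kernel I P"
    and near: "(\<Sum>p\<in>I. \<Sum>q\<in>I. (cmod ((A - P) p q))\<^sup>2) \<le> \<eta>\<^sup>2" by fastforce
  have "pos_kernel I ((A - P) + \<eta> *\<^sub>R one_kernel)"
    using herm[OF in_C] pos_kernel_herm[OF fin pos_P] near \<open>0 < \<eta>\<close>
    by (intro pos_kernel_add_one[OF fin] herm_kernel_diff) auto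
  from pos_kernel_add[OF this pos_P] have "pos_kernel I (A + \<eta> *\<^sub>R one_kernel)"
    by (simp add: algebra_simps)
  with in_C show ?thesis by (rule pos)
next
  case False
  then obtain Y where separating: "pos_kernel I Y" "\<And>A. A \<in> C \<Longrightarrow> Re (kernel_pair I Y A) \<le> - \<eta>\<^sup>2"
    using convex_pos_kernel_separation[OF fin nonempty herm convex, of "\<eta>\<^sup>2"] \<open>0 < \<eta>\<close>
    by (auto simp: not_less)
  have "\<not> Y \<simeq>\<^bsub>I\<^esub> 0"
  proof
    assume "Y \<simeq>\<^bsub>I\<^esub> 0"
    then have "kernel_pair I Y A = 0" for A by (simp add: kernel_pair_def kernel_eq_def)
    then show False using separating(2) nonempty \<open>0 < \<eta>\<close> by fastforce
  qed
  note normalised = density_kernel_normalise[OF fin separating(1) this]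
  show ?thesis
  proof (rule sep[OF normalised(2)])
    show "0 < \<eta>\<^sup>2 / Re (kernel_trace I Y)" using normalised(1) \<open>0 < \<eta>\<close> by simp
    show "Re (kernel_pair I ((1 / Re (kernel_trace I Y)) *\<^sub>R Y) A) \<le> - (\<eta>\<^sup>2 / Re (kernel_trace I Y))"
      if "A \<in> C" for A
      using separating(2)[OF that] normalised(1) by (simp add: kernel_pair_scaleR_left field_simps)
  qed
qed

section \<open>Bipartite kernels and the link product\<close>

text \<open>A bipartite kernel on \<open>X \<times> Y\<close> is the Choi kernel of a map from \<open>X\<close> to \<open>Y\<close>, and \<open>link\<close>
  composes such maps: \<open>link Y A C\<close> is the Choi kernel of the map of \<open>C\<close> after the map of \<open>A\<close>.\<close>

definition link :: "'y set \<Rightarrow> ('x \<times> 'y) kernel \<Rightarrow> ('y \<times> 'z) kernel \<Rightarrow> ('x \<times> 'z) kernel" where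
  "link Y A C p q = (\<Sum>x\<in>Y. \<Sum>y\<in>Y. A (fst p, x) (fst q, y) * C (x, snd p) (y, snd q))"

definition swap_kernel :: "('x \<times> 'y) kernel \<Rightarrow> ('y \<times> 'x) kernel" where
  "swap_kernel A p q = A (prod.swap p) (prod.swap q)"

definition ptrace :: "'y set \<Rightarrow> ('x \<times> 'y) kernel \<Rightarrow> 'x kernel" where
  "ptrace Y A i j = (\<Sum>y\<in>Y. A (i, y) (j, y))"

definition kernel_tensor :: "'x kernel \<Rightarrow> 'y kernel \<Rightarrow> ('x \<times> 'y) kernel" where
  "kernel_tensor A B p q = A (fst p) (fst q) * B (snd p) (snd q)"

definition id_kernel :: "('x \<times> 'x) kernel" where
  "id_kernel = outer (\<lambda>p. of_bool (fst p = snd p)) (\<lambda>p. of_bool (fst p = snd p))"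

definition chan_kernel :: "'x set \<Rightarrow> 'y set \<Rightarrow> ('x \<times> 'y) kernel \<Rightarrow> bool" where
  "chan_kernel X Y c \<longleftrightarrow> pos_kernel (X \<times> Y) c \<and> ptrace Y c \<simeq>\<^bsub>X\<^esub> one_kernel"

lemma sum_swap_pairs:
  fixes f :: "_ \<Rightarrow> _ \<Rightarrow> _ \<Rightarrow> _ \<Rightarrow> 'a :: comm_monoid_add"
  shows "(\<Sum>x\<in>A. \<Sum>y\<in>B. \<Sum>k\<in>C. \<Sum>l\<in>D. f x y k l) = (\<Sum>k\<in>C. \<Sum>l\<in>D. \<Sum>x\<in>A. \<Sum>y\<in>B. f x y k l)"
  using sum.swap[of "\<lambda>(x, y) (k, l). f x y k l" "C \<times> D" "A \<times> B"]
  by (simp add: sum.cartesian_product')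

subsection \<open>Algebra of the link product\<close>

lemma link_cong:
  assumes "A \<simeq>\<^bsub>X \<times> Y\<^esub> A'" "C \<simeq>\<^bsub>Y \<times> Z\<^esub> C'"
  shows "link Y A C \<simeq>\<^bsub>X \<times> Z\<^esub> link Y A' C'"
  using assms by (auto simp: kernel_eq_def link_def intro!: sum.cong)

lemma swap_kernel_cong: "A \<simeq>\<^bsub>X \<times> Y\<^esub> B \<Longrightarrow> swap_kernel A \<simeq>\<^bsub>Y \<times> X\<^esub> swap_kernel B"
  by (auto simp: kernel_eq_def swap_kernel_def)

lemma ptrace_cong: "A \<simeq>\<^bsub>X \<times> Y\<^esub> B \<Longrightarrow> ptrace Y A \<simeq>\<^bsub>X\<^esub> ptrace Y B"
  by (auto simp: kernel_eq_def ptrace_def intro!: sum.cong)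

lemma kernel_tensor_cong:
  "A \<simeq>\<^bsub>X\<^esub> A' \<Longrightarrow> B \<simeq>\<^bsub>Y\<^esub> B' \<Longrightarrow> kernel_tensor A B \<simeq>\<^bsub>X \<times> Y\<^esub> kernel_tensor A' B'"
  by (auto simp: kernel_eq_def kernel_tensor_def)

lemma link_add_left: "link Y (A + B) C = link Y A C + link Y B C"
  by (simp add: link_def fun_eq_iff algebra_simps sum.distrib)

lemma link_diff_left: "link Y (A - B) C = link Y A C - link Y B C"
  by (simp add: link_def fun_eq_iff algebra_simps sum_subtractf)

lemma link_diff_right: "link Y A (C - D) = link Y A C - link Y A D"
  by (simp add: link_def fun_eq_iff algebra_simps sum_subtractf)

lemma link_scaleR_left: "link Y (c *\<^sub>R A) C = c *\<^sub>R link Y A C"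
  by (simp add: link_def fun_eq_iff scaleR_sum_right)

lemma link_scaleR_right: "link Y A (c *\<^sub>R C) = c *\<^sub>R link Y A C"
  by (simp add: link_def fun_eq_iff scaleR_sum_right)

lemma link_sum_left: "link Y (\<Sum>k\<in>K. A k) C = (\<Sum>k\<in>K. link Y (A k) C)"
  by (induction K rule: infinite_finite_induct)
    (simp_all add: link_def fun_eq_iff algebra_simps sum.distrib)

lemma link_sum_right: "link Y A (\<Sum>k\<in>K. C k) = (\<Sum>k\<in>K. link Y A (C k))"
  by (induction K rule: infinite_finite_induct)
    (simp_all add: link_def fun_eq_iff algebra_simps sum.distrib)

lemma link_assoc: "link Z (link Y A B) C = link Y A (link Z B C)"
proof (intro ext)
  fix p q
  have "link Z (link Y A B) C p q = (\<Sum>u\<in>Z. \<Sum>v\<in>Z. \<Sum>x\<in>Y. \<Sum>y\<in>Y.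
      A (fst p, x) (fst q, y) * B (x, u) (y, v) * C (u, snd p) (v, snd q))"
    by (simp add: link_def sum_distrib_right)
  also have "\<dots> = (\<Sum>x\<in>Y. \<Sum>y\<in>Y. \<Sum>u\<in>Z. \<Sum>v\<in>Z.
      A (fst p, x) (fst q, y) * B (x, u) (y, v) * C (u, snd p) (v, snd q))"
    by (rule sum_swap_pairs)
  finally show "link Z (link Y A B) C p q = link Y A (link Z B C) p q"
    by (simp add: link_def sum_distrib_left mult.assoc)
qed

lemma link_outer:
  "link Y (outer f f') (outer g g') =
    outer (\<lambda>p. \<Sum>y\<in>Y. f (fst p, y) * g (y, snd p)) (\<lambda>p. \<Sum>y\<in>Y. f' (fst p, y) * g' (y, snd p))"
  by (simp add: link_def outer_def fun_eq_iff sum_product mult_ac)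

lemma swap_swap_kernel [simp]: "swap_kernel (swap_kernel A) = A"
  by (simp add: swap_kernel_def fun_eq_iff)

lemma swap_kernel_link: "swap_kernel (link Y A C) = link Y (swap_kernel C) (swap_kernel A)"
  by (simp add: swap_kernel_def link_def fun_eq_iff mult.commute)

lemma swap_kernel_diff: "swap_kernel (A - B) = swap_kernel A - swap_kernel B"
  by (simp add: swap_kernel_def fun_eq_iff)

lemma swap_kernel_scaleR: "swap_kernel (c *\<^sub>R A) = c *\<^sub>R swap_kernel A"
  by (simp add: swap_kernel_def fun_eq_iff)

lemma swap_kernel_one [simp]: "swap_kernel one_kernel = one_kernel"
  by (auto simp: swap_kernel_def one_kernel_def fun_eq_iff)

lemma swap_kernel_outer: "swap_kernel (outer f g) = outer (f \<circ> prod.swap) (g \<circ> prod.swap)"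
  by (simp add: swap_kernel_def outer_def fun_eq_iff)

lemma kernel_transpose_link:
  "kernel_transpose (link Y A C) = link Y (kernel_transpose A) (kernel_transpose C)"
  unfolding kernel_transpose_def link_def by (intro ext sum.swap)

lemma link_id_left:
  assumes "finite Y"
  shows "link Y id_kernel A \<simeq>\<^bsub>Y \<times> Z\<^esub> A"
proof (rule kernel_eqI)
  fix p q assume "p \<in> Y \<times> Z" "q \<in> Y \<times> Z"
  have "link Y id_kernel A p q =
      (\<Sum>x\<in>Y. \<Sum>y\<in>Y. if y = fst q then if x = fst p then A p q else 0 else 0)"
    unfolding link_def id_kernel_def outer_def by (intro sum.cong refl) auto
  then show "link Y id_kernel A p q = A p q"
    using assms \<open>p \<in> Y \<times> Z\<close> \<open>q \<in> Y \<times> Z\<close> by auto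
qed

lemma swap_id_kernel [simp]: "swap_kernel id_kernel = id_kernel"
  by (auto simp: id_kernel_def swap_kernel_outer o_def intro!: arg_cong2[where f = outer])

lemma link_id_right:
  assumes "finite Y"
  shows "link Y A id_kernel \<simeq>\<^bsub>X \<times> Y\<^esub> A"
  using swap_kernel_cong[OF link_id_left[OF assms, of "swap_kernel A" X]]
  by (simp add: swap_kernel_link)

lemma one_kernel_prod: "one_kernel = kernel_tensor one_kernel one_kernel"
  by (auto simp: one_kernel_def kernel_tensor_def fun_eq_iff)

lemma link_one_right:
  assumes "finite Y"
  shows "link Y A one_kernel = kernel_tensor (ptrace Y A) one_kernel"
proof (intro ext)
  fix p q
  have "link Y A one_kernel p q = (\<Sum>x\<in>Y. \<Sum>y\<in>Y.
      if y = x then A (fst p, x) (fst q, x) * one_kernel (snd p) (snd q) else 0)"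
    unfolding link_def by (intro sum.cong refl) (auto simp: one_kernel_def)
  then show "link Y A one_kernel p q = kernel_tensor (ptrace Y A) one_kernel p q"
    using assms by (simp add: kernel_tensor_def ptrace_def sum_distrib_right)
qed

subsection \<open>Pairings of link products\<close>

lemma kernel_pair_prod:
  "kernel_pair (X \<times> Y) A B = (\<Sum>x\<in>X. \<Sum>x'\<in>X. \<Sum>y\<in>Y. \<Sum>y'\<in>Y. A (x, y) (x', y') * B (x, y) (x', y'))"
  unfolding kernel_pair_def sum.cartesian_product' by (intro sum.cong refl sum.swap)

lemma kernel_pair_swap:
  "kernel_pair (Y \<times> X) (swap_kernel A) (swap_kernel B) = kernel_pair (X \<times> Y) A B"
  unfolding kernel_pair_prod swap_kernel_def swap_simp by (rule sum_swap_pairs)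

lemma kernel_pair_link_left:
  "kernel_pair (X \<times> Z) R (link Y A C) = kernel_pair (Y \<times> Z) (link X (swap_kernel A) R) C"
proof -
  let ?f = "\<lambda>x x' z z' y y'. R (x, z) (x', z') * (A (x, y) (x', y') * C (y, z) (y', z'))"
  have "kernel_pair (X \<times> Z) R (link Y A C) =
      (\<Sum>x\<in>X. \<Sum>x'\<in>X. \<Sum>z\<in>Z. \<Sum>z'\<in>Z. \<Sum>y\<in>Y. \<Sum>y'\<in>Y. ?f x x' z z' y y')"
    unfolding kernel_pair_prod link_def by (simp add: sum_distrib_left)
  also have "\<dots> = (\<Sum>x\<in>X. \<Sum>x'\<in>X. \<Sum>y\<in>Y. \<Sum>y'\<in>Y. \<Sum>z\<in>Z. \<Sum>z'\<in>Z. ?f x x' z z' y y')"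
    by (intro sum.cong refl sum_swap_pairs)
  also have "\<dots> = (\<Sum>y\<in>Y. \<Sum>y'\<in>Y. \<Sum>x\<in>X. \<Sum>x'\<in>X. \<Sum>z\<in>Z. \<Sum>z'\<in>Z. ?f x x' z z' y y')"
    by (rule sum_swap_pairs)
  also have "\<dots> = (\<Sum>y\<in>Y. \<Sum>y'\<in>Y. \<Sum>z\<in>Z. \<Sum>z'\<in>Z. \<Sum>x\<in>X. \<Sum>x'\<in>X. ?f x x' z z' y y')"
    by (intro sum.cong refl sum_swap_pairs)
  also have "\<dots> = kernel_pair (Y \<times> Z) (link X (swap_kernel A) R) C"
    unfolding kernel_pair_prod link_def swap_kernel_def by (simp add: sum_distrib_left mult_ac)
  finally show ?thesis .
qed

lemma kernel_pair_link_right: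
  "kernel_pair (X \<times> Z) R (link Y A C) = kernel_pair (X \<times> Y) (link Z R (swap_kernel C)) A"
proof -
  have "kernel_pair (X \<times> Z) R (link Y A C) =
      kernel_pair (Z \<times> X) (swap_kernel R) (link Y (swap_kernel C) (swap_kernel A))"
    by (simp add: kernel_pair_swap flip: swap_kernel_link)
  also have "\<dots> = kernel_pair (Y \<times> X) (swap_kernel (link Z R (swap_kernel C))) (swap_kernel A)"
    by (simp add: kernel_pair_link_left swap_kernel_link)
  finally show ?thesis by (simp add: kernel_pair_swap)
qed

lemma kernel_pair_tensor_one:
  assumes "finite Y"
  shows "kernel_pair (X \<times> Y) A (kernel_tensor B one_kernel) = kernel_pair X (ptrace Y A) B"
proof -
  have "kernel_pair (X \<times> Y) A (kernel_tensor B one_kernel) =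
      (\<Sum>x\<in>X. \<Sum>x'\<in>X. \<Sum>y\<in>Y. \<Sum>y'\<in>Y. if y' = y then A (x, y) (x', y) * B x x' else 0)"
    unfolding kernel_pair_prod kernel_tensor_def
    by (intro sum.cong refl) (auto simp: one_kernel_def)
  then show ?thesis using assms by (simp add: kernel_pair_def ptrace_def sum_distrib_right)
qed

lemma kernel_trace_prod: "kernel_trace (X \<times> Y) A = kernel_trace X (ptrace Y A)"
  by (simp add: kernel_trace_def ptrace_def sum.cartesian_product')

lemma ptrace_add: "ptrace Y (A + B) = ptrace Y A + ptrace Y B"
  by (simp add: ptrace_def fun_eq_iff sum.distrib)

lemma ptrace_diff: "ptrace Y (A - B) = ptrace Y A - ptrace Y B"
  by (simp add: ptrace_def fun_eq_iff sum_subtractf)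

lemma ptrace_scaleR: "ptrace Y (c *\<^sub>R A) = c *\<^sub>R ptrace Y A"
  by (simp add: ptrace_def fun_eq_iff scaleR_sum_right)

lemma ptrace_sum: "ptrace Y (\<Sum>k\<in>K. A k) = (\<Sum>k\<in>K. ptrace Y (A k))"
  unfolding ptrace_def fun_eq_iff sum_fun_apply by (intro allI sum.swap)

lemma ptrace_tensor: "ptrace Y (kernel_tensor A B) = (\<lambda>i j. A i j * kernel_trace Y B)"
  by (intro ext) (simp add: ptrace_def kernel_tensor_def kernel_trace_def sum_distrib_left)

lemma ptrace_one: "ptrace Y one_kernel = real (card Y) *\<^sub>R one_kernel"
  unfolding one_kernel_prod ptrace_tensor kernel_trace_one
  by (simp add: fun_eq_iff scaleR_conv_of_real)

lemma ptrace_link: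
  assumes "finite Y" "ptrace Z C \<simeq>\<^bsub>Y\<^esub> one_kernel"
  shows "ptrace Z (link Y A C) = ptrace Y A"
proof (intro ext)
  fix i j
  have "ptrace Z (link Y A C) i j = (\<Sum>z\<in>Z. \<Sum>x\<in>Y. \<Sum>y\<in>Y. A (i, x) (j, y) * C (x, z) (y, z))"
    by (simp add: ptrace_def link_def)
  also have "\<dots> = (\<Sum>x\<in>Y. \<Sum>y\<in>Y. A (i, x) (j, y) * ptrace Z C x y)"
    unfolding ptrace_def sum_distrib_left by (subst sum.swap, intro sum.cong refl sum.swap)
  also have "\<dots> = (\<Sum>x\<in>Y. \<Sum>y\<in>Y. A (i, x) (j, y) * one_kernel x y)"
    using assms(2) by (simp add: kernel_eq_def)
  finally show "ptrace Z (link Y A C) i j = ptrace Y A i j"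
    using assms(1) by (simp add: one_kernel_def sum_mult_of_bool_eq ptrace_def)
qed

subsection \<open>Positivity\<close>

lemma sesq_swap_kernel:
  "sesq (Y \<times> X) (swap_kernel A) u v = sesq (X \<times> Y) A (u \<circ> prod.swap) (v \<circ> prod.swap)"
  using kernel_pair_swap[of Y X A "swap_kernel (outer (cnj \<circ> u) (cnj \<circ> v))"]
  unfolding sesq_eq_kernel_pair swap_swap_kernel by (simp add: swap_kernel_outer o_assoc)

lemma pos_kernel_swap: "pos_kernel (X \<times> Y) A \<Longrightarrow> pos_kernel (Y \<times> X) (swap_kernel A)"
  by (simp add: pos_kernel_def sesq_swap_kernel)

lemma pos_kernel_transpose: "pos_kernel I A \<Longrightarrow> pos_kernel I (kernel_transpose A)"
proof -
  have "sesq I (kernel_transpose A) v v = sesq I A (cnj \<circ> v) (cnj \<circ> v)" for v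
    unfolding sesq_def kernel_transpose_def by (subst sum.swap) (simp add: mult_ac)
  then show "pos_kernel I A \<Longrightarrow> pos_kernel I (kernel_transpose A)" by (simp add: pos_kernel_def)
qed

lemma sesq_link_outer:
  "sesq (Y \<times> Z) (link X (outer g h) M) u v =
    sesq (X \<times> Z) M (\<lambda>p. \<Sum>y\<in>Y. cnj (g (y, fst p)) * u (y, snd p))
          (\<lambda>p. \<Sum>y\<in>Y. cnj (h (y, fst p)) * v (y, snd p))"
proof -
  let ?uv = "outer (cnj \<circ> u) (cnj \<circ> v)"
  have "sesq (Y \<times> Z) (link X (outer g h) M) u v = kernel_pair (Y \<times> Z) ?uv (link X (outer g h) M)"
    by (simp add: sesq_eq_kernel_pair kernel_pair_commute)
  also have "\<dots> = kernel_pair (X \<times> Z) M (link Y (swap_kernel (outer g h)) ?uv)"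
    by (simp add: kernel_pair_link_left kernel_pair_commute)
  finally show ?thesis
    by (simp add: sesq_eq_kernel_pair swap_kernel_outer link_outer o_def)
qed

lemma pos_kernel_link:
  assumes fin: "finite X" "finite Y" and pos_A: "pos_kernel (X \<times> Y) A"
    and pos_C: "pos_kernel (Y \<times> Z) C"
  shows "pos_kernel (X \<times> Z) (link Y A C)"
proof -
  obtain J :: "nat set" and g where g_expansion: "A \<simeq>\<^bsub>X \<times> Y\<^esub> (\<Sum>j\<in>J. outer (g j) (g j))"
    using pos_kernel_gram[OF _ pos_A] fin by blast
  have "pos_kernel (X \<times> Z) (\<Sum>j\<in>J. link Y (outer (g j) (g j)) C)"
    using pos_C by (intro pos_kernel_sum) (simp add: pos_kernel_def sesq_link_outer)
  then show ?thesis
    unfolding pos_kernel_cong[OF link_cong[OF g_expansion kernel_eq_refl]] link_sum_left .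
qed

lemma pos_kernel_tensor_one:
  fixes X :: "'x set" and Y :: "'y set"
  assumes "finite Y" "pos_kernel X A"
  shows "pos_kernel (X \<times> Y) (kernel_tensor A one_kernel)"
  unfolding pos_kernel_def
proof
  fix v :: "'x \<times> 'y \<Rightarrow> complex"
  let ?vv = "outer (cnj \<circ> v) (cnj \<circ> v)"
  have "sesq (X \<times> Y) (kernel_tensor A one_kernel) v v = kernel_pair X (ptrace Y ?vv) A"
    by (simp add: sesq_eq_kernel_pair kernel_pair_commute[of _ _ ?vv]
        kernel_pair_tensor_one[OF assms(1)])
  also have "ptrace Y ?vv = (\<Sum>y\<in>Y. outer (\<lambda>x. cnj (v (x, y))) (\<lambda>x. cnj (v (x, y))))"
    by (simp add: ptrace_def outer_def fun_eq_iff)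
  also have "kernel_pair X \<dots> A = (\<Sum>y\<in>Y. sesq X A (\<lambda>x. v (x, y)) (\<lambda>x. v (x, y)))"
    by (simp add: kernel_pair_commute[of X _ A] kernel_pair_sum_right kernel_pair_outer o_def)
  finally show "0 \<le> sesq (X \<times> Y) (kernel_tensor A one_kernel) v v"
    using assms(2) by (simp add: pos_kernelD sum_nonneg)
qed

lemma pos_kernel_ptrace:
  assumes "finite X" "finite Y" "pos_kernel (X \<times> Y) A"
  shows "pos_kernel X (ptrace Y A)"
  unfolding pos_kernel_def sesq_eq_kernel_pair kernel_pair_tensor_one[OF assms(2), symmetric]
  using assms by (intro allI kernel_pair_nonneg pos_kernel_tensor_one pos_kernel_outer) auto

subsection \<open>Channel kernels\<close>

lemma chan_kernel_cong: "c \<simeq>\<^bsub>X \<times> Y\<^esub> d \<Longrightarrow> chan_kernel X Y c \<longleftrightarrow> chan_kernel X Y d"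
  using pos_kernel_cong ptrace_cong kernel_eq_sym kernel_eq_trans unfolding chan_kernel_def by metis

lemma chan_kernel_link:
  assumes "finite X" "finite Y" "chan_kernel X Y c" "chan_kernel Y Z d"
  shows "chan_kernel X Z (link Y c d)"
  using assms by (simp add: chan_kernel_def pos_kernel_link ptrace_link)

lemma ptrace_transpose: "ptrace Y (kernel_transpose A) = kernel_transpose (ptrace Y A)"
  by (simp add: ptrace_def kernel_transpose_def fun_eq_iff)

lemma chan_kernel_transpose:
  assumes "chan_kernel X Y c"
  shows "chan_kernel X Y (kernel_transpose c)"
  using assms kernel_transpose_cong[of "ptrace Y c" X one_kernel]
  by (simp add: chan_kernel_def pos_kernel_transpose ptrace_transpose)

lemma link_chan_kernel_one:
  assumes "finite Y" "chan_kernel X Y c"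
  shows "link Y c one_kernel \<simeq>\<^bsub>X \<times> Z\<^esub> one_kernel"
  using kernel_tensor_cong[of "ptrace Y c" X one_kernel one_kernel Z one_kernel] assms
  by (simp add: link_one_right chan_kernel_def flip: one_kernel_prod)

lemma chan_kernel_herm: "finite X \<Longrightarrow> finite Y \<Longrightarrow> chan_kernel X Y c \<Longrightarrow> herm_kernel (X \<times> Y) c"
  by (simp add: chan_kernel_def pos_kernel_herm)

lemma chan_kernel_convex: "convex {c. chan_kernel X Y c}"
proof -
  have "convex {c :: ('a \<times> 'b) kernel. ptrace Y c \<simeq>\<^bsub>X\<^esub> one_kernel}"
    by (rule convexI) (simp add: kernel_eq_def ptrace_add ptrace_scaleR flip: scaleR_left.add)
  with pos_kernel_convex have "convex ({c. pos_kernel (X \<times> Y) c} \<inter> {c. ptrace Y c \<simeq>\<^bsub>X\<^esub> one_kernel})"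
    by (rule convex_Int)
  then show ?thesis by (simp add: chan_kernel_def Collect_conj_eq)
qed

lemma chan_kernel_depolarizing:
  assumes "finite X" "finite Y" "Y \<noteq> {}"
  shows "chan_kernel X Y ((1 / card Y) *\<^sub>R one_kernel)"
  using assms by (simp add: chan_kernel_def pos_kernel_scaleR pos_kernel_one ptrace_scaleR
      ptrace_one)

lemma chan_kernel_id:
  assumes "finite X"
  shows "chan_kernel X X id_kernel"
proof -
  have "ptrace X id_kernel \<simeq>\<^bsub>X\<^esub> one_kernel"
    using assms by (intro kernel_eqI)
      (simp add: ptrace_def id_kernel_def outer_def one_kernel_def sum_of_bool_mult_eq)
  then show ?thesis by (simp add: chan_kernel_def id_kernel_def pos_kernel_outer)
qed

lemma kernel_trace_chan_kernel:
  assumes "chan_kernel X Y c"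
  shows "kernel_trace (X \<times> Y) c = of_nat (card X)"
  using assms kernel_trace_cong kernel_trace_one
  unfolding kernel_trace_prod chan_kernel_def by metis

lemma kernel_trace_link_channel:
  assumes "finite X" "finite Y" "finite Z" "chan_kernel X Y c"
  shows "kernel_trace (Y \<times> Z) (link X (swap_kernel c) A) = kernel_trace (X \<times> Z) A"
proof -
  have "kernel_trace (Y \<times> Z) (link X (swap_kernel c) A) =
      kernel_pair (X \<times> Z) A (kernel_tensor (ptrace Y c) one_kernel)"
    using assms(1-3) kernel_pair_link_left[of X Z A Y c one_kernel]
    by (simp add: kernel_pair_one link_one_right)
  also have "\<dots> = kernel_pair (X \<times> Z) A one_kernel"
    using assms(4) unfolding one_kernel_prod[where 'a = 'a and 'b = 'c]
    by (intro kernel_pair_cong kernel_tensor_cong) (auto simp: chan_kernel_def)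
  finally show ?thesis using assms(1,3) by (simp add: kernel_pair_one)
qed

section \<open>The conditional norm and its dual\<close>

definition cond_norm :: "'x set \<Rightarrow> 'y set \<Rightarrow> ('x \<times> 'y) kernel \<Rightarrow> real" where
  "cond_norm X Y \<rho> = Sup {Re (kernel_pair (X \<times> Y) \<rho> c) | c. chan_kernel X Y c}"

lemma cond_norm_cong:
  assumes "\<rho> \<simeq>\<^bsub>X \<times> Y\<^esub> \<rho>'"
  shows "cond_norm X Y \<rho> = cond_norm X Y \<rho>'"
  unfolding cond_norm_def kernel_pair_cong[OF assms kernel_eq_refl] ..

lemma cond_norm_upper:
  assumes fin: "finite X" "finite Y" and pos_\<rho>: "pos_kernel (X \<times> Y) \<rho>"
    and chan_c: "chan_kernel X Y c"
  shows "Re (kernel_pair (X \<times> Y) \<rho> c) \<le> cond_norm X Y \<rho>"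
  unfolding cond_norm_def
proof (rule cSup_upper)
  have "Re (kernel_pair (X \<times> Y) \<rho> d) \<le> Re (kernel_trace (X \<times> Y) \<rho>) * card X"
    if "chan_kernel X Y d" for d
    using kernel_pair_le_trace[OF _ pos_\<rho>, of d] fin that kernel_trace_chan_kernel[OF that]
    by (simp add: chan_kernel_def)
  then show "bdd_above {Re (kernel_pair (X \<times> Y) \<rho> c) | c. chan_kernel X Y c}"
    by (intro bdd_aboveI) blast
qed (use chan_c in blast)

lemma cond_norm_least:
  assumes "finite X" "finite Y" "Y \<noteq> {}"
    and "\<And>c. chan_kernel X Y c \<Longrightarrow> Re (kernel_pair (X \<times> Y) \<rho> c) \<le> b"
  shows "cond_norm X Y \<rho> \<le> b"
  unfolding cond_norm_def
  by (rule cSup_least) (use chan_kernel_depolarizing[OF assms(1-3)] assms(4) in blast)+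

lemma cond_norm_least_scaled:
  assumes fin: "finite X" "finite Y" "Y \<noteq> {}" and "0 \<le> s"
    and bound: "\<And>c. chan_kernel X Y c \<Longrightarrow> s * Re (kernel_pair (X \<times> Y) \<rho> c) \<le> b"
  shows "s * cond_norm X Y \<rho> \<le> b"
proof (cases "s = 0")
  case True
  then show ?thesis using bound[OF chan_kernel_depolarizing[OF fin]] by simp
next
  case False
  then have "cond_norm X Y \<rho> \<le> b / s"
    using \<open>0 \<le> s\<close> bound by (intro cond_norm_least[OF fin]) (simp add: field_simps)
  then show ?thesis using False \<open>0 \<le> s\<close> by (simp add: field_simps)
qed

lemma cond_norm_nonneg:
  assumes "finite X" "finite Y" "Y \<noteq> {}" "pos_kernel (X \<times> Y) \<rho>"
  shows "0 \<le> cond_norm X Y \<rho>"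
proof -
  have chan_c: "chan_kernel X Y ((1 / card Y) *\<^sub>R one_kernel)"
    by (rule chan_kernel_depolarizing[OF assms(1-3)])
  then have "0 \<le> kernel_pair (X \<times> Y) \<rho> ((1 / card Y) *\<^sub>R one_kernel)"
    using assms by (intro kernel_pair_nonneg) (auto simp: chan_kernel_def)
  then show ?thesis
    using cond_norm_upper[OF assms(1,2,4) chan_c] by (simp add: less_eq_complex_def)
qed

lemma cond_norm_scaleR:
  assumes fin: "finite X" "finite Y" "Y \<noteq> {}" and pos_\<rho>: "pos_kernel (X \<times> Y) \<rho>"
    and s_positive: "0 < s"
  shows "cond_norm X Y (s *\<^sub>R \<rho>) = s * cond_norm X Y \<rho>"
proof (rule antisym)
  show "cond_norm X Y (s *\<^sub>R \<rho>) \<le> s * cond_norm X Y \<rho>"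
    using cond_norm_upper[OF fin(1,2) pos_\<rho>] s_positive
    by (intro cond_norm_least[OF fin]) (simp add: kernel_pair_scaleR_left)
  have "cond_norm X Y \<rho> \<le> cond_norm X Y (s *\<^sub>R \<rho>) / s"
    using cond_norm_upper[OF fin(1,2) pos_kernel_scaleR[OF pos_\<rho>, of s]] s_positive
    by (intro cond_norm_least[OF fin]) (simp add: kernel_pair_scaleR_left field_simps)
  then show "s * cond_norm X Y \<rho> \<le> cond_norm X Y (s *\<^sub>R \<rho>)"
    using s_positive by (simp add: field_simps)
qed

lemma cond_norm_link_le:
  assumes fin: "finite X" "finite Y" "finite Z" "Z \<noteq> {}"
    and chan_c: "chan_kernel X Y c" and pos_\<rho>: "pos_kernel (X \<times> Z) \<rho>"
  shows "cond_norm Y Z (link X (swap_kernel c) \<rho>) \<le> cond_norm X Z \<rho>"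
proof (rule cond_norm_least[OF fin(2-4)])
  fix d assume "chan_kernel Y Z d"
  then have "chan_kernel X Z (link Y c d)" using chan_c fin by (intro chan_kernel_link)
  from cond_norm_upper[OF fin(1,3) pos_\<rho> this]
  show "Re (kernel_pair (Y \<times> Z) (link X (swap_kernel c) \<rho>) d) \<le> cond_norm X Z \<rho>"
    by (simp add: kernel_pair_link_left)
qed

lemma pos_kernel_one_minus_if_states_bounded:
  assumes fin: "finite X" and herm: "herm_kernel X A"
    and bound: "\<And>\<sigma>. density_kernel X \<sigma> \<Longrightarrow> Re (kernel_pair X A \<sigma>) \<le> k"
  shows "pos_kernel X (k *\<^sub>R one_kernel - A)"
proof (rule pos_kernel_if_pairing_nonneg)
  show "herm_kernel X (k *\<^sub>R one_kernel - A)"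
    by (intro herm_kernel_diff herm_kernel_scaleR herm_kernel_one herm)
  fix u
  have "Re (kernel_pair X A (outer u u)) \<le> k * Re (kernel_trace X (outer u u))"
  proof (cases "outer u u \<simeq>\<^bsub>X\<^esub> 0")
    case True
    then show ?thesis by (simp add: kernel_pair_def kernel_trace_def kernel_eq_def)
  next
    case False
    note normalised = density_kernel_normalise[OF fin pos_kernel_outer this]
    from bound[OF normalised(2)] normalised(1) show ?thesis
      by (simp add: kernel_pair_scaleR_right field_simps)
  qed
  then show "0 \<le> Re (kernel_pair X (k *\<^sub>R one_kernel - A) (outer u u))"
    by (simp add: kernel_pair_commute[of X _ "outer u u"] kernel_pair_diff_right
        kernel_pair_scaleR_right kernel_pair_one[OF fin])
qed

lemma chan_kernel_dominating:
  assumes fin: "finite X" "finite Y" "Y \<noteq> {}" and pos_A: "pos_kernel (X \<times> Y) A" and "0 < k"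
    and marginal: "pos_kernel X (k *\<^sub>R one_kernel - ptrace Y A)"
  obtains c where "chan_kernel X Y c" "pos_kernel (X \<times> Y) (k *\<^sub>R c - A)"
proof -
  define R where "R = (1 / card Y) *\<^sub>R
    kernel_tensor (k *\<^sub>R one_kernel - ptrace Y A) (one_kernel :: 'b kernel)"
  define c where "c = (1 / k) *\<^sub>R (A + R)"
  have pos_R: "pos_kernel (X \<times> Y) R"
    unfolding R_def using fin marginal by (intro pos_kernel_scaleR pos_kernel_tensor_one) auto
  moreover have "ptrace Y R = k *\<^sub>R one_kernel - ptrace Y A"
    using fin by (simp add: R_def ptrace_scaleR ptrace_tensor kernel_trace_one fun_eq_iff
        scaleR_conv_of_real)
  ultimately have "chan_kernel X Y c"
    using pos_A \<open>0 < k\<close>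
    by (simp add: chan_kernel_def c_def pos_kernel_add pos_kernel_scaleR ptrace_add ptrace_scaleR)
  moreover have "k *\<^sub>R c - A = R" using \<open>0 < k\<close> by (simp add: c_def)
  ultimately show ?thesis using that pos_R by metis
qed

lemma cond_norm_ge_if_states_bounded:
  assumes fin: "finite X" "X \<noteq> {}" "finite Y" "Y \<noteq> {}" and pos_\<rho>: "pos_kernel (X \<times> Y) \<rho>" and "0 < l"
    and density_A: "density_kernel (X \<times> Y) A"
    and bound: "\<And>\<sigma>. density_kernel X \<sigma> \<Longrightarrow>
        l * Re (kernel_pair X (ptrace Y A) \<sigma>) \<le> Re (kernel_pair (X \<times> Y) A \<rho>)"
  shows "l \<le> cond_norm X Y \<rho>"
proof -
  define k where "k = Re (kernel_pair (X \<times> Y) A \<rho>) / l"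
  have pos_A: "pos_kernel (X \<times> Y) A" using density_A by (simp add: density_kernel_def)
  have bounded_by_k: "Re (kernel_pair X (ptrace Y A) \<sigma>) \<le> k" if "density_kernel X \<sigma>" for \<sigma>
    using bound[OF that] \<open>0 < l\<close> by (simp add: k_def field_simps)
  have "kernel_pair X (ptrace Y A) ((1 / card X) *\<^sub>R one_kernel) = of_real (1 / card X)"
    using density_A fin by (simp add: kernel_pair_scaleR_right kernel_pair_one density_kernel_def
        kernel_trace_prod[symmetric] scaleR_conv_of_real)
  then have "1 / card X \<le> k" using bounded_by_k[OF density_kernel_one[OF fin(1,2)]] by simp
  moreover have "0 < 1 / real (card X)" using fin by (simp add: card_gt_0_iff)
  ultimately have "0 < k" by (rule order_less_le_trans[rotated])
  have "herm_kernel X (ptrace Y A)"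
    using fin pos_A by (intro pos_kernel_herm pos_kernel_ptrace)
  from pos_kernel_one_minus_if_states_bounded[OF fin(1) this bounded_by_k]
  obtain c where chan_c: "chan_kernel X Y c" "pos_kernel (X \<times> Y) (k *\<^sub>R c - A)"
    using chan_kernel_dominating[OF fin(1,3,4) pos_A \<open>0 < k\<close>] by blast
  have "k * l = Re (kernel_pair (X \<times> Y) \<rho> A)"
    using \<open>0 < l\<close> by (simp add: k_def kernel_pair_commute)
  also have "\<dots> \<le> Re (kernel_pair (X \<times> Y) \<rho> (k *\<^sub>R c))"
    using fin pos_\<rho> chan_c(2) by (intro kernel_pair_mono) auto
  also have "\<dots> \<le> k * cond_norm X Y \<rho>"
    using cond_norm_upper[OF fin(1,3) pos_\<rho> chan_c(1)] \<open>0 < k\<close>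
    by (simp add: kernel_pair_scaleR_right)
  finally show ?thesis using \<open>0 < k\<close> by simp
qed

definition dominance_gaps :: "'x set \<Rightarrow> real \<Rightarrow> ('x \<times> 'y) kernel \<Rightarrow> ('x \<times> 'y) kernel set" where
  "dominance_gaps X k \<rho> = {k *\<^sub>R kernel_tensor \<sigma> one_kernel - \<rho> | \<sigma>. density_kernel X \<sigma>}"

lemma dominance_gaps_nonempty: "finite X \<Longrightarrow> X \<noteq> {} \<Longrightarrow> dominance_gaps X k \<rho> \<noteq> {}"
  using density_kernel_one by (fastforce simp: dominance_gaps_def)

lemma dominance_gaps_herm:
  assumes "finite X" "finite Y" "pos_kernel (X \<times> Y) \<rho>" "A \<in> dominance_gaps X k \<rho>"
  shows "herm_kernel (X \<times> Y) A"
  using assms by (auto simp: dominance_gaps_def density_kernel_def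
      herm_kernel_diff herm_kernel_scaleR pos_kernel_herm pos_kernel_tensor_one)

lemma dominance_gaps_convex:
  fixes \<rho> :: "('x \<times> 'y) kernel"
  shows "convex (dominance_gaps X k \<rho>)"
proof -
  define T where "T \<sigma> = k *\<^sub>R kernel_tensor \<sigma> (one_kernel :: 'y kernel)" for \<sigma> :: "'x kernel"
  have "dominance_gaps X k \<rho> = (\<lambda>A. A - \<rho>) ` T ` {\<sigma>. density_kernel X \<sigma>}"
    by (auto simp: dominance_gaps_def T_def)
  moreover have "linear T"
    by (rule linearI) (auto simp: T_def kernel_tensor_def fun_eq_iff algebra_simps)
  ultimately show ?thesis
    by (simp only:) (intro convex_translation_subtract convex_linear_image density_kernel_convex)
qed

lemma density_kernel_mix_one:
  fixes k \<eta> l :: real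
  assumes "finite X" "density_kernel X \<sigma>" "0 \<le> k" "0 < \<eta>" "0 < l" and l_eq: "l = k + \<eta> * card X"
  defines "\<tau> \<equiv> (1 / l) *\<^sub>R (k *\<^sub>R \<sigma> + \<eta> *\<^sub>R one_kernel)"
  shows "density_kernel X \<tau>" "pos_kernel X (\<tau> - (\<eta> / l) *\<^sub>R one_kernel)"
proof -
  have "complex_of_real k + of_real \<eta> * of_nat (card X) = of_real l" unfolding l_eq by simp
  then show "density_kernel X \<tau>"
    using assms(1-5)
    by (simp add: density_kernel_def \<tau>_def pos_kernel_add pos_kernel_scaleR pos_kernel_one
        kernel_trace_scaleR kernel_trace_add kernel_trace_one scaleR_conv_of_real)
  show "pos_kernel X (\<tau> - (\<eta> / l) *\<^sub>R one_kernel)"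
    using assms(2,3,5) by (simp add: \<tau>_def scaleR_add_right density_kernel_def pos_kernel_scaleR)
qed

theorem cond_norm_dual:
  fixes X :: "'x set" and Y :: "'y set"
  assumes fin: "finite X" "X \<noteq> {}" "finite Y" "Y \<noteq> {}" and pos: "pos_kernel (X \<times> Y) \<rho>"
    and less: "cond_norm X Y \<rho> < l"
  obtains \<sigma> \<delta> where "density_kernel X \<sigma>" "0 < \<delta>" "pos_kernel X (\<sigma> - \<delta> *\<^sub>R one_kernel)"
    "pos_kernel (X \<times> Y) (l *\<^sub>R kernel_tensor \<sigma> one_kernel - \<rho>)"
proof -
  obtain k where between: "cond_norm X Y \<rho> < k" "k < l" using dense[OF less] by blast
  then have "0 < k" using cond_norm_nonneg[OF fin(1,3,4) pos] by simp
  define \<eta> where "\<eta> = (l - k) / card X"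
  have gap: "0 < \<eta>" "l = k + \<eta> * card X" using between fin by (simp_all add: \<eta>_def card_gt_0_iff)
  have "0 < l" using \<open>0 < k\<close> between(2) by simp
  show ?thesis
  proof (rule pos_kernel_alternative[OF _ dominance_gaps_nonempty[OF fin(1,2)]
        dominance_gaps_herm[OF fin(1,3) pos] dominance_gaps_convex gap(1)])
    fix A assume "A \<in> dominance_gaps X k \<rho>" and pos_A: "pos_kernel (X \<times> Y) (A + \<eta> *\<^sub>R one_kernel)"
    then obtain \<sigma> where density: "density_kernel X \<sigma>"
      and A_eq: "A = k *\<^sub>R kernel_tensor \<sigma> one_kernel - \<rho>"
      by (auto simp: dominance_gaps_def)
    define \<tau> where "\<tau> = (1 / l) *\<^sub>R (k *\<^sub>R \<sigma> + \<eta> *\<^sub>R one_kernel)"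
    have "density_kernel X \<tau>" "pos_kernel X (\<tau> - (\<eta> / l) *\<^sub>R one_kernel)"
      unfolding \<tau>_def
      by (rule density_kernel_mix_one[OF fin(1) density less_imp_le[OF \<open>0 < k\<close>] gap(1)
            \<open>0 < l\<close> gap(2)])+
    moreover have "l *\<^sub>R kernel_tensor \<tau> (one_kernel :: 'y kernel) - \<rho> = A + \<eta> *\<^sub>R one_kernel"
      using \<open>0 < l\<close> unfolding one_kernel_prod A_eq
      by (simp add: \<tau>_def kernel_tensor_def fun_eq_iff scaleR_conv_of_real algebra_simps)
    then have "pos_kernel (X \<times> Y) (l *\<^sub>R kernel_tensor \<tau> one_kernel - \<rho>)" using pos_A by simp
    moreover have "0 < \<eta> / l" using gap(1) \<open>0 < l\<close> by simp
    ultimately show ?thesis using that by blast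
  next
    fix A m assume density: "density_kernel (X \<times> Y) A" and "0 < m"
      and separated: "\<And>B. B \<in> dominance_gaps X k \<rho> \<Longrightarrow> Re (kernel_pair (X \<times> Y) A B) \<le> - m"
    have "k * Re (kernel_pair X (ptrace Y A) \<sigma>) \<le> Re (kernel_pair (X \<times> Y) A \<rho>)"
      if "density_kernel X \<sigma>" for \<sigma>
    proof -
      have "k *\<^sub>R kernel_tensor \<sigma> one_kernel - \<rho> \<in> dominance_gaps X k \<rho>"
        using that by (auto simp: dominance_gaps_def)
      from separated[OF this] \<open>0 < m\<close> show ?thesis
        by (simp add: kernel_pair_diff_right kernel_pair_scaleR_right
            kernel_pair_tensor_one[OF fin(3)])
    qed
    then show ?thesis using cond_norm_ge_if_states_bounded[OF fin pos \<open>0 < k\<close> density] between(1)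
      by simp
  qed (use fin in simp)
qed

section \<open>Matrices on a tensor product as bipartite kernels\<close>

abbreviation grid :: "nat \<Rightarrow> nat \<Rightarrow> (nat \<times> nat) set" where
  "grid r n \<equiv> {..<r} \<times> {..<n}"

definition bip_kernel :: "nat \<Rightarrow> complex mat \<Rightarrow> (nat \<times> nat) kernel" where
  "bip_kernel n A p q = A $$ (fst p * n + snd p, fst q * n + snd q)"

definition kernel_mat :: "nat \<Rightarrow> nat \<Rightarrow> (nat \<times> nat) kernel \<Rightarrow> complex mat" where
  "kernel_mat r n C = mat (r * n) (r * n) (\<lambda>(p, q). C (p div n, p mod n) (q div n, q mod n))"

lemma grid_index_less:
  assumes "i < r" "a < (n :: nat)"
  shows "i * n + a < r * n"
proof -
  have "i * n + a < Suc i * n" using assms(2) by simp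
  also have "\<dots> \<le> r * n" using assms(1) by (intro mult_le_mono1) simp
  finally show ?thesis .
qed

lemma div_mod_less:
  assumes "p < r * (n :: nat)"
  shows "p div n < r" "p mod n < n"
proof -
  have "n > 0" using assms by (cases n) auto
  then show "p div n < r" "p mod n < n" using assms by (auto simp: less_mult_imp_div_less)
qed

lemma sum_grid: "(\<Sum>p<r * n. f p) = (\<Sum>z\<in>grid r n. f (fst z * n + snd z :: nat))"
  by (rule sum.reindex_bij_witness[where i = "\<lambda>z. fst z * n + snd z"
        and j = "\<lambda>p. (p div n, p mod n)"])
    (auto simp: div_mod_less grid_index_less)

lemma kernel_mat_carrier [simp]: "kernel_mat r n C \<in> carrier_mat (r * n) (r * n)"
  by (simp add: kernel_mat_def)

lemma bip_kernel_kernel_mat: "bip_kernel n (kernel_mat r n C) \<simeq>\<^bsub>grid r n\<^esub> C"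
  by (rule kernel_eqI) (auto simp: bip_kernel_def kernel_mat_def grid_index_less)

lemma mat_eq_iff_bip_kernel:
  assumes "A \<in> carrier_mat (r * n) (r * n)" "B \<in> carrier_mat (r * n) (r * n)"
  shows "A = B \<longleftrightarrow> bip_kernel n A \<simeq>\<^bsub>grid r n\<^esub> bip_kernel n B"
proof
  assume kernels_eq: "bip_kernel n A \<simeq>\<^bsub>grid r n\<^esub> bip_kernel n B"
  show "A = B"
  proof (rule eq_matI)
    fix p q assume "p < dim_row B" "q < dim_col B"
    then have "p < r * n" "q < r * n" using assms by auto
    then show "A $$ (p, q) = B $$ (p, q)"
      using kernel_eqD[OF kernels_eq, of "(p div n, p mod n)" "(q div n, q mod n)"]
      by (simp add: bip_kernel_def div_mod_less)
  qed (use assms in auto)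
qed simp

lemma psd_iff_pos_kernel:
  "psd (r * n) A \<longleftrightarrow> A \<in> carrier_mat (r * n) (r * n) \<and> pos_kernel (grid r n) (bip_kernel n A)"
proof (cases "A \<in> carrier_mat (r * n) (r * n)")
  case True
  let ?q = "\<lambda>v. (A *\<^sub>v v) \<bullet> conjugate v"
  have form: "?q v = sesq (grid r n) (bip_kernel n A) (\<lambda>z. v $ (fst z * n + snd z))
        (\<lambda>z. v $ (fst z * n + snd z))"
    if "v \<in> carrier_vec (r * n)" for v
  proof -
    have "?q v = (\<Sum>i<r * n. \<Sum>j<r * n. cnj (v $ i) * A $$ (i, j) * v $ j)"
      using True that by (auto simp: scalar_prod_def atLeast0LessThan sum_distrib_left mult_ac
          intro!: sum.cong)
    then show ?thesis unfolding sum_grid by (simp add: sesq_def bip_kernel_def)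
  qed
  have "sesq (grid r n) (bip_kernel n A) u u = ?q (vec (r * n) (\<lambda>p. u (p div n, p mod n)))" for u
    unfolding form[OF vec_carrier] sesq_def by (intro sum.cong refl) (auto simp: grid_index_less)
  then have "pos_kernel (grid r n) (bip_kernel n A)" if "\<And>v. v \<in> carrier_vec (r * n) \<Longrightarrow> 0 \<le> ?q v"
    using that by (simp add: pos_kernel_def)
  moreover have "0 \<le> ?q v" if "pos_kernel (grid r n) (bip_kernel n A)"
    "v \<in> carrier_vec (r * n)" for v
    unfolding form[OF that(2)] by (rule pos_kernelD[OF that(1)])
  moreover have "z \<in> \<real> \<and> 0 \<le> Re z \<longleftrightarrow> 0 \<le> z" for z
    by (auto simp: less_eq_complex_def complex_is_Real_iff)
  ultimately show ?thesis using True by (auto simp: psd_def)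
qed (simp add: psd_def)

lemma psd_kernel_mat: "pos_kernel (grid r n) C \<Longrightarrow> psd (r * n) (kernel_mat r n C)"
  by (simp add: psd_iff_pos_kernel pos_kernel_cong[OF bip_kernel_kernel_mat])

lemma psd_carrier: "psd d A \<Longrightarrow> A \<in> carrier_mat d d"
  by (simp add: psd_def)

lemma mtrace_eq_kernel_trace:
  "A \<in> carrier_mat (r * n) (r * n) \<Longrightarrow> mtrace A = kernel_trace (grid r n) (bip_kernel n A)"
  by (simp add: mtrace_def kernel_trace_def bip_kernel_def sum_grid)

lemma mtrace_kernel_mat: "mtrace (kernel_mat r n C) = kernel_trace (grid r n) C"
  using kernel_trace_cong[OF bip_kernel_kernel_mat]
  by (simp add: mtrace_eq_kernel_trace[of _ r n])

lemma state_iff_density_kernel: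
  "state (r * n) A \<longleftrightarrow> A \<in> carrier_mat (r * n) (r * n) \<and> density_kernel (grid r n) (bip_kernel n A)"
  by (auto simp: state_def psd_iff_pos_kernel density_kernel_def mtrace_eq_kernel_trace[of _ r n])

lemma bip_kernel_mult:
  assumes "A \<in> carrier_mat (r * n) (r * n)" "B \<in> carrier_mat (r * n) (r * n)"
  shows "bip_kernel n (A * B) \<simeq>\<^bsub>grid r n\<^esub> kernel_mult (grid r n) (bip_kernel n A) (bip_kernel n B)"
proof (rule kernel_eqI)
  fix p q assume "p \<in> grid r n" "q \<in> grid r n"
  then have "fst p * n + snd p < r * n" "fst q * n + snd q < r * n" by (auto simp: grid_index_less)
  then show "bip_kernel n (A * B) p q =
      kernel_mult (grid r n) (bip_kernel n A) (bip_kernel n B) p q"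
    using assms sum_grid[of _ r n]
    by (auto simp: bip_kernel_def kernel_mult_def scalar_prod_def atLeast0LessThan)
qed

lemma mat_adjoint_carrier: "A \<in> carrier_mat m k \<Longrightarrow> mat_adjoint A \<in> carrier_mat k m"
  by (simp add: mat_adjoint_def mat_of_rows_def)

lemma mat_adjoint_index:
  assumes "A \<in> carrier_mat m k" "i < k" "j < m"
  shows "mat_adjoint A $$ (i, j) = cnj (A $$ (j, i))"
  using assms by (simp add: mat_adjoint_def mat_of_rows_def)

lemma bip_kernel_adjoint:
  assumes "A \<in> carrier_mat (r * n) (r * n)"
  shows "bip_kernel n (mat_adjoint A) \<simeq>\<^bsub>grid r n\<^esub> kernel_adjoint (bip_kernel n A)"
  by (rule kernel_eqI) (auto simp: bip_kernel_def kernel_adjoint_def grid_index_less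
      mat_adjoint_index[OF assms])

lemma mtrace_mult:
  assumes "A \<in> carrier_mat (r * n) (r * n)" "B \<in> carrier_mat (r * n) (r * n)"
  shows "mtrace (A * B) = kernel_pair (grid r n) (bip_kernel n A)
        (kernel_transpose (bip_kernel n B))"
proof -
  have "mtrace (A * B) = kernel_trace (grid r n)
        (kernel_mult (grid r n) (bip_kernel n A) (bip_kernel n B))"
    using assms kernel_trace_cong[OF bip_kernel_mult[OF assms]]
    by (simp add: mtrace_eq_kernel_trace[of _ r n])
  then show ?thesis by (simp add: kernel_trace_def kernel_mult_def kernel_pair_def
      kernel_transpose_def)
qed

section \<open>The trace norm\<close>

lemma trace_norm_eqI:
  assumes carrier_A: "A \<in> carrier_mat (r * n) (r * n)" and pos_B: "pos_kernel (grid r n) B"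
    and square: "kernel_mult (grid r n) B B \<simeq>\<^bsub>grid r n\<^esub>
        kernel_mult (grid r n) (kernel_adjoint (bip_kernel n A)) (bip_kernel n A)"
  shows "trace_norm A = Re (kernel_trace (grid r n) B)"
proof -
  have gram: "C * C = mat_adjoint A * A \<longleftrightarrow>
      kernel_mult (grid r n) (bip_kernel n C) (bip_kernel n C) \<simeq>\<^bsub>grid r n\<^esub> kernel_mult (grid r n) B B"
    if C_props: "C \<in> carrier_mat (r * n) (r * n)" for C
  proof -
    have "bip_kernel n (mat_adjoint A * A) \<simeq>\<^bsub>grid r n\<^esub> kernel_mult (grid r n) B B"
      by (rule kernel_eq_trans[OF bip_kernel_mult[OF mat_adjoint_carrier[OF carrier_A] carrier_A]
            kernel_eq_trans[OF kernel_mult_cong[OF bip_kernel_adjoint[OF carrier_A] kernel_eq_refl]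
                kernel_eq_sym[OF square]]])
    from kernel_eq_cong[OF bip_kernel_mult[OF C_props C_props] this] show ?thesis
      unfolding mat_eq_iff_bip_kernel[OF mult_carrier_mat[OF C_props C_props]
          mult_carrier_mat[OF mat_adjoint_carrier[OF carrier_A] carrier_A]] .
  qed
  have "(THE C. psd (r * n) C \<and> C * C = mat_adjoint A * A) = kernel_mat r n B"
  proof (rule the_equality)
    show "psd (r * n) (kernel_mat r n B) \<and> kernel_mat r n B * kernel_mat r n B = mat_adjoint A * A"
      unfolding gram[OF kernel_mat_carrier]
      by (intro conjI psd_kernel_mat[OF pos_B] kernel_mult_cong bip_kernel_kernel_mat)
    fix C assume C_props: "psd (r * n) C \<and> C * C = mat_adjoint A * A"
    then have carrier: "C \<in> carrier_mat (r * n) (r * n)" by (simp add: psd_carrier)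
    then have "kernel_mult (grid r n) (bip_kernel n C) (bip_kernel n C) \<simeq>\<^bsub>grid r n\<^esub>
        kernel_mult (grid r n) B B"
      using C_props gram by blast
    moreover have "pos_kernel (grid r n) (bip_kernel n C)"
      using C_props by (simp add: psd_iff_pos_kernel)
    ultimately have "bip_kernel n C \<simeq>\<^bsub>grid r n\<^esub> B"
      by (intro pos_kernel_sqrt_unique[OF _ _ pos_B]) simp_all
    then have "bip_kernel n C \<simeq>\<^bsub>grid r n\<^esub> bip_kernel n (kernel_mat r n B)"
      by (rule kernel_eq_trans[OF _ kernel_eq_sym[OF bip_kernel_kernel_mat]])
    then show "C = kernel_mat r n B"
      using mat_eq_iff_bip_kernel[OF carrier kernel_mat_carrier] by blast
  qed
  then show ?thesis using carrier_A by (simp add: trace_norm_def mtrace_kernel_mat)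
qed

lemma trace_norm_eq_sum:
  assumes carrier_A: "A \<in> carrier_mat (r * n) (r * n)" and finite_J: "finite J"
    and orthonormal_u: "orthonormal_on (grid r n) J u"
    and orthonormal_v: "orthonormal_on (grid r n) J v" and s_nonneg: "\<And>j. j \<in> J \<Longrightarrow> 0 \<le> s j"
    and sum: "bip_kernel n A \<simeq>\<^bsub>grid r n\<^esub> (\<Sum>j\<in>J. s j *\<^sub>R outer (u j) (v j))"
  shows "trace_norm A = (\<Sum>j\<in>J. s j)"
proof -
  define B where "B = (\<Sum>j\<in>J. s j *\<^sub>R outer (v j) (v j))"
  have adjoint: "kernel_adjoint (\<Sum>j\<in>J. s j *\<^sub>R outer (u j) (v j)) = (\<Sum>j\<in>J. s j *\<^sub>R outer (v j) (u j))"
    by (simp add: kernel_adjoint_sum kernel_adjoint_scaleR_outer)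
  have "kernel_mult (grid r n) B B =
      kernel_mult (grid r n) (\<Sum>j\<in>J. s j *\<^sub>R outer (v j) (u j)) (\<Sum>j\<in>J. s j *\<^sub>R outer (u j) (v j))"
    unfolding B_def kernel_mult_orthonormal_sum[OF finite_J orthonormal_u]
      kernel_mult_orthonormal_sum[OF finite_J orthonormal_v] ..
  then have "kernel_mult (grid r n) B B \<simeq>\<^bsub>grid r n\<^esub>
      kernel_mult (grid r n) (kernel_adjoint (bip_kernel n A)) (bip_kernel n A)"
    unfolding adjoint[symmetric]
    by (simp only:) (rule kernel_eq_sym[OF kernel_mult_cong[OF kernel_adjoint_cong[OF sum] sum]])
  moreover have "pos_kernel (grid r n) B"
    unfolding B_def using s_nonneg by (intro pos_kernel_sum pos_kernel_scaleR pos_kernel_outer)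
  ultimately have "trace_norm A = Re (kernel_trace (grid r n) B)"
    by (intro trace_norm_eqI[OF carrier_A])
  then show ?thesis by (simp add: B_def kernel_trace_orthonormal_sum[OF orthonormal_v])
qed

lemma trace_norm_svd:
  assumes carrier_A: "A \<in> carrier_mat (r * n) (r * n)"
  obtains J :: "nat set" and u v s where "finite J" "orthonormal_on (grid r n) J u"
    "orthonormal_on (grid r n) J v"
    "\<And>j. j \<in> J \<Longrightarrow> 0 < s j" "bip_kernel n A \<simeq>\<^bsub>grid r n\<^esub> (\<Sum>j\<in>J. s j *\<^sub>R outer (u j) (v j))"
    "trace_norm A = (\<Sum>j\<in>J. s j)"
proof -
  obtain J :: "nat set" and u v s where svd: "finite J" "orthonormal_on (grid r n) J u"
    "orthonormal_on (grid r n) J v"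
    "\<And>j. j \<in> J \<Longrightarrow> 0 < s j" "bip_kernel n A \<simeq>\<^bsub>grid r n\<^esub> (\<Sum>j\<in>J. s j *\<^sub>R outer (u j) (v j))"
    by (rule kernel_svd[of "grid r n" "bip_kernel n A"]) auto
  have "trace_norm A = (\<Sum>j\<in>J. s j)"
    by (rule trace_norm_eq_sum[OF carrier_A svd(1-3) _ svd(5)]) (simp add: svd(4) less_imp_le)
  with svd show ?thesis by (rule that)
qed

lemma trace_norm_nonneg:
  assumes "A \<in> carrier_mat (r * n) (r * n)"
  shows "0 \<le> trace_norm A"
  by (rule trace_norm_svd[OF assms]) (simp add: sum_nonneg less_imp_le)

lemma trace_norm_psd:
  assumes "psd (r * n) A"
  shows "trace_norm A = Re (mtrace A)"
proof -
  have carrier_A: "A \<in> carrier_mat (r * n) (r * n)"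
    and pos: "pos_kernel (grid r n) (bip_kernel n A)"
    using assms by (auto simp: psd_iff_pos_kernel)
  have "bip_kernel n A \<simeq>\<^bsub>grid r n\<^esub> kernel_adjoint (bip_kernel n A)"
    using pos_kernel_herm[OF _ pos] by (simp add: herm_kernel_def)
  from trace_norm_eqI[OF carrier_A pos kernel_mult_cong[OF this kernel_eq_refl]]
  have "trace_norm A = Re (kernel_trace (grid r n) (bip_kernel n A))" .
  then show ?thesis by (simp add: mtrace_eq_kernel_trace[OF carrier_A])
qed

lemma trace_norm_herm:
  assumes carrier_A: "A \<in> carrier_mat (r * n) (r * n)" and finite_J: "finite J"
    and orthonormal_v: "orthonormal_on (grid r n) J v"
    and sum: "bip_kernel n A \<simeq>\<^bsub>grid r n\<^esub> (\<Sum>j\<in>J. d j *\<^sub>R outer (v j) (v j))"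
  shows "trace_norm A = (\<Sum>j\<in>J. \<bar>d j\<bar>)"
proof -
  define u where "u j = (\<lambda>p. (if d j < 0 then - 1 else 1) * v j p)" for j
  have "orthonormal_on (grid r n) J u"
    using orthonormal_v unfolding orthonormal_on_def u_def inner_on_mult_left inner_on_mult_right
    by auto
  moreover have "(\<Sum>j\<in>J. d j *\<^sub>R outer (v j) (v j)) = (\<Sum>j\<in>J. \<bar>d j\<bar> *\<^sub>R outer (u j) (v j))"
    by (intro sum.cong refl) (auto simp: u_def outer_def fun_eq_iff)
  ultimately show ?thesis
    using sum by (intro trace_norm_eq_sum[OF carrier_A finite_J _ orthonormal_v abs_ge_zero]) auto
qed

subsection \<open>Off-diagonal blocks\<close>

text \<open>Positivity of the block kernel with diagonal blocks \<open>A\<close>, \<open>B\<close> and off-diagonal block \<open>- M\<close>.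
  The trace norm of \<open>M\<close> is the least value of \<open>(Tr A + Tr B) / 2\<close>, and completely positive maps act
  on such triples.\<close>

definition block_dominated :: "'i set \<Rightarrow> 'i kernel \<Rightarrow> 'i kernel \<Rightarrow> 'i kernel \<Rightarrow> bool" where
  "block_dominated I M A B \<longleftrightarrow> pos_kernel I A \<and> pos_kernel I B \<and>
    (\<forall>u v. 2 * Re (sesq I M u v) \<le> Re (sesq I A u u) + Re (sesq I B v v))"

lemma block_dominated_cong: "M \<simeq>\<^bsub>I\<^esub> M' \<Longrightarrow> block_dominated I M A B \<longleftrightarrow> block_dominated I M' A B"
  by (simp add: block_dominated_def sesq_cong)

lemma block_dominated_add:
  assumes "block_dominated I M A B" "block_dominated I M' A' B'"
  shows "block_dominated I (M + M') (A + A') (B + B')"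
  unfolding block_dominated_def sesq_add
proof (intro conjI allI)
  fix u v
  show "2 * Re (sesq I M u v + sesq I M' u v) \<le>
      Re (sesq I A u u + sesq I A' u u) + Re (sesq I B v v + sesq I B' v v)"
    using assms[unfolded block_dominated_def, THEN conjunct2, THEN conjunct2, rule_format, of u v]
    by simp
qed (use assms in \<open>auto simp: block_dominated_def intro: pos_kernel_add\<close>)

lemma block_dominated_minus:
  assumes "block_dominated I M A B"
  shows "block_dominated I (- M) A B"
  unfolding block_dominated_def sesq_minus
proof (intro conjI allI)
  fix u v
  have "2 * Re (sesq I M u (\<lambda>p. - 1 * v p)) \<le>
      Re (sesq I A u u) + Re (sesq I B (\<lambda>p. - 1 * v p) (\<lambda>p. - 1 * v p))"
    using assms by (simp add: block_dominated_def)
  then show "2 * Re (- sesq I M u v) \<le> Re (sesq I A u u) + Re (sesq I B v v)"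
    unfolding sesq_mult_left sesq_mult_right by simp
qed (use assms in \<open>auto simp: block_dominated_def\<close>)

lemma block_dominated_scaleR:
  assumes "block_dominated I M A B" "0 \<le> c"
  shows "block_dominated I (c *\<^sub>R M) (c *\<^sub>R A) (c *\<^sub>R B)"
  unfolding block_dominated_def sesq_scaleR
proof (intro conjI allI)
  fix u v
  have "c * (2 * Re (sesq I M u v)) \<le> c * (Re (sesq I A u u) + Re (sesq I B v v))"
    using assms by (intro mult_left_mono) (auto simp: block_dominated_def)
  then show "2 * Re (c *\<^sub>R sesq I M u v) \<le> Re (c *\<^sub>R sesq I A u u) + Re (c *\<^sub>R sesq I B v v)"
    by (simp add: algebra_simps)
qed (use assms in \<open>auto simp: block_dominated_def intro: pos_kernel_scaleR\<close>)

lemma block_dominated_sum: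
  assumes "\<And>j. j \<in> J \<Longrightarrow> block_dominated I (M j) (A j) (B j)"
  shows "block_dominated I (\<Sum>j\<in>J. M j) (\<Sum>j\<in>J. A j) (\<Sum>j\<in>J. B j)"
  using assms
proof (induction J rule: infinite_finite_induct)
  case (insert j J)
  have "block_dominated I (M j + (\<Sum>j\<in>J. M j)) (A j + (\<Sum>j\<in>J. A j)) (B j + (\<Sum>j\<in>J. B j))"
    by (rule block_dominated_add) (use insert in blast)+
  then show ?case by (simp only: sum.insert[OF insert.hyps])
qed (simp_all add: block_dominated_def pos_kernel_zero, simp_all add: sesq_def)

lemma block_dominated_link:
  assumes fin: "finite X" "finite Y" and pos_c: "pos_kernel (Y \<times> X) c"
    and dominated: "block_dominated (X \<times> Z) M A B"
  shows "block_dominated (Y \<times> Z) (link X c M) (link X c A) (link X c B)"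
proof -
  obtain J :: "nat set" and g where g_expansion: "c \<simeq>\<^bsub>Y \<times> X\<^esub> (\<Sum>j\<in>J. outer (g j) (g j))"
    using pos_kernel_gram[OF _ pos_c] fin by blast
  have link_sum: "sesq (Y \<times> Z) (link X c N) u v =
      (\<Sum>j\<in>J. sesq (Y \<times> Z) (link X (outer (g j) (g j)) N) u v)" for N u v
    unfolding sesq_cong[OF link_cong[OF g_expansion kernel_eq_refl]] link_sum_left sesq_sum ..
  have "2 * Re (sesq (Y \<times> Z) (link X (outer (g j) (g j)) M) u v) \<le>
      Re (sesq (Y \<times> Z) (link X (outer (g j) (g j)) A) u u) +
          Re (sesq (Y \<times> Z) (link X (outer (g j) (g j)) B) v v)" for j u v
    using dominated unfolding sesq_link_outer block_dominated_def by blast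
  then have "2 * Re (sesq (Y \<times> Z) (link X c M) u v) \<le>
      Re (sesq (Y \<times> Z) (link X c A) u u) + Re (sesq (Y \<times> Z) (link X c B) v v)" for u v
    unfolding link_sum Re_sum sum_distrib_left sum.distrib[symmetric] by (rule sum_mono)
  then show ?thesis
    using fin pos_c dominated by (simp add: block_dominated_def pos_kernel_link)
qed

lemma block_dominated_outer: "block_dominated I (outer a b) (outer a a) (outer b b)"
  unfolding block_dominated_def sesq_outer
proof (intro conjI allI pos_kernel_outer)
  fix u v
  define x where "x = inner_on I a u"
  define y where "y = inner_on I b v"
  have "2 * Re (cnj x * y) \<le> 2 * (cmod x * cmod y)"
    using complex_Re_le_cmod[of "cnj x * y"] by (simp add: norm_mult)
  also have "\<dots> \<le> (cmod x)\<^sup>2 + (cmod y)\<^sup>2" using sum_squares_bound[of "cmod x" "cmod y"] by simp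
  finally show "2 * Re (inner_on I u a * inner_on I b v) \<le>
      Re (inner_on I u a * inner_on I a u) + Re (inner_on I v b * inner_on I b v)"
    unfolding inner_on_cnj[of I a u, symmetric] inner_on_cnj[of I b v, symmetric] x_def[symmetric]
      y_def[symmetric]
    by (simp add: cmod_power2 flip: power2_eq_square)
qed

lemma trace_norm_block_attained:
  assumes carrier_M: "M \<in> carrier_mat (r * n) (r * n)"
  obtains A B where "block_dominated (grid r n) (bip_kernel n M) A B"
    "Re (kernel_trace (grid r n) A) = trace_norm M" "Re (kernel_trace (grid r n) B) = trace_norm M"
proof -
  obtain J :: "nat set" and u v s where svd: "finite J" "orthonormal_on (grid r n) J u"
    "orthonormal_on (grid r n) J v"
    "\<And>j. j \<in> J \<Longrightarrow> 0 < s j" "bip_kernel n M \<simeq>\<^bsub>grid r n\<^esub> (\<Sum>j\<in>J. s j *\<^sub>R outer (u j) (v j))"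
    "trace_norm M = (\<Sum>j\<in>J. s j)"
    by (rule trace_norm_svd[OF carrier_M]) blast
  have "block_dominated (grid r n) (bip_kernel n M) (\<Sum>j\<in>J. s j *\<^sub>R outer (u j) (u j))
        (\<Sum>j\<in>J. s j *\<^sub>R outer (v j) (v j))"
    unfolding block_dominated_cong[OF svd(5)]
    using svd(4) by (intro block_dominated_sum block_dominated_scaleR block_dominated_outer)
      (simp add: less_imp_le)
  then show ?thesis
    by (rule that) (simp_all add: kernel_trace_orthonormal_sum[OF svd(2)]
        kernel_trace_orthonormal_sum[OF svd(3)] svd(6))
qed

lemma trace_norm_le_block:
  assumes carrier_M: "M \<in> carrier_mat (r * n) (r * n)"
    and dominated: "block_dominated (grid r n) (bip_kernel n M) A B"
  shows "trace_norm M \<le> (Re (kernel_trace (grid r n) A) + Re (kernel_trace (grid r n) B)) / 2"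
proof -
  obtain J :: "nat set" and u v s where svd: "finite J" "orthonormal_on (grid r n) J u"
    "orthonormal_on (grid r n) J v"
    "\<And>j. j \<in> J \<Longrightarrow> 0 < s j" "bip_kernel n M \<simeq>\<^bsub>grid r n\<^esub> (\<Sum>j\<in>J. s j *\<^sub>R outer (u j) (v j))"
    "trace_norm M = (\<Sum>j\<in>J. s j)"
    by (rule trace_norm_svd[OF carrier_M]) blast
  have "sesq (grid r n) (bip_kernel n M) (u k) (v k) = of_real (s k)" if member: "k \<in> J" for k
  proof -
    have "sesq (grid r n) (bip_kernel n M) (u k) (v k) = (\<Sum>j\<in>J. if j = k then of_real (s k) else 0)"
      unfolding sesq_cong[OF svd(5)] sesq_sum sesq_scaleR sesq_outer
      using svd(2,3) member
      by (intro sum.cong refl) (auto simp: orthonormal_on_def scaleR_conv_of_real)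
    then show ?thesis using member svd(1) by simp
  qed
  then have "2 * trace_norm M = (\<Sum>j\<in>J. 2 * Re (sesq (grid r n) (bip_kernel n M) (u j) (v j)))"
    by (simp add: svd(6) sum_distrib_left)
  also have "\<dots> \<le> (\<Sum>j\<in>J. Re (sesq (grid r n) A (u j) (u j)) + Re (sesq (grid r n) B (v j) (v j)))"
    using dominated by (intro sum_mono) (simp add: block_dominated_def)
  also have "\<dots> \<le> Re (kernel_trace (grid r n) A) + Re (kernel_trace (grid r n) B)"
    unfolding sum.distrib using dominated svd(1-3)
    by (intro add_mono pos_kernel_bessel) (auto simp: block_dominated_def)
  finally show ?thesis by simp
qed

lemma kernel_pair_effect_unit_vector:
  assumes "finite I" and pos: "pos_kernel I T" "pos_kernel I (one_kernel - T)"
    and unit: "inner_on I v v = 1"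
  shows "0 \<le> Re (kernel_pair I T (outer v v))" "Re (kernel_pair I T (outer v v)) \<le> 1"
proof -
  show "0 \<le> Re (kernel_pair I T (outer v v))"
    using kernel_pair_nonneg[OF assms(1) pos(1) pos_kernel_outer[of _ v]]
    by (simp add: less_eq_complex_def)
  have "Re (kernel_pair I T (outer v v)) \<le> Re (kernel_pair I (outer v v) one_kernel)"
    unfolding kernel_pair_commute[of _ T]
    by (rule kernel_pair_mono[OF assms(1) pos_kernel_outer pos(2)])
  then show "Re (kernel_pair I T (outer v v)) \<le> 1"
    using unit by (simp add: kernel_pair_one[OF assms(1)] kernel_trace_outer)
qed

lemma kernel_pair_le_trace_norm:
  assumes carrier_D: "D \<in> carrier_mat (r * n) (r * n)"
    and herm: "herm_kernel (grid r n) (bip_kernel n D)" and trace: "mtrace D = 0"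
    and pos_T: "pos_kernel (grid r n) T"
    and pos_complement: "pos_kernel (grid r n) (one_kernel - T)"
  shows "Re (kernel_pair (grid r n) T (bip_kernel n D)) \<le> trace_norm D / 2"
proof -
  obtain J :: "nat set" and v d where finite_J: "finite J"
    and orthonormal_v: "orthonormal_on (grid r n) J v"
    and sum: "bip_kernel n D \<simeq>\<^bsub>grid r n\<^esub> (\<Sum>j\<in>J. d j *\<^sub>R outer (v j) (v j))"
    by (rule herm_kernel_spectral[OF _ herm]) auto
  define t where "t j = Re (kernel_pair (grid r n) T (outer (v j) (v j)))" for j
  have unit_interval: "0 \<le> t j" "t j \<le> 1" if "j \<in> J" for j
    unfolding t_def using orthonormal_v that
    by (auto simp: orthonormal_on_def intro!: kernel_pair_effect_unit_vector pos_T pos_complement)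
  have "complex_of_real (\<Sum>j\<in>J. d j) = 0"
    using trace kernel_trace_cong[OF sum]
    by (simp add: mtrace_eq_kernel_trace[OF carrier_D]
        kernel_trace_orthonormal_sum[OF orthonormal_v])
  then have sum_d: "(\<Sum>j\<in>J. d j) = 0" by (simp only: of_real_eq_0_iff)
  have "Re (kernel_pair (grid r n) T (bip_kernel n D)) = (\<Sum>j\<in>J. d j * t j)"
    unfolding kernel_pair_cong[OF kernel_eq_refl sum]
    by (simp add: kernel_pair_sum_right kernel_pair_scaleR_right t_def)
  also have "\<dots> \<le> (\<Sum>j\<in>J. (\<bar>d j\<bar> + d j) / 2)"
  proof (rule sum_mono)
    fix j assume "j \<in> J"
    then show "d j * t j \<le> (\<bar>d j\<bar> + d j) / 2"
      using unit_interval[of j] by (cases "0 \<le> d j") (auto simp: mult_left_le mult_nonpos_nonneg)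
  qed
  also have "\<dots> = trace_norm D / 2"
    unfolding trace_norm_herm[OF carrier_D finite_J orthonormal_v sum] sum_divide_distrib[symmetric]
      sum.distrib sum_d by simp
  finally show ?thesis .
qed

section \<open>Choi kernels of linear maps\<close>

definition choi_kernel :: "nat \<Rightarrow> cmap \<Rightarrow> (nat \<times> nat) kernel" where
  "choi_kernel r \<phi> p q = \<phi> (munit r (fst p) (fst q)) $$ (snd p, snd q)"

definition map_of_kernel :: "nat \<Rightarrow> nat \<Rightarrow> (nat \<times> nat) kernel \<Rightarrow> cmap" where
  "map_of_kernel r n C A = mat n n (\<lambda>(a, b). \<Sum>i<r. \<Sum>j<r. A $$ (i, j) * C (i, a) (j, b))"

lemma munit_carrier [simp]: "munit d i j \<in> carrier_mat d d"
  by (simp add: munit_def)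

lemma lin_map_carrier: "lin_map r n \<phi> \<Longrightarrow> A \<in> carrier_mat r r \<Longrightarrow> \<phi> A \<in> carrier_mat n n"
  by (simp add: lin_map_def)

lemma lin_map_restrict_entries:
  assumes lin: "lin_map r n \<phi>" and carrier_A: "A \<in> carrier_mat r r" and indices: "a < n" "b < n"
    and subset: "K \<subseteq> grid r r"
  shows "\<phi> (mat r r (\<lambda>z. if z \<in> K then A $$ z else 0)) $$ (a, b) =
    (\<Sum>z\<in>K. A $$ z * choi_kernel r \<phi> (fst z, a) (snd z, b))"
proof -
  have "finite K" using subset by (rule finite_subset) simp
  then show ?thesis
    using subset
  proof (induction K)
    case empty
    have "\<phi> (0 \<cdot>\<^sub>m A) = 0 \<cdot>\<^sub>m \<phi> A" using lin carrier_A by (simp add: lin_map_def)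
    moreover have "mat r r (\<lambda>z. if z \<in> {} then A $$ z else 0) = 0 \<cdot>\<^sub>m A"
      using carrier_A by (intro eq_matI) auto
    ultimately show ?case using lin_map_carrier[OF lin carrier_A] indices by auto
  next
    case (insert z K)
    have split: "mat r r (\<lambda>w. if w \<in> insert z K then A $$ w else 0) =
        mat r r (\<lambda>w. if w \<in> K then A $$ w else 0) + A $$ z \<cdot>\<^sub>m munit r (fst z) (snd z)"
      using insert.hyps(2) by (intro eq_matI) (auto simp: munit_def)
    have "\<phi> (mat r r (\<lambda>w. if w \<in> insert z K then A $$ w else 0)) =
        \<phi> (mat r r (\<lambda>w. if w \<in> K then A $$ w else 0)) + A $$ z \<cdot>\<^sub>m \<phi> (munit r (fst z) (snd z))"
      unfolding split using lin by (simp add: lin_map_def)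
    then show ?case
      using insert lin_map_carrier[OF lin, of "munit r (fst z) (snd z)"] indices
      by (auto simp: choi_kernel_def)
  qed
qed

lemma lin_map_entry:
  assumes lin: "lin_map r n \<phi>" and carrier_A: "A \<in> carrier_mat r r" and indices: "a < n" "b < n"
  shows "\<phi> A $$ (a, b) = (\<Sum>i<r. \<Sum>j<r. A $$ (i, j) * choi_kernel r \<phi> (i, a) (j, b))"
proof -
  have "mat r r (\<lambda>z. if z \<in> grid r r then A $$ z else 0) = A"
    using carrier_A by (intro eq_matI) auto
  with lin_map_restrict_entries[OF assms order_refl] show ?thesis
    by (simp add: sum.cartesian_product')
qed

lemma lin_map_map_of_kernel: "lin_map r n (map_of_kernel r n C)"
  unfolding lin_map_def map_of_kernel_def
  by (auto intro!: eq_matI simp: algebra_simps sum.distrib sum_distrib_left)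

lemma choi_kernel_map_of_kernel: "choi_kernel r (map_of_kernel r n C) \<simeq>\<^bsub>grid r n\<^esub> C"
proof (rule kernel_eqI)
  fix p q assume indices: "p \<in> grid r n" "q \<in> grid r n"
  have "choi_kernel r (map_of_kernel r n C) p q =
      (\<Sum>i<r. \<Sum>j<r. munit r (fst p) (fst q) $$ (i, j) * C (i, snd p) (j, snd q))"
    using indices by (auto simp: choi_kernel_def map_of_kernel_def)
  also have "\<dots> = (\<Sum>i<r. \<Sum>j<r. if j = fst q then if i = fst p then C p q else 0 else 0)"
    by (intro sum.cong refl) (auto simp: munit_def)
  finally show "choi_kernel r (map_of_kernel r n C) p q = C p q" using indices by auto
qed

lemma choi_kernel_compose:
  assumes "lin_map r s \<psi>" "lin_map s n \<phi>"
  shows "choi_kernel r (\<lambda>X. \<phi> (\<psi> X)) \<simeq>\<^bsub>grid r n\<^esub> link {..<s} (choi_kernel r \<psi>) (choi_kernel s \<phi>)"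
  using assms by (intro kernel_eqI)
    (auto simp: choi_kernel_def[of r] link_def lin_map_entry[OF assms(2)] lin_map_carrier)

lemma lin_map_compose: "lin_map r s \<psi> \<Longrightarrow> lin_map s n \<phi> \<Longrightarrow> lin_map r n (\<lambda>X. \<phi> (\<psi> X))"
  by (simp add: lin_map_def)

lemma lin_map_diff:
  assumes "lin_map r n \<phi>" "lin_map r n \<psi>"
  shows "lin_map r n (\<lambda>X. \<phi> X - \<psi> X)"
proof -
  have carrier: "\<phi> A \<in> carrier_mat n n" "\<psi> A \<in> carrier_mat n n" if "A \<in> carrier_mat r r" for A
    using assms that by (auto intro: lin_map_carrier)
  have "\<phi> (A + B) - \<psi> (A + B) = \<phi> A - \<psi> A + (\<phi> B - \<psi> B)"
    if "A \<in> carrier_mat r r" "B \<in> carrier_mat r r" for A B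
    using assms that by (intro eq_matI)
      (auto simp: lin_map_def carrier_matD[OF carrier(1)] carrier_matD[OF carrier(2)])
  moreover have "\<phi> (c \<cdot>\<^sub>m A) - \<psi> (c \<cdot>\<^sub>m A) = c \<cdot>\<^sub>m (\<phi> A - \<psi> A)" if "A \<in> carrier_mat r r" for A c
    using assms that by (intro eq_matI)
      (auto simp: lin_map_def algebra_simps carrier_matD[OF carrier(1)] carrier_matD[OF carrier(2)])
  ultimately show ?thesis using carrier unfolding lin_map_def by (simp add: minus_carrier_mat)
qed

lemma choi_kernel_diff:
  assumes "lin_map r n \<psi>"
  shows "choi_kernel r (\<lambda>X. \<phi> X - \<psi> X) \<simeq>\<^bsub>grid r n\<^esub> choi_kernel r \<phi> - choi_kernel r \<psi>"
  by (rule kernel_eqI) (auto simp: choi_kernel_def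
      carrier_matD[OF lin_map_carrier[OF assms munit_carrier]])

subsection \<open>Maps on one tensor factor\<close>

lemma bip_kernel_id_tensor:
  assumes "lin_map r n \<phi>"
  shows "bip_kernel n (id_tensor m r n \<phi> P) \<simeq>\<^bsub>grid m n\<^esub>
      link {..<r} (bip_kernel r P) (choi_kernel r \<phi>)"
  by (rule kernel_eqI) (auto simp: bip_kernel_def id_tensor_def link_def grid_index_less
      lin_map_entry[OF assms])

lemma bip_kernel_tensor_id:
  assumes "lin_map r n \<phi>"
  shows "bip_kernel k (tensor_id r n k \<phi> P) \<simeq>\<^bsub>grid n k\<^esub>
      link {..<r} (swap_kernel (choi_kernel r \<phi>)) (bip_kernel k P)"
  by (rule kernel_eqI)
    (auto simp: bip_kernel_def tensor_id_def link_def swap_kernel_def grid_index_less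
        lin_map_entry[OF assms] mult.commute[of "P $$ z" for z])

lemma id_tensor_carrier [simp]: "id_tensor m r n \<phi> P \<in> carrier_mat (m * n) (m * n)"
  by (simp add: id_tensor_def)

lemma tensor_id_carrier [simp]: "tensor_id r n k \<phi> P \<in> carrier_mat (n * k) (n * k)"
  by (simp add: tensor_id_def)

lemma max_ent_carrier [simp]: "max_ent d \<in> carrier_mat (d * d) (d * d)"
  by (simp add: max_ent_def)

lemma bip_kernel_max_ent: "bip_kernel d (max_ent d) \<simeq>\<^bsub>grid d d\<^esub> id_kernel"
  by (rule kernel_eqI) (auto simp: bip_kernel_def max_ent_def id_kernel_def outer_def
      grid_index_less)

lemma pos_kernel_choi_kernel_if_CP_map:
  assumes "0 < r" and lin: "lin_map r n \<phi>" and "CP_map r n \<phi>"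
  shows "pos_kernel (grid r n) (choi_kernel r \<phi>)"
proof -
  have "psd (r * r) (max_ent r)"
    by (simp add: psd_iff_pos_kernel pos_kernel_cong[OF bip_kernel_max_ent] id_kernel_def
        pos_kernel_outer)
  then have "psd (r * n) (id_tensor r r n \<phi> (max_ent r))" using assms by (simp add: CP_map_def)
  moreover have "bip_kernel n (id_tensor r r n \<phi> (max_ent r)) \<simeq>\<^bsub>grid r n\<^esub> choi_kernel r \<phi>"
    by (rule kernel_eq_trans[OF bip_kernel_id_tensor[OF lin]
          kernel_eq_trans[OF link_cong[OF bip_kernel_max_ent kernel_eq_refl] link_id_left]]) simp
  ultimately show ?thesis by (simp add: psd_iff_pos_kernel pos_kernel_cong)
qed

lemma CP_map_if_pos_kernel_choi_kernel:
  assumes lin: "lin_map r n \<phi>" and pos: "pos_kernel (grid r n) (choi_kernel r \<phi>)"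
  shows "CP_map r n \<phi>"
  unfolding CP_map_def psd_iff_pos_kernel
  using pos by (auto simp: pos_kernel_cong[OF bip_kernel_id_tensor[OF lin]] intro: pos_kernel_link)

lemma ptrace_choi_kernel:
  assumes "lin_map r n \<phi>"
  shows "ptrace {..<n} (choi_kernel r \<phi>) i j = mtrace (\<phi> (munit r i j))"
  using lin_map_carrier[OF assms, of "munit r i j"]
  by (auto simp: ptrace_def choi_kernel_def mtrace_def)

lemma TP_map_iff_ptrace_choi_kernel:
  assumes lin: "lin_map r n \<phi>"
  shows "TP_map r n \<phi> \<longleftrightarrow> ptrace {..<n} (choi_kernel r \<phi>) \<simeq>\<^bsub>{..<r}\<^esub> one_kernel"
proof
  assume trace_preserving: "TP_map r n \<phi>"
  have "mtrace (munit r i j) = one_kernel i j" if "i < r" for i j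
    using that by (auto simp: mtrace_def munit_def one_kernel_def)
  with trace_preserving show "ptrace {..<n} (choi_kernel r \<phi>) \<simeq>\<^bsub>{..<r}\<^esub> one_kernel"
    by (intro kernel_eqI) (simp add: ptrace_choi_kernel[OF lin] TP_map_def)
next
  assume marginal: "ptrace {..<n} (choi_kernel r \<phi>) \<simeq>\<^bsub>{..<r}\<^esub> one_kernel"
  show "TP_map r n \<phi>"
    unfolding TP_map_def
  proof
    fix A :: "complex mat" assume carrier_A: "A \<in> carrier_mat r r"
    have "mtrace (\<phi> A) = (\<Sum>a<n. \<Sum>i<r. \<Sum>j<r. A $$ (i, j) * choi_kernel r \<phi> (i, a) (j, a))"
      using lin_map_carrier[OF lin carrier_A]
      by (auto simp: mtrace_def lin_map_entry[OF lin carrier_A] intro!: sum.cong)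
    also have "\<dots> = (\<Sum>i<r. \<Sum>j<r. A $$ (i, j) * ptrace {..<n} (choi_kernel r \<phi>) i j)"
      unfolding ptrace_def sum_distrib_left by (subst sum.swap, intro sum.cong refl sum.swap)
    also have "\<dots> = (\<Sum>i<r. \<Sum>j<r. A $$ (i, j) * one_kernel i j)"
      using marginal by (simp add: kernel_eq_def)
    also have "\<dots> = mtrace A"
      using carrier_A by (simp add: one_kernel_def mtrace_def sum_mult_of_bool_eq)
    finally show "mtrace (\<phi> A) = mtrace A" .
  qed
qed

lemma channel_iff_chan_kernel:
  assumes "0 < r"
  shows "channel r n \<phi> \<longleftrightarrow> lin_map r n \<phi> \<and> chan_kernel {..<r} {..<n} (choi_kernel r \<phi>)"
  using pos_kernel_choi_kernel_if_CP_map[OF assms] CP_map_if_pos_kernel_choi_kernel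
    TP_map_iff_ptrace_choi_kernel
  by (auto simp: channel_def chan_kernel_def)

lemma channel_map_of_kernel:
  assumes "0 < r" "chan_kernel {..<r} {..<n} c"
  shows "channel r n (map_of_kernel r n c)"
  using assms by (simp add: channel_iff_chan_kernel lin_map_map_of_kernel
      chan_kernel_cong[OF choi_kernel_map_of_kernel])

lemma chan_kernel_choi_kernel:
  "0 < r \<Longrightarrow> channel r n \<phi> \<Longrightarrow> chan_kernel {..<r} {..<n} (choi_kernel r \<phi>)"
  by (simp add: channel_iff_chan_kernel)

lemma pos_kernel_link_swap_choi_kernel:
  assumes "0 < r" "channel r n \<phi>" "finite X" "pos_kernel (X \<times> {..<n}) \<rho>"
  shows "pos_kernel (X \<times> {..<r}) (link {..<n} \<rho> (swap_kernel (choi_kernel r \<phi>)))"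
  using chan_kernel_choi_kernel[OF assms(1,2)] assms(3,4)
  by (intro pos_kernel_link pos_kernel_swap) (auto simp: chan_kernel_def)

lemma channel_exists:
  assumes "0 < r" "0 < n"
  obtains \<phi> where "channel r n \<phi>"
  using channel_map_of_kernel[OF assms(1) chan_kernel_depolarizing[of "{..<r}" "{..<n}"]] assms(2)
  by (auto simp: lessThan_empty_iff)

subsection \<open>Adjoint and transpose\<close>

lemma mtrace_mult_munit:
  assumes "A \<in> carrier_mat n n" "a < n" "b < n"
  shows "mtrace (A * munit n a b) = A $$ (b, a)"
proof -
  have "mtrace (A * munit n a b) = (\<Sum>i<n. \<Sum>j<n. A $$ (i, j) * munit n a b $$ (j, i))"
    using assms(1) by (auto simp: mtrace_def scalar_prod_def atLeast0LessThan munit_def)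
  also have "\<dots> = (\<Sum>i<n. \<Sum>j<n. if j = a then if i = b then A $$ (b, a) else 0 else 0)"
    by (intro sum.cong refl) (auto simp: munit_def)
  finally show ?thesis using assms(2,3) by simp
qed

lemma hs_adj_carrier [simp]: "hs_adj r n \<phi> Z \<in> carrier_mat r r"
  by (simp add: hs_adj_def)

lemma hs_adj_munit:
  assumes lin: "lin_map r n \<phi>" and "i < r" "j < r" "a < n" "b < n"
  shows "hs_adj r n \<phi> (munit n a b) $$ (i, j) = cnj (choi_kernel r \<phi> (i, a) (j, b))"
proof -
  have carrier: "\<phi> (munit r i j) \<in> carrier_mat n n" using lin_map_carrier[OF lin] by simp
  show ?thesis
    using assms(2-) by (simp add: hs_adj_def mtrace_mult_munit[OF mat_adjoint_carrier[OF carrier]]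
        mat_adjoint_index[OF carrier] choi_kernel_def)
qed

lemma mtrace_add: "A \<in> carrier_mat n n \<Longrightarrow> B \<in> carrier_mat n n \<Longrightarrow> mtrace (A + B) = mtrace A + mtrace B"
  by (auto simp: mtrace_def sum.distrib)

lemma mtrace_smult: "A \<in> carrier_mat n n \<Longrightarrow> mtrace (c \<cdot>\<^sub>m A) = c * mtrace A"
  by (auto simp: mtrace_def sum_distrib_left)

lemma lin_map_hs_adj:
  assumes lin: "lin_map r n \<phi>"
  shows "lin_map n r (hs_adj r n \<phi>)"
proof -
  have carrier: "mat_adjoint (\<phi> (munit r i j)) \<in> carrier_mat n n" for i j
    using lin_map_carrier[OF lin] by (intro mat_adjoint_carrier) simp
  show ?thesis
    unfolding lin_map_def hs_adj_def
    using mtrace_add[OF mult_carrier_mat[OF carrier] mult_carrier_mat[OF carrier]]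
      mtrace_smult[OF mult_carrier_mat[OF carrier]]
    by (auto intro!: eq_matI simp: mult_add_distrib_mat[OF carrier] mult_smult_distrib[OF carrier])
qed

lemma choi_kernel_hs_adj:
  assumes lin: "lin_map r n \<phi>" and herm: "herm_kernel (grid r n) (choi_kernel r \<phi>)"
  shows "choi_kernel n (hs_adj r n \<phi>) \<simeq>\<^bsub>grid n r\<^esub> swap_kernel (kernel_transpose (choi_kernel r \<phi>))"
proof (rule kernel_eqI)
  fix p q assume "p \<in> grid n r" "q \<in> grid n r"
  then show "choi_kernel n (hs_adj r n \<phi>) p q =
      swap_kernel (kernel_transpose (choi_kernel r \<phi>)) p q"
    using herm_kernelD[OF herm, of "prod.swap q" "prod.swap p"]
    by (auto simp: choi_kernel_def[of n] hs_adj_munit[OF lin] swap_kernel_def kernel_transpose_def)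
qed

lemma lin_map_map_transp:
  assumes "lin_map r n \<phi>"
  shows "lin_map n r (map_transp r n \<phi>)"
proof -
  have hs_adj: "hs_adj r n \<phi> (A + B) = hs_adj r n \<phi> A + hs_adj r n \<phi> B"
    "hs_adj r n \<phi> (c \<cdot>\<^sub>m A) = c \<cdot>\<^sub>m hs_adj r n \<phi> A"
    if "A \<in> carrier_mat n n" "B \<in> carrier_mat n n" for A B c
    using lin_map_hs_adj[OF assms] that by (simp_all add: lin_map_def)
  have "(c \<cdot>\<^sub>m A)\<^sup>T = c \<cdot>\<^sub>m A\<^sup>T" for c and A :: "complex mat"
    by (rule eq_matI) auto
  then show ?thesis
    unfolding lin_map_def map_transp_def transp_def
    by (auto simp: transpose_add hs_adj transpose_add[OF hs_adj_carrier hs_adj_carrier])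
qed

lemma choi_kernel_map_transp:
  assumes lin: "lin_map r n \<phi>" and herm: "herm_kernel (grid r n) (choi_kernel r \<phi>)"
  shows "choi_kernel n (map_transp r n \<phi>) \<simeq>\<^bsub>grid n r\<^esub> swap_kernel (choi_kernel r \<phi>)"
proof (rule kernel_eqI)
  fix p q assume "p \<in> grid n r" "q \<in> grid n r"
  moreover have "transp (munit n a b) = munit n b a" for a b
    by (auto simp: transp_def munit_def)
  ultimately show "choi_kernel n (map_transp r n \<phi>) p q = swap_kernel (choi_kernel r \<phi>) p q"
    using herm_kernelD[OF herm, of "prod.swap p" "prod.swap q"]
    by (auto simp: choi_kernel_def[of n] map_transp_def transp_def hs_adj_munit[OF lin]
        swap_kernel_def carrier_matD[OF hs_adj_carrier])
qed

lemma bip_kernel_choi: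
  assumes "lin_map r n \<phi>"
  shows "bip_kernel r (choi r n \<phi>) \<simeq>\<^bsub>grid n r\<^esub> swap_kernel (choi_kernel r \<phi>)"
  unfolding choi_def
  by (rule kernel_eq_trans[OF bip_kernel_tensor_id[OF assms]
        kernel_eq_trans[OF link_cong[OF kernel_eq_refl bip_kernel_max_ent] link_id_right]]) simp

lemma pairing_eq_kernel_pair:
  assumes carrier_X: "X \<in> carrier_mat (r * n) (r * n)" and lin: "lin_map r n \<phi>"
    and herm: "herm_kernel (grid r n) (choi_kernel r \<phi>)"
  shows "pairing r n X \<phi> = kernel_pair (grid r n) (bip_kernel n X) (choi_kernel r \<phi>)"
proof -
  have "bip_kernel n (choi n r (hs_adj r n \<phi>)) \<simeq>\<^bsub>grid r n\<^esub> kernel_transpose (choi_kernel r \<phi>)"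
    using kernel_eq_trans[OF bip_kernel_choi[OF lin_map_hs_adj[OF lin]]
        swap_kernel_cong[OF choi_kernel_hs_adj[OF lin herm]]] by simp
  from kernel_transpose_cong[OF this]
  have "kernel_pair (grid r n) (bip_kernel n X)
        (kernel_transpose (bip_kernel n (choi n r (hs_adj r n \<phi>)))) =
      kernel_pair (grid r n) (bip_kernel n X) (choi_kernel r \<phi>)"
    by (intro kernel_pair_cong) simp_all
  then show ?thesis
    unfolding pairing_def using carrier_X by (simp add: mtrace_mult[of _ r n] choi_def)
qed

lemma choi_kernels_of_channels:
  assumes "0 < r" and cong: "\<And>c c'. c \<simeq>\<^bsub>grid r n\<^esub> c' \<Longrightarrow> f c = f c'"
  shows "{f (choi_kernel r \<alpha>) | \<alpha>. channel r n \<alpha>} = {f c | c. chan_kernel {..<r} {..<n} c}"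
proof -
  have "\<exists>\<alpha>. f c = f (choi_kernel r \<alpha>) \<and> channel r n \<alpha>" if "chan_kernel {..<r} {..<n} c" for c
    using cong[OF kernel_eq_sym[OF choi_kernel_map_of_kernel]]
      channel_map_of_kernel[OF assms(1) that] by blast
  then show ?thesis by (auto simp: channel_iff_chan_kernel[OF assms(1)])
qed

lemma cond_dnorm_eq_cond_norm:
  assumes "0 < r" "\<rho> \<in> carrier_mat (r * n) (r * n)"
  shows "cond_dnorm r n \<rho> = cond_norm {..<r} {..<n} (bip_kernel n \<rho>)"
proof -
  have "pairing r n \<rho> \<alpha> = kernel_pair (grid r n) (bip_kernel n \<rho>) (choi_kernel r \<alpha>)"
    if "channel r n \<alpha>" for \<alpha>
    using that assms by (intro pairing_eq_kernel_pair chan_kernel_herm)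
      (simp_all add: channel_iff_chan_kernel)
  then have "cond_dnorm r n \<rho> =
      Sup {Re (kernel_pair (grid r n) (bip_kernel n \<rho>) (choi_kernel r \<alpha>)) | \<alpha>. channel r n \<alpha>}"
    unfolding cond_dnorm_def by (intro arg_cong[where f = Sup] Collect_cong) metis
  also have "\<dots> = cond_norm {..<r} {..<n} (bip_kernel n \<rho>)"
    unfolding cond_norm_def
    by (intro arg_cong[where f = Sup] choi_kernels_of_channels assms(1) arg_cong[where f = Re]
        kernel_pair_cong kernel_eq_refl)
  finally show ?thesis .
qed

lemma cond_dnorm_id_tensor_map_transp:
  assumes "0 < m" "0 < r" and channel_\<phi>: "channel r n \<phi>"
  shows "cond_dnorm m r (id_tensor m n r (map_transp r n \<phi>) \<rho>) =
    cond_norm {..<m} {..<r} (link {..<n} (bip_kernel n \<rho>) (swap_kernel (choi_kernel r \<phi>)))"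
proof -
  have lin: "lin_map r n \<phi>" and "chan_kernel {..<r} {..<n} (choi_kernel r \<phi>)"
    using channel_\<phi> by (simp_all add: channel_iff_chan_kernel[OF assms(2)])
  then have "herm_kernel (grid r n) (choi_kernel r \<phi>)" by (simp add: chan_kernel_herm)
  then have "bip_kernel r (id_tensor m n r (map_transp r n \<phi>) \<rho>) \<simeq>\<^bsub>grid m r\<^esub>
      link {..<n} (bip_kernel n \<rho>) (swap_kernel (choi_kernel r \<phi>))"
    using kernel_eq_trans[OF bip_kernel_id_tensor[OF lin_map_map_transp[OF lin]]
        link_cong[OF kernel_eq_refl choi_kernel_map_transp[OF lin]]] by blast
  then show ?thesis using assms(1) by (simp add: cond_dnorm_eq_cond_norm cond_norm_cong)
qed

section \<open>The diamond norm of a difference of channels\<close>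

definition channel_difference :: "nat \<Rightarrow> nat \<Rightarrow> real \<Rightarrow> cmap \<Rightarrow> bool" where
  "channel_difference m n t \<Delta> \<longleftrightarrow> lin_map m n \<Delta> \<and> 0 \<le> t \<and>
     (\<exists>G H. chan_kernel {..<m} {..<n} G \<and> chan_kernel {..<m} {..<n} H \<and>
       choi_kernel m \<Delta> \<simeq>\<^bsub>grid m n\<^esub> t *\<^sub>R (G - H))"

lemma channel_differenceI:
  assumes "lin_map m n \<Delta>" "0 \<le> t" "chan_kernel {..<m} {..<n} G" "chan_kernel {..<m} {..<n} H"
    "choi_kernel m \<Delta> \<simeq>\<^bsub>grid m n\<^esub> t *\<^sub>R (G - H)"
  shows "channel_difference m n t \<Delta>"
  unfolding channel_difference_def using assms by blast

lemma channel_difference_tensor_id: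
  assumes "channel_difference m n t \<Delta>"
  obtains G H where "0 \<le> t" "chan_kernel {..<m} {..<n} G" "chan_kernel {..<m} {..<n} H"
    "\<And>k X. bip_kernel k (tensor_id m n k \<Delta> X) \<simeq>\<^bsub>grid n k\<^esub>
      t *\<^sub>R (link {..<m} (swap_kernel G) (bip_kernel k X) -
          link {..<m} (swap_kernel H) (bip_kernel k X))"
proof -
  obtain G H where lin: "lin_map m n \<Delta>" and t_nonneg: "0 \<le> t"
    and chan_G: "chan_kernel {..<m} {..<n} G"
    and chan_H: "chan_kernel {..<m} {..<n} H" and choi_\<Delta>: "choi_kernel m \<Delta> \<simeq>\<^bsub>grid m n\<^esub> t *\<^sub>R (G - H)"
    using assms by (auto simp: channel_difference_def)
  have "bip_kernel k (tensor_id m n k \<Delta> X) \<simeq>\<^bsub>grid n k\<^esub>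
      link {..<m} (swap_kernel (t *\<^sub>R (G - H))) (bip_kernel k X)" for k X
    by (rule kernel_eq_trans[OF bip_kernel_tensor_id[OF lin]
        link_cong[OF swap_kernel_cong[OF choi_\<Delta>] kernel_eq_refl]])
  then show ?thesis
    by (intro that[OF t_nonneg chan_G chan_H])
      (simp add: swap_kernel_scaleR swap_kernel_diff link_scaleR_left link_diff_left)
qed

lemma trace_norm_tensor_id_le:
  assumes difference_\<Delta>: "channel_difference m n t \<Delta>"
    and carrier_X: "X \<in> carrier_mat (m * k) (m * k)"
  shows "trace_norm (tensor_id m n k \<Delta> X) \<le> 2 * t * trace_norm X"
proof -
  obtain G H where t_nonneg: "0 \<le> t"
    and channels: "chan_kernel {..<m} {..<n} G" "chan_kernel {..<m} {..<n} H"
    and tensor: "\<And>k X. bip_kernel k (tensor_id m n k \<Delta> X) \<simeq>\<^bsub>grid n k\<^esub>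
      t *\<^sub>R (link {..<m} (swap_kernel G) (bip_kernel k X) -
          link {..<m} (swap_kernel H) (bip_kernel k X))"
    by (rule channel_difference_tensor_id[OF difference_\<Delta>]) blast
  obtain A B where dominated: "block_dominated (grid m k) (bip_kernel k X) A B"
    and trace: "Re (kernel_trace (grid m k) A) = trace_norm X"
      "Re (kernel_trace (grid m k) B) = trace_norm X"
    by (rule trace_norm_block_attained[OF carrier_X]) blast
  define image where
    "image R = t *\<^sub>R (link {..<m} (swap_kernel G) R + link {..<m} (swap_kernel H) R)"
    for R :: "(nat \<times> nat) kernel"
  have link: "block_dominated (grid n k) (link {..<m} (swap_kernel c) (bip_kernel k X))
      (link {..<m} (swap_kernel c) A) (link {..<m} (swap_kernel c) B)"
        if "chan_kernel {..<m} {..<n} c" for c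
    using that by (intro block_dominated_link[OF _ _ _ dominated] pos_kernel_swap)
      (auto simp: chan_kernel_def)
  have "block_dominated (grid n k)
      (t *\<^sub>R (link {..<m} (swap_kernel G) (bip_kernel k X) +
        - link {..<m} (swap_kernel H) (bip_kernel k X)))
      (image A) (image B)"
    unfolding image_def
    by (intro block_dominated_scaleR block_dominated_add block_dominated_minus link channels
        t_nonneg)
  then have "block_dominated (grid n k) (bip_kernel k (tensor_id m n k \<Delta> X)) (image A) (image B)"
    unfolding block_dominated_cong[OF tensor] diff_conv_add_uminus .
  from trace_norm_le_block[OF tensor_id_carrier this]
  have "trace_norm (tensor_id m n k \<Delta> X) \<le>
      (Re (kernel_trace (grid n k) (image A)) + Re (kernel_trace (grid n k) (image B))) / 2" .
  moreover have "Re (kernel_trace (grid n k) (image R)) =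
      2 * t * Re (kernel_trace (grid m k) R)" for R
    using channels by (simp add: image_def kernel_trace_scaleR kernel_trace_add
        kernel_trace_link_channel)
  ultimately show ?thesis by (simp add: trace)
qed

lemma trace_norm_tensor_id_le_if_trace_norm_le_1:
  assumes difference_\<Delta>: "channel_difference m n t \<Delta>"
    and carrier_X: "X \<in> carrier_mat (m * k) (m * k)" "trace_norm X \<le> 1"
  shows "trace_norm (tensor_id m n k \<Delta> X) \<le> 2 * t"
proof -
  have "0 \<le> 2 * t" using difference_\<Delta> by (simp add: channel_difference_def)
  with carrier_X(2) have "2 * t * trace_norm X \<le> 2 * t" by (rule mult_left_le)
  with trace_norm_tensor_id_le[OF difference_\<Delta> carrier_X(1)] show ?thesis by (rule order_trans)
qed

lemma trace_norm_zero_mat: "trace_norm (0\<^sub>m (r * n) (r * n)) = 0"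
proof -
  have "bip_kernel n (0\<^sub>m (r * n) (r * n)) \<simeq>\<^bsub>grid r n\<^esub> 0"
    by (rule kernel_eqI) (auto simp: bip_kernel_def grid_index_less)
  then have "psd (r * n) (0\<^sub>m (r * n) (r * n))"
    by (simp add: psd_iff_pos_kernel pos_kernel_cong pos_kernel_zero)
  from trace_norm_psd[OF this] show ?thesis by (simp add: mtrace_def)
qed

lemma dnorm_le:
  assumes "channel_difference m n t \<Delta>"
  shows "dnorm m n \<Delta> \<le> 2 * t"
  unfolding dnorm_def
proof (rule cSup_least)
  show "{trace_norm (tensor_id m n m \<Delta> X) | X.
      X \<in> carrier_mat (m * m) (m * m) \<and> trace_norm X \<le> 1} \<noteq> {}"
    using trace_norm_zero_mat[of m m] by (auto intro!: exI[of _ "0\<^sub>m (m * m) (m * m)"])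
qed (use trace_norm_tensor_id_le_if_trace_norm_le_1[OF assms] in blast)

lemma dnorm_upper:
  assumes "channel_difference m n t \<Delta>" "X \<in> carrier_mat (m * m) (m * m)" "trace_norm X \<le> 1"
  shows "trace_norm (tensor_id m n m \<Delta> X) \<le> dnorm m n \<Delta>"
  unfolding dnorm_def
proof (rule cSup_upper)
  show "bdd_above {trace_norm (tensor_id m n m \<Delta> X) | X.
      X \<in> carrier_mat (m * m) (m * m) \<and> trace_norm X \<le> 1}"
    using trace_norm_tensor_id_le_if_trace_norm_le_1[OF assms(1)]
    by (intro bdd_aboveI[of _ "2 * t"]) blast
qed (use assms(2,3) in blast)

lemma dnorm_nonneg:
  assumes "channel_difference m n t \<Delta>"
  shows "0 \<le> dnorm m n \<Delta>"
proof -
  have "0 \<le> trace_norm (tensor_id m n m \<Delta> (0\<^sub>m (m * m) (m * m)))"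
    by (rule trace_norm_nonneg[OF tensor_id_carrier])
  also have "\<dots> \<le> dnorm m n \<Delta>"
    by (rule dnorm_upper[OF assms]) (simp_all add: trace_norm_zero_mat)
  finally show ?thesis .
qed

subsection \<open>Conjugation by a kernel\<close>

text \<open>The Choi kernel of \<open>Z \<mapsto> S\<^sup>T Z (S\<^sup>T)\<^sup>*\<close>.\<close>

definition conj_kernel :: "'i kernel \<Rightarrow> ('i \<times> 'i) kernel" where
  "conj_kernel S = outer (\<lambda>p. S (fst p) (snd p)) (\<lambda>p. S (fst p) (snd p))"

lemma conj_kernel_cong: "S \<simeq>\<^bsub>I\<^esub> S' \<Longrightarrow> conj_kernel S \<simeq>\<^bsub>I \<times> I\<^esub> conj_kernel S'"
  by (auto simp: kernel_eq_def conj_kernel_def outer_def)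

lemma pos_kernel_conj_kernel: "pos_kernel I (conj_kernel S)"
  by (simp add: conj_kernel_def pos_kernel_outer)

lemma conj_kernel_one: "conj_kernel one_kernel = id_kernel"
  by (simp add: conj_kernel_def id_kernel_def one_kernel_def)

lemma link_conj_kernel: "link I (conj_kernel S) (conj_kernel T) = conj_kernel (kernel_mult I S T)"
  by (simp add: conj_kernel_def link_outer kernel_mult_def)

lemma kernel_trace_conj_kernel:
  assumes "herm_kernel I S"
  shows "kernel_trace (I \<times> I) (conj_kernel S) = kernel_trace I (kernel_mult I S S)"
  by (simp add: kernel_trace_def conj_kernel_def outer_def kernel_mult_def sum.cartesian_product'
      herm_kernelD[OF assms])

lemma link_conj_kernel_tensor_one:
  assumes "herm_kernel I S"
  shows "link I (conj_kernel S) (kernel_tensor \<sigma> one_kernel) \<simeq>\<^bsub>I \<times> Y\<^esub>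
    kernel_tensor (kernel_mult I (kernel_mult I S \<sigma>) S) one_kernel"
proof (rule kernel_eqI)
  fix p q assume "p \<in> I \<times> Y" "q \<in> I \<times> Y"
  then have "link I (conj_kernel S) (kernel_tensor \<sigma> one_kernel) p q =
      (\<Sum>x\<in>I. \<Sum>y\<in>I. S (fst p) x * \<sigma> x y * S y (fst q) * one_kernel (snd p) (snd q))"
    unfolding link_def by (auto simp: conj_kernel_def outer_def kernel_tensor_def
        herm_kernelD[OF assms] intro!: sum.cong)
  then show "link I (conj_kernel S) (kernel_tensor \<sigma> one_kernel) p q =
      kernel_tensor (kernel_mult I (kernel_mult I S \<sigma>) S) one_kernel p q"
    by (subst (asm) sum.swap) (simp add: kernel_tensor_def kernel_mult_def sum_distrib_right)
qed

lemma spectral_lower_bound: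
  assumes "finite I" and orthonormal: "orthonormal_on I J v" and "finite J" "j \<in> J"
    and sum: "A \<simeq>\<^bsub>I\<^esub> (\<Sum>j\<in>J. d j *\<^sub>R outer (v j) (v j))" and lower: "pos_kernel I (A - \<delta> *\<^sub>R one_kernel)"
  shows "\<delta> \<le> d j"
proof -
  have "inner_on I (v j) (v j) = 1" using orthonormal \<open>j \<in> J\<close> by (simp add: orthonormal_on_def)
  moreover have "sesq I A (v j) (v j) = of_real (d j)"
    unfolding sesq_cong[OF sum] by (rule sesq_orthonormal_sum[OF orthonormal \<open>finite J\<close> \<open>j \<in> J\<close>])
  ultimately show ?thesis
    using pos_kernelD[OF lower, of "v j"]
    by (simp add: sesq_diff sesq_scaleR sesq_one[OF \<open>finite I\<close>] less_eq_complex_def)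
qed

lemma positive_definite_kernel_sqrt:
  assumes fin: "finite I" and pos_\<sigma>: "pos_kernel I \<sigma>" and "0 < \<delta>"
    and definite: "pos_kernel I (\<sigma> - \<delta> *\<^sub>R one_kernel)"
  obtains S T where "herm_kernel I S" "herm_kernel I T" "kernel_mult I S S \<simeq>\<^bsub>I\<^esub> \<sigma>"
    "kernel_mult I S T \<simeq>\<^bsub>I\<^esub> one_kernel" "kernel_mult I (kernel_mult I T \<sigma>) T \<simeq>\<^bsub>I\<^esub> one_kernel"
proof -
  obtain J :: "nat set" and v d where finite_J: "finite J" and orthonormal_v: "orthonormal_on I J v"
    and one: "one_kernel \<simeq>\<^bsub>I\<^esub> (\<Sum>j\<in>J. outer (v j) (v j))"
    and \<sigma>_sum: "\<sigma> \<simeq>\<^bsub>I\<^esub> (\<Sum>j\<in>J. d j *\<^sub>R outer (v j) (v j))"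
    by (rule herm_kernel_spectral[OF fin pos_kernel_herm[OF fin pos_\<sigma>]]) blast
  have d_positive: "0 < d j" if "j \<in> J" for j
    using spectral_lower_bound[OF fin orthonormal_v finite_J that \<sigma>_sum definite] \<open>0 < \<delta>\<close> by simp
  then have d_nonzero: "d j \<noteq> 0" if "j \<in> J" for j using that by force
  define f where "f a = (\<Sum>j\<in>J. a j *\<^sub>R outer (v j) (v j))" for a
  have f_mult: "kernel_mult I (f a) (f b) = f (\<lambda>j. a j * b j)" for a b
    unfolding f_def by (rule kernel_mult_orthonormal_sum[OF finite_J orthonormal_v])
  have f_one: "f a \<simeq>\<^bsub>I\<^esub> one_kernel" if "\<And>j. j \<in> J \<Longrightarrow> a j = 1" for a
    using kernel_eq_sym[OF one] that by (simp add: f_def)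
  have f_herm: "herm_kernel I (f a)" for a
    unfolding f_def by (intro herm_kernel_sum herm_kernel_scaleR herm_kernel_outer)
  define S where "S = f (\<lambda>j. sqrt (d j))"
  define T where "T = f (\<lambda>j. 1 / sqrt (d j))"
  have "kernel_mult I S S = f d"
    unfolding S_def f_mult using d_positive by (simp add: f_def less_imp_le)
  then have "kernel_mult I S S \<simeq>\<^bsub>I\<^esub> \<sigma>" using kernel_eq_sym[OF \<sigma>_sum] by (simp add: f_def)
  moreover have "kernel_mult I S T \<simeq>\<^bsub>I\<^esub> one_kernel"
    unfolding S_def T_def f_mult by (intro f_one) (simp add: d_nonzero)
  moreover have "kernel_mult I (kernel_mult I T \<sigma>) T \<simeq>\<^bsub>I\<^esub> one_kernel"
  proof -
    have "kernel_mult I (kernel_mult I T \<sigma>) T \<simeq>\<^bsub>I\<^esub> kernel_mult I (kernel_mult I T (f d)) T"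
      unfolding f_def
      by (rule kernel_mult_cong[OF kernel_mult_cong[OF kernel_eq_refl \<sigma>_sum] kernel_eq_refl])
    also have "\<dots> \<simeq>\<^bsub>I\<^esub> one_kernel"
      unfolding T_def f_mult using d_positive by (intro f_one) (simp add: d_nonzero less_imp_le)
    finally show ?thesis .
  qed
  ultimately show ?thesis using that f_herm unfolding S_def T_def by blast
qed

lemma kernel_pair_link_conj_kernel:
  assumes "finite I" "kernel_mult I S T \<simeq>\<^bsub>I\<^esub> one_kernel"
  shows "kernel_pair (Y \<times> I) (swap_kernel (link I (conj_kernel T) R))
        (link I (swap_kernel J) (conj_kernel S)) =
    kernel_pair (I \<times> Y) R J"
proof -
  have "link I (conj_kernel S) (link I (conj_kernel T) R) =
      link I (conj_kernel (kernel_mult I S T)) R"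
    by (simp add: link_conj_kernel flip: link_assoc)
  moreover have "\<dots> \<simeq>\<^bsub>I \<times> Y\<^esub> link I id_kernel R"
    using link_cong[OF conj_kernel_cong[OF assms(2)] kernel_eq_refl] by (simp add: conj_kernel_one)
  ultimately have "link I (conj_kernel S) (link I (conj_kernel T) R) \<simeq>\<^bsub>I \<times> Y\<^esub> R"
    using link_id_left[OF assms(1)] by (metis kernel_eq_trans)
  from kernel_pair_cong[OF this kernel_eq_refl]
  show ?thesis by (simp add: kernel_pair_link_right kernel_pair_swap flip: swap_kernel_link)
qed

lemma pos_kernel_one_minus_link_conj_kernel:
  assumes fin: "finite I" and inverse_root: "herm_kernel I T"
    "kernel_mult I (kernel_mult I T \<sigma>) T \<simeq>\<^bsub>I\<^esub> one_kernel"
    and dominated: "pos_kernel (I \<times> Y) (kernel_tensor \<sigma> one_kernel - \<rho>)"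
  shows "pos_kernel (I \<times> Y) (one_kernel - link I (conj_kernel T) \<rho>)"
proof -
  have "link I (conj_kernel T) (kernel_tensor \<sigma> one_kernel) \<simeq>\<^bsub>I \<times> Y\<^esub> one_kernel"
    unfolding one_kernel_prod
    by (rule kernel_eq_trans[OF link_conj_kernel_tensor_one[OF inverse_root(1)]
        kernel_tensor_cong[OF inverse_root(2) kernel_eq_refl]])
  moreover have "pos_kernel (I \<times> Y) (link I (conj_kernel T) (kernel_tensor \<sigma> one_kernel - \<rho>))"
    by (rule pos_kernel_link[OF fin fin pos_kernel_conj_kernel dominated])
  ultimately show ?thesis
    unfolding link_diff_right using pos_kernel_cong[OF kernel_eq_diff[OF _ kernel_eq_refl]] by blast
qed

subsection \<open>Duality between the diamond norm and the conditional norm\<close>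

lemma channel_difference_effect_bound:
  assumes difference_\<Delta>: "channel_difference m n t \<Delta>" and psd_X: "psd (m * k) X"
    and effect: "pos_kernel (grid n k) (one_kernel - E)" "pos_kernel (grid n k) E"
  shows "- Re (kernel_pair (grid n k) E (bip_kernel k (tensor_id m n k \<Delta> X))) \<le>
      trace_norm (tensor_id m n k \<Delta> X) / 2"
proof -
  let ?D = "tensor_id m n k \<Delta> X"
  obtain G H where t_nonneg: "0 \<le> t"
    and channels: "chan_kernel {..<m} {..<n} G" "chan_kernel {..<m} {..<n} H"
    and tensor: "\<And>k X. bip_kernel k (tensor_id m n k \<Delta> X) \<simeq>\<^bsub>grid n k\<^esub>
      t *\<^sub>R (link {..<m} (swap_kernel G) (bip_kernel k X) -
          link {..<m} (swap_kernel H) (bip_kernel k X))"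
    by (rule channel_difference_tensor_id[OF difference_\<Delta>]) blast
  have herm: "herm_kernel (grid n k) (link {..<m} (swap_kernel c) (bip_kernel k X))"
    if "chan_kernel {..<m} {..<n} c" for c
    using that psd_X by (intro pos_kernel_herm pos_kernel_link pos_kernel_swap)
      (auto simp: chan_kernel_def psd_iff_pos_kernel)
  have "herm_kernel (grid n k) (bip_kernel k ?D)"
    unfolding herm_kernel_cong[OF tensor]
    by (intro herm_kernel_scaleR herm_kernel_diff herm channels)
  moreover have trace: "kernel_trace (grid n k) (bip_kernel k ?D) = 0"
    using channels by (simp add: kernel_trace_cong[OF tensor] kernel_trace_scaleR kernel_trace_diff
        kernel_trace_link_channel)
  ultimately have "Re (kernel_pair (grid n k) (one_kernel - E) (bip_kernel k ?D)) \<le>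
      trace_norm ?D / 2"
    using effect by (intro kernel_pair_le_trace_norm)
      (simp_all add: mtrace_eq_kernel_trace[of _ n k])
  then show ?thesis
    using trace by (simp add: kernel_pair_commute[of _ "one_kernel - E"] kernel_pair_commute[of _ E]
        kernel_pair_diff_right kernel_pair_one)
qed

lemma trace_norm_conj_kernel:
  assumes "herm_kernel {..<m} S" "kernel_mult {..<m} S S \<simeq>\<^bsub>{..<m}\<^esub> \<sigma>" "density_kernel {..<m} \<sigma>"
  shows "trace_norm (kernel_mat m m (conj_kernel S)) = 1"
proof -
  have "kernel_trace (grid m m) (conj_kernel S) = 1"
    using assms(3) by (simp add: kernel_trace_conj_kernel[OF assms(1)]
        kernel_trace_cong[OF assms(2)] density_kernel_def)
  then show ?thesis
    using trace_norm_psd[OF psd_kernel_mat[OF pos_kernel_conj_kernel]]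
    by (simp add: mtrace_kernel_mat)
qed

text \<open>The square root \<open>S\<close> of \<open>\<sigma>\<close> provides the input \<open>|S\<rangle>\<rangle>\<langle>\<langle>S|\<close> for the diamond norm, and
  conjugation by \<open>S\<inverse>\<close> turns \<open>\<rho> \<le> \<sigma> \<otimes> 1\<close> into an effect.\<close>

lemma kernel_pair_le_dnorm_if_dominated:
  assumes difference_\<Delta>: "channel_difference m n t \<Delta>" and pos: "pos_kernel (grid m n) \<rho>"
    and density: "density_kernel {..<m} \<sigma>"
    and definite: "0 < \<delta>" "pos_kernel {..<m} (\<sigma> - \<delta> *\<^sub>R one_kernel)"
    and dominated: "pos_kernel (grid m n) (kernel_tensor \<sigma> one_kernel - \<rho>)"
  shows "- Re (kernel_pair (grid m n) \<rho> (choi_kernel m \<Delta>)) \<le> dnorm m n \<Delta> / 2"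
proof -
  have "pos_kernel {..<m} \<sigma>" using density by (simp add: density_kernel_def)
  from this definite obtain S T where herm_S: "herm_kernel {..<m} S"
    and herm_T: "herm_kernel {..<m} T"
    and root: "kernel_mult {..<m} S S \<simeq>\<^bsub>{..<m}\<^esub> \<sigma>"
    and inverse: "kernel_mult {..<m} S T \<simeq>\<^bsub>{..<m}\<^esub> one_kernel"
    and inverse_root: "kernel_mult {..<m} (kernel_mult {..<m} T \<sigma>) T \<simeq>\<^bsub>{..<m}\<^esub> one_kernel"
    by (rule positive_definite_kernel_sqrt[OF finite_lessThan]) blast
  define X where "X = kernel_mat m m (conj_kernel S)"
  have bip_X: "bip_kernel m X \<simeq>\<^bsub>grid m m\<^esub> conj_kernel S"
    unfolding X_def by (rule bip_kernel_kernel_mat)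
  have psd_X: "psd (m * m) X" unfolding X_def by (intro psd_kernel_mat pos_kernel_conj_kernel)
  have "trace_norm X = 1" unfolding X_def by (rule trace_norm_conj_kernel[OF herm_S root density])
  define D where "D = tensor_id m n m \<Delta> X"
  define E where "E = swap_kernel (link {..<m} (conj_kernel T) \<rho>)"
  have "bip_kernel m D \<simeq>\<^bsub>grid n m\<^esub> link {..<m} (swap_kernel (choi_kernel m \<Delta>)) (conj_kernel S)"
    using difference_\<Delta> unfolding D_def channel_difference_def
    by (intro kernel_eq_trans[OF bip_kernel_tensor_id link_cong[OF kernel_eq_refl bip_X]]) simp
  from kernel_pair_cong[OF kernel_eq_refl this]
  have "kernel_pair (grid m n) \<rho> (choi_kernel m \<Delta>) = kernel_pair (grid n m) E (bip_kernel m D)"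
    by (simp add: E_def kernel_pair_link_conj_kernel[OF _ inverse])
  moreover have "pos_kernel (grid n m) (swap_kernel (one_kernel - link {..<m} (conj_kernel T) \<rho>))"
    by (intro pos_kernel_swap
        pos_kernel_one_minus_link_conj_kernel[OF _ herm_T inverse_root dominated]) simp
  then have "pos_kernel (grid n m) (one_kernel - E)" by (simp add: E_def swap_kernel_diff)
  moreover have "pos_kernel (grid n m) E"
    unfolding E_def using pos by (intro pos_kernel_swap pos_kernel_link pos_kernel_conj_kernel) auto
  ultimately have "- Re (kernel_pair (grid m n) \<rho> (choi_kernel m \<Delta>)) \<le> trace_norm D / 2"
    unfolding D_def by (simp only:) (rule channel_difference_effect_bound[OF difference_\<Delta> psd_X])
  also have "\<dots> \<le> dnorm m n \<Delta> / 2"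
    unfolding D_def using \<open>trace_norm X = 1\<close> psd_carrier[OF psd_X]
    by (simp add: dnorm_upper[OF difference_\<Delta>])
  finally show ?thesis .
qed

lemma kernel_pair_le_cond_norm_dnorm:
  assumes "0 < m" "0 < n" and difference_\<Delta>: "channel_difference m n t \<Delta>"
    and pos: "pos_kernel (grid m n) \<rho>"
  shows "- Re (kernel_pair (grid m n) \<rho> (choi_kernel m \<Delta>)) \<le>
      dnorm m n \<Delta> / 2 * cond_norm {..<m} {..<n} \<rho>"
proof -
  have nonempty: "{..<m} \<noteq> {}" "{..<n} \<noteq> {}" using assms(1,2) by (auto simp: lessThan_empty_iff)
  have "0 \<le> dnorm m n \<Delta> / 2 * cond_norm {..<m} {..<n} \<rho> +
      Re (kernel_pair (grid m n) \<rho> (choi_kernel m \<Delta>)) +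
      e * (dnorm m n \<Delta> / 2)" if "0 < e" for e :: real
  proof -
    define l where "l = cond_norm {..<m} {..<n} \<rho> + e"
    have "cond_norm {..<m} {..<n} \<rho> < l" using \<open>0 < e\<close> by (simp add: l_def)
    moreover have "0 \<le> cond_norm {..<m} {..<n} \<rho>"
      by (rule cond_norm_nonneg[OF finite_lessThan finite_lessThan nonempty(2) pos])
    ultimately have "0 < l" by simp
    obtain \<sigma> \<delta> where density: "density_kernel {..<m} \<sigma>" "0 < \<delta>"
      "pos_kernel {..<m} (\<sigma> - \<delta> *\<^sub>R one_kernel)"
      and dominated: "pos_kernel (grid m n) (l *\<^sub>R kernel_tensor \<sigma> one_kernel - \<rho>)"
      by (rule cond_norm_dual[OF finite_lessThan nonempty(1) finite_lessThan nonempty(2) pos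
          \<open>cond_norm {..<m} {..<n} \<rho> < l\<close>])
    have "(1 / l) *\<^sub>R (l *\<^sub>R kernel_tensor \<sigma> one_kernel - \<rho>) =
        kernel_tensor \<sigma> one_kernel - (1 / l) *\<^sub>R \<rho>"
      using \<open>0 < l\<close> by (simp add: scaleR_diff_right)
    then have "pos_kernel (grid m n) (kernel_tensor \<sigma> one_kernel - (1 / l) *\<^sub>R \<rho>)"
      using pos_kernel_scaleR[OF dominated, of "1 / l"] \<open>0 < l\<close> by simp
    moreover have "pos_kernel (grid m n) ((1 / l) *\<^sub>R \<rho>)"
      using pos \<open>0 < l\<close> by (simp add: pos_kernel_scaleR)
    ultimately have "- Re (kernel_pair (grid m n) ((1 / l) *\<^sub>R \<rho>) (choi_kernel m \<Delta>)) \<le>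
        dnorm m n \<Delta> / 2"
      using kernel_pair_le_dnorm_if_dominated[OF difference_\<Delta> _ density] by blast
    then show ?thesis using \<open>0 < l\<close> by (simp add: kernel_pair_scaleR_left l_def field_simps)
  qed
  from nonneg_if_nonneg_perturbation[OF this] show ?thesis by simp
qed

section \<open>Preprocessing of channels\<close>

locale channel_pair =
  fixes d0 d0' d1 :: nat and \<Phi>1 \<Phi>2 :: cmap
  assumes dims: "0 < d0" "0 < d0'" "0 < d1"
    and \<Phi>1: "channel d0 d1 \<Phi>1" and \<Phi>2: "channel d0' d1 \<Phi>2"
begin

abbreviation "J1 \<equiv> choi_kernel d0 \<Phi>1"
abbreviation "J2 \<equiv> choi_kernel d0' \<Phi>2"
abbreviation "deviation \<Lambda> \<equiv> \<lambda>X. \<Phi>1 (\<Lambda> X) - \<Phi>2 X"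

lemma chan_kernel_J1: "chan_kernel {..<d0} {..<d1} J1"
  using chan_kernel_choi_kernel dims(1) \<Phi>1 .

lemma chan_kernel_J2: "chan_kernel {..<d0'} {..<d1} J2"
  using chan_kernel_choi_kernel dims(2) \<Phi>2 .

lemma chan_kernel_link_J1:
  assumes "finite X" "chan_kernel X {..<d0} L"
  shows "chan_kernel X {..<d1} (link {..<d0} L J1)"
  by (rule chan_kernel_link[OF assms(1) finite_lessThan assms(2) chan_kernel_J1])

lemma lessThan_dims_nonempty: "{..<d0} \<noteq> {}" "{..<d0'} \<noteq> {}" "{..<d1} \<noteq> {}"
  using dims by (auto simp: lessThan_empty_iff)

lemma
  assumes "channel d0' d0 \<Lambda>"
  shows lin_map_deviation: "lin_map d0' d1 (deviation \<Lambda>)"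
    and choi_kernel_deviation:
      "choi_kernel d0' (deviation \<Lambda>) \<simeq>\<^bsub>grid d0' d1\<^esub> link {..<d0} (choi_kernel d0' \<Lambda>) J1 - J2"
proof -
  have lin: "lin_map d0' d0 \<Lambda>" "lin_map d0 d1 \<Phi>1" "lin_map d0' d1 \<Phi>2"
    using assms \<Phi>1 \<Phi>2 by (simp_all add: channel_def)
  show "lin_map d0' d1 (deviation \<Lambda>)"
    by (rule lin_map_diff[OF lin_map_compose[OF lin(1,2)] lin(3)])
  show "choi_kernel d0' (deviation \<Lambda>) \<simeq>\<^bsub>grid d0' d1\<^esub> link {..<d0} (choi_kernel d0' \<Lambda>) J1 - J2"
    by (rule kernel_eq_trans[OF choi_kernel_diff[OF lin(3)]
        kernel_eq_diff[OF choi_kernel_compose[OF lin(1,2)] kernel_eq_refl]])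
qed

lemma channel_difference_deviation:
  assumes "channel d0' d0 \<Lambda>"
  shows "channel_difference d0' d1 1 (deviation \<Lambda>)"
proof -
  have "choi_kernel d0' (deviation \<Lambda>) \<simeq>\<^bsub>grid d0' d1\<^esub> 1 *\<^sub>R (link {..<d0} (choi_kernel d0' \<Lambda>) J1 - J2)"
    unfolding scaleR_one by (rule choi_kernel_deviation[OF assms])
  then show ?thesis
    by (rule channel_differenceI[OF lin_map_deviation[OF assms] zero_le_one
          chan_kernel_link_J1[OF finite_lessThan chan_kernel_choi_kernel[OF dims(2) assms]]
            chan_kernel_J2])
qed

lemma delta_pre_lower:
  assumes "channel d0' d0 \<Lambda>"
  shows "delta_pre d0 d0' d1 \<Phi>1 \<Phi>2 \<le> dnorm d0' d1 (deviation \<Lambda>)"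
  unfolding delta_pre_def
proof (rule cInf_lower)
  show "bdd_below {dnorm d0' d1 (deviation \<Lambda>) | \<Lambda>. channel d0' d0 \<Lambda>}"
    using dnorm_nonneg[OF channel_difference_deviation] by (intro bdd_belowI[of _ 0]) blast
qed (use assms in blast)

lemma delta_pre_greatest:
  assumes "\<And>\<Lambda>. channel d0' d0 \<Lambda> \<Longrightarrow> b \<le> dnorm d0' d1 (deviation \<Lambda>)"
  shows "b \<le> delta_pre d0 d0' d1 \<Phi>1 \<Phi>2"
proof -
  obtain \<Lambda> where "channel d0' d0 \<Lambda>" by (rule channel_exists[OF dims(2,1)])
  then show ?thesis unfolding delta_pre_def using assms by (intro cInf_greatest) blast+
qed

lemma delta_pre_greatest_scaled:
  assumes "0 \<le> s" "\<And>\<Lambda>. channel d0' d0 \<Lambda> \<Longrightarrow> b \<le> s * dnorm d0' d1 (deviation \<Lambda>)"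
  shows "b \<le> s * delta_pre d0 d0' d1 \<Phi>1 \<Phi>2"
proof (cases "s = 0")
  case True
  obtain \<Lambda> where "channel d0' d0 \<Lambda>" by (rule channel_exists[OF dims(2,1)])
  from assms(2)[OF this] True show ?thesis by simp
next
  case False
  then have "b / s \<le> delta_pre d0 d0' d1 \<Phi>1 \<Phi>2"
    using assms by (intro delta_pre_greatest) (simp add: field_simps)
  then show ?thesis using False assms(1) by (simp add: field_simps)
qed

text \<open>Condition (ii) for kernels, without the normalisation of \<open>\<rho>\<close>.\<close>

definition norm_bound :: "real \<Rightarrow> 'r set \<Rightarrow> ('r \<times> nat) kernel \<Rightarrow> bool" where
  "norm_bound \<epsilon> R \<rho> \<longleftrightarrow> cond_norm R {..<d0'} (link {..<d1} \<rho> (swap_kernel J2))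
     \<le> cond_norm R {..<d0} (link {..<d1} \<rho> (swap_kernel J1)) + \<epsilon> / 2 * cond_norm R {..<d1} \<rho>"

lemma norm_bound_cong:
  assumes "\<rho> \<simeq>\<^bsub>R \<times> {..<d1}\<^esub> \<rho>'"
  shows "norm_bound \<epsilon> R \<rho> \<longleftrightarrow> norm_bound \<epsilon> R \<rho>'"
  unfolding norm_bound_def cond_norm_cong[OF assms]
    cond_norm_cong[OF link_cong[OF assms kernel_eq_refl]] ..

lemma kernel_pair_deviation:
  assumes "channel d0' d0 \<Lambda>"
  shows "kernel_pair (R \<times> {..<d0'}) (link {..<d1} \<rho> (swap_kernel J2)) c =
    kernel_pair (R \<times> {..<d0}) (link {..<d1} \<rho> (swap_kernel J1))
          (link {..<d0'} c (choi_kernel d0' \<Lambda>)) -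
    kernel_pair (grid d0' d1) (link R (swap_kernel c) \<rho>) (choi_kernel d0' (deviation \<Lambda>))"
proof -
  let ?L = "choi_kernel d0' \<Lambda>" and ?\<tau> = "link R (swap_kernel c) \<rho>"
  have "kernel_pair (R \<times> {..<d0'}) (link {..<d1} \<rho> (swap_kernel J2)) c =
      kernel_pair (grid d0' d1) ?\<tau> J2"
    by (simp flip: kernel_pair_link_left kernel_pair_link_right)
  also have "\<dots> = kernel_pair (grid d0' d1) ?\<tau> (link {..<d0} ?L J1) -
      kernel_pair (grid d0' d1) ?\<tau> (choi_kernel d0' (deviation \<Lambda>))"
    unfolding kernel_pair_cong[OF kernel_eq_refl choi_kernel_deviation[OF assms]]
    by (simp add: kernel_pair_diff_right)
  also have "kernel_pair (grid d0' d1) ?\<tau> (link {..<d0} ?L J1) =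
      kernel_pair (R \<times> {..<d0}) (link {..<d1} \<rho> (swap_kernel J1)) (link {..<d0'} c ?L)"
    by (simp add: link_assoc flip: kernel_pair_link_left kernel_pair_link_right)
  finally show ?thesis .
qed

lemma kernel_pair_le_cond_norm_deviation:
  assumes fin: "finite R" and pos_\<rho>: "pos_kernel (R \<times> {..<d1}) \<rho>"
    and chan_c: "chan_kernel R {..<d0'} c" and channel_\<Lambda>: "channel d0' d0 \<Lambda>"
  shows "Re (kernel_pair (R \<times> {..<d0'}) (link {..<d1} \<rho> (swap_kernel J2)) c) \<le>
    cond_norm R {..<d0} (link {..<d1} \<rho> (swap_kernel J1)) +
    cond_norm R {..<d1} \<rho> / 2 * dnorm d0' d1 (deviation \<Lambda>)"
proof -
  let ?L = "choi_kernel d0' \<Lambda>" and ?D = "choi_kernel d0' (deviation \<Lambda>)"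
  define \<tau> where "\<tau> = link R (swap_kernel c) \<rho>"
  note difference = channel_difference_deviation[OF channel_\<Lambda>]
  have "chan_kernel R {..<d0} (link {..<d0'} c ?L)"
    by (rule chan_kernel_link[OF fin finite_lessThan chan_c
        chan_kernel_choi_kernel[OF dims(2) channel_\<Lambda>]])
  then have "Re (kernel_pair (R \<times> {..<d0}) (link {..<d1} \<rho> (swap_kernel J1)) (link {..<d0'} c ?L)) \<le>
      cond_norm R {..<d0} (link {..<d1} \<rho> (swap_kernel J1))"
    using fin pos_\<rho> dims(1) \<Phi>1 by (intro cond_norm_upper pos_kernel_link_swap_choi_kernel) simp_all
  moreover have "- Re (kernel_pair (grid d0' d1) \<tau> ?D) \<le>
      dnorm d0' d1 (deviation \<Lambda>) / 2 * cond_norm R {..<d1} \<rho>"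
  proof -
    have "pos_kernel (grid d0' d1) \<tau>"
      unfolding \<tau>_def using fin chan_c pos_\<rho>
      by (intro pos_kernel_link pos_kernel_swap) (auto simp: chan_kernel_def)
    then have "- Re (kernel_pair (grid d0' d1) \<tau> ?D) \<le>
        dnorm d0' d1 (deviation \<Lambda>) / 2 * cond_norm {..<d0'} {..<d1} \<tau>"
      by (rule kernel_pair_le_cond_norm_dnorm[OF dims(2,3) difference])
    also have "\<dots> \<le> dnorm d0' d1 (deviation \<Lambda>) / 2 * cond_norm R {..<d1} \<rho>"
      unfolding \<tau>_def using dnorm_nonneg[OF difference] fin
      by (intro mult_left_mono cond_norm_link_le[OF _ _ _ lessThan_dims_nonempty(3) chan_c pos_\<rho>])
        simp_all
    finally show ?thesis .
  qed
  ultimately show ?thesis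
    unfolding kernel_pair_deviation[OF channel_\<Lambda>] \<tau>_def by (simp add: mult.commute)
qed

theorem norm_bound_if_delta_pre_le:
  assumes "delta_pre d0 d0' d1 \<Phi>1 \<Phi>2 \<le> \<epsilon>" and fin: "finite R"
    and pos_\<rho>: "pos_kernel (R \<times> {..<d1}) \<rho>"
  shows "norm_bound \<epsilon> R \<rho>"
proof -
  let ?s = "cond_norm R {..<d1} \<rho> / 2"
  have s_nonneg: "0 \<le> ?s"
    using cond_norm_nonneg[OF fin finite_lessThan lessThan_dims_nonempty(3) pos_\<rho>] by simp
  have "Re (kernel_pair (R \<times> {..<d0'}) (link {..<d1} \<rho> (swap_kernel J2)) c) \<le>
      cond_norm R {..<d0} (link {..<d1} \<rho> (swap_kernel J1)) + \<epsilon> / 2 * cond_norm R {..<d1} \<rho>"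
    if chan_c: "chan_kernel R {..<d0'} c" for c
  proof -
    have "Re (kernel_pair (R \<times> {..<d0'}) (link {..<d1} \<rho> (swap_kernel J2)) c) -
        cond_norm R {..<d0} (link {..<d1} \<rho> (swap_kernel J1)) \<le> ?s * delta_pre d0 d0' d1 \<Phi>1 \<Phi>2"
    proof (rule delta_pre_greatest_scaled[OF s_nonneg])
      fix \<Lambda> assume "channel d0' d0 \<Lambda>"
      from kernel_pair_le_cond_norm_deviation[OF fin pos_\<rho> chan_c this]
      show "Re (kernel_pair (R \<times> {..<d0'}) (link {..<d1} \<rho> (swap_kernel J2)) c) -
          cond_norm R {..<d0} (link {..<d1} \<rho> (swap_kernel J1)) \<le> ?s * dnorm d0' d1 (deviation \<Lambda>)"
            by simp
    qed
    also have "\<dots> \<le> ?s * \<epsilon>" by (rule mult_left_mono[OF assms(1) s_nonneg])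
    finally show ?thesis by (simp add: algebra_simps)
  qed
  then show ?thesis
    unfolding norm_bound_def
    by (intro cond_norm_least[OF fin finite_lessThan lessThan_dims_nonempty(2)])
qed

lemma channel_difference_if_pos_kernel:
  assumes channel_\<Lambda>: "channel d0' d0 \<Lambda>" and "0 \<le> s" "0 < \<eta>"
    and chan_\<gamma>: "chan_kernel {..<d0'} {..<d1} \<gamma>"
    and pos: "pos_kernel (grid d0' d1) (choi_kernel d0' (deviation \<Lambda>) + s *\<^sub>R \<gamma> + \<eta> *\<^sub>R one_kernel)"
  shows "channel_difference d0' d1 (s + \<eta> * d1) (deviation \<Lambda>)"
proof -
  let ?D = "choi_kernel d0' (deviation \<Lambda>)"
  define t where "t = s + \<eta> * d1"
  have t_positive: "0 < t" using assms(2,3) dims(3) by (simp add: t_def add_nonneg_pos)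
  define H where "H = (1 / t) *\<^sub>R (s *\<^sub>R \<gamma> + \<eta> *\<^sub>R one_kernel)"
  have "(1 / t) *\<^sub>R (s *\<^sub>R ptrace {..<d1} \<gamma> + (\<eta> * d1) *\<^sub>R one_kernel) \<simeq>\<^bsub>{..<d0'}\<^esub>
      (1 / t) *\<^sub>R (s *\<^sub>R one_kernel + (\<eta> * d1) *\<^sub>R one_kernel)"
    using chan_\<gamma> by (intro kernel_eq_scaleR kernel_eq_add kernel_eq_refl)
      (simp add: chan_kernel_def)
  moreover have "(1 / t) *\<^sub>R (s *\<^sub>R one_kernel + (\<eta> * d1) *\<^sub>R one_kernel) = (one_kernel :: nat kernel)"
    using t_positive unfolding scaleR_add_left[symmetric] t_def[symmetric] by simp
  ultimately have "ptrace {..<d1} H \<simeq>\<^bsub>{..<d0'}\<^esub> one_kernel"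
    by (simp only: H_def ptrace_add ptrace_scaleR ptrace_one card_lessThan scaleR_scaleR)
  moreover have "pos_kernel (grid d0' d1) H"
    unfolding H_def using chan_\<gamma> t_positive assms(2,3)
    by (intro pos_kernel_scaleR pos_kernel_add pos_kernel_one) (simp_all add: chan_kernel_def)
  ultimately have chan_H: "chan_kernel {..<d0'} {..<d1} H" by (simp add: chan_kernel_def)
  define G where "G = (1 / t) *\<^sub>R ?D + H"
  have "ptrace {..<d1} (link {..<d0} (choi_kernel d0' \<Lambda>) J1) \<simeq>\<^bsub>{..<d0'}\<^esub> one_kernel"
    using chan_kernel_link_J1[OF finite_lessThan chan_kernel_choi_kernel[OF dims(2) channel_\<Lambda>]]
    by (simp add: chan_kernel_def)
  then have "ptrace {..<d1} ?D \<simeq>\<^bsub>{..<d0'}\<^esub> 0"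
    using ptrace_cong[OF choi_kernel_deviation[OF channel_\<Lambda>]] chan_kernel_J2
    by (simp add: ptrace_diff chan_kernel_def kernel_eq_def)
  then have "ptrace {..<d1} G \<simeq>\<^bsub>{..<d0'}\<^esub> one_kernel"
    using chan_H by (simp add: G_def ptrace_add ptrace_scaleR chan_kernel_def kernel_eq_def)
  moreover have "G = (1 / t) *\<^sub>R (?D + s *\<^sub>R \<gamma> + \<eta> *\<^sub>R one_kernel)"
    by (simp add: G_def H_def scaleR_add_right add.assoc)
  ultimately have "chan_kernel {..<d0'} {..<d1} G"
    using pos t_positive by (simp add: chan_kernel_def pos_kernel_scaleR)
  moreover have "t *\<^sub>R (G - H) = ?D" using t_positive by (simp add: G_def)
  ultimately show ?thesis
    unfolding t_def[symmetric] using lin_map_deviation[OF channel_\<Lambda>] t_positive chan_H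
    by (intro channel_differenceI[of _ _ _ _ G H]) simp_all
qed

definition slack_kernels :: "real \<Rightarrow> (nat \<times> nat) kernel set" where
  "slack_kernels \<epsilon> = {link {..<d0} L J1 + (\<epsilon> / 2) *\<^sub>R \<gamma> - J2 | L \<gamma>.
     chan_kernel {..<d0'} {..<d0} L \<and> chan_kernel {..<d0'} {..<d1} \<gamma>}"

lemma slack_kernels_nonempty: "slack_kernels \<epsilon> \<noteq> {}"
  unfolding slack_kernels_def
  using chan_kernel_depolarizing[OF finite_lessThan finite_lessThan] lessThan_dims_nonempty by blast

lemma slack_kernels_herm: "A \<in> slack_kernels \<epsilon> \<Longrightarrow> herm_kernel (grid d0' d1) A"
  unfolding slack_kernels_def
  by (auto simp: chan_kernel_link_J1 chan_kernel_J2 intro!: herm_kernel_diff herm_kernel_add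
      herm_kernel_scaleR chan_kernel_herm)

lemma slack_kernels_convex: "convex (slack_kernels \<epsilon>)"
proof -
  define T where "T z = link {..<d0} (fst z) J1 +
      (\<epsilon> / 2) *\<^sub>R snd z" for z :: "(nat \<times> nat) kernel \<times> (nat \<times> nat) kernel"
  have "slack_kernels \<epsilon> = (\<lambda>A. A - J2) ` T `
      ({L. chan_kernel {..<d0'} {..<d0} L} \<times> {\<gamma>. chan_kernel {..<d0'} {..<d1} \<gamma>})"
    unfolding slack_kernels_def T_def by force
  moreover have "linear T"
    by (rule linearI) (simp_all add: T_def link_add_left link_scaleR_left algebra_simps)
  ultimately show ?thesis
    using chan_kernel_convex
    by (simp only:) (intro convex_translation_subtract convex_linear_image convex_Times)
qed

lemma delta_pre_le_if_pos_slack_kernel: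
  assumes "0 \<le> \<epsilon>" "0 < \<eta>" "A \<in> slack_kernels \<epsilon>"
    and pos: "pos_kernel (grid d0' d1) (A + \<eta> *\<^sub>R one_kernel)"
  shows "delta_pre d0 d0' d1 \<Phi>1 \<Phi>2 \<le> \<epsilon> + \<eta> * (2 * d1)"
proof -
  obtain L \<gamma> where chan_L: "chan_kernel {..<d0'} {..<d0} L"
    and chan_\<gamma>: "chan_kernel {..<d0'} {..<d1} \<gamma>"
    and A_eq: "A = link {..<d0} L J1 + (\<epsilon> / 2) *\<^sub>R \<gamma> - J2"
      using assms(3) by (auto simp: slack_kernels_def)
  define \<Lambda> where "\<Lambda> = map_of_kernel d0' d0 L"
  have channel_\<Lambda>: "channel d0' d0 \<Lambda>"
    unfolding \<Lambda>_def by (rule channel_map_of_kernel[OF dims(2) chan_L])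
  have "link {..<d0} (choi_kernel d0' \<Lambda>) J1 \<simeq>\<^bsub>grid d0' d1\<^esub> link {..<d0} L J1"
    unfolding \<Lambda>_def by (rule link_cong[OF choi_kernel_map_of_kernel kernel_eq_refl])
  then have "choi_kernel d0' (deviation \<Lambda>) + (\<epsilon> / 2) *\<^sub>R \<gamma> + \<eta> *\<^sub>R one_kernel \<simeq>\<^bsub>grid d0' d1\<^esub>
      A + \<eta> *\<^sub>R one_kernel"
    using choi_kernel_deviation[OF channel_\<Lambda>] by (simp add: A_eq kernel_eq_def)
  with pos have "pos_kernel (grid d0' d1) (choi_kernel d0' (deviation \<Lambda>) + (\<epsilon> / 2) *\<^sub>R \<gamma> +
      \<eta> *\<^sub>R one_kernel)"
    by (simp only: pos_kernel_cong)
  from channel_difference_if_pos_kernel[OF channel_\<Lambda> _ assms(2) chan_\<gamma> this] assms(1)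
  have "dnorm d0' d1 (deviation \<Lambda>) \<le> 2 * (\<epsilon> / 2 + \<eta> * d1)" by (intro dnorm_le) simp
  then show ?thesis using delta_pre_lower[OF channel_\<Lambda>] by simp
qed

lemma cond_norm_le_if_separated_from_slack_kernels:
  assumes "0 \<le> \<epsilon>" and separated: "\<And>A. A \<in> slack_kernels \<epsilon> \<Longrightarrow> Re (kernel_pair (grid d0' d1) C A) \<le> b"
  shows "cond_norm {..<d0'} {..<d0} (link {..<d1} C (swap_kernel J1)) +
      \<epsilon> / 2 * cond_norm {..<d0'} {..<d1} C \<le>
    Re (kernel_pair (grid d0' d1) C J2) + b"
proof -
  have "Re (kernel_pair (grid d0' d0) (link {..<d1} C (swap_kernel J1)) L) +
      \<epsilon> / 2 * Re (kernel_pair (grid d0' d1) C \<gamma>) \<le> Re (kernel_pair (grid d0' d1) C J2) + b"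
    if "chan_kernel {..<d0'} {..<d0} L" "chan_kernel {..<d0'} {..<d1} \<gamma>" for L \<gamma>
  proof -
    have "link {..<d0} L J1 + (\<epsilon> / 2) *\<^sub>R \<gamma> - J2 \<in> slack_kernels \<epsilon>"
      unfolding slack_kernels_def using that by blast
    from separated[OF this] show ?thesis
      by (simp add: kernel_pair_diff_right kernel_pair_add_right kernel_pair_scaleR_right
          kernel_pair_link_right)
  qed
  then have "\<epsilon> / 2 * cond_norm {..<d0'} {..<d1} C \<le> Re (kernel_pair (grid d0' d1) C J2) + b -
      Re (kernel_pair (grid d0' d0) (link {..<d1} C (swap_kernel J1)) L)"
        if "chan_kernel {..<d0'} {..<d0} L" for L
    using that assms(1) by (intro cond_norm_least_scaled lessThan_dims_nonempty)
      (auto simp: algebra_simps)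
  then have "cond_norm {..<d0'} {..<d0} (link {..<d1} C (swap_kernel J1)) \<le>
      Re (kernel_pair (grid d0' d1) C J2) + b - \<epsilon> / 2 * cond_norm {..<d0'} {..<d1} C"
    by (intro cond_norm_least lessThan_dims_nonempty) (auto simp: algebra_simps)
  then show ?thesis by simp
qed

theorem delta_pre_le_if_norm_bound:
  assumes "0 \<le> \<epsilon>"
    and bound: "\<And>C. density_kernel (grid d0' d1) C \<Longrightarrow> Re (kernel_pair (grid d0' d1) C J2) \<le>
      cond_norm {..<d0'} {..<d0} (link {..<d1} C (swap_kernel J1)) +
          \<epsilon> / 2 * cond_norm {..<d0'} {..<d1} C"
  shows "delta_pre d0 d0' d1 \<Phi>1 \<Phi>2 \<le> \<epsilon>"
proof -
  have "0 \<le> \<epsilon> - delta_pre d0 d0' d1 \<Phi>1 \<Phi>2 + \<eta> * (2 * d1)" if \<eta>_positive: "0 < \<eta>" for \<eta> :: real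
  proof (rule pos_kernel_alternative[OF _ slack_kernels_nonempty slack_kernels_herm
      slack_kernels_convex \<eta>_positive])
    fix A assume "A \<in> slack_kernels \<epsilon>" "pos_kernel (grid d0' d1) (A + \<eta> *\<^sub>R one_kernel)"
    from delta_pre_le_if_pos_slack_kernel[OF assms(1) \<eta>_positive this]
    show "0 \<le> \<epsilon> - delta_pre d0 d0' d1 \<Phi>1 \<Phi>2 + \<eta> * (2 * d1)" by simp
  next
    fix C m assume density_C: "density_kernel (grid d0' d1) C" and m_positive: "0 < m"
      and separated: "\<And>A. A \<in> slack_kernels \<epsilon> \<Longrightarrow> Re (kernel_pair (grid d0' d1) C A) \<le> - m"
    from cond_norm_le_if_separated_from_slack_kernels[OF assms(1) separated] bound[OF density_C]
      m_positive
    show "0 \<le> \<epsilon> - delta_pre d0 d0' d1 \<Phi>1 \<Phi>2 + \<eta> * (2 * d1)" by simp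
  qed simp
  from nonneg_if_nonneg_perturbation[OF this] show ?thesis by simp
qed

end

section \<open>Guessing probabilities\<close>

lemma ball_grid: "(\<forall>a<r * n. P a) \<longleftrightarrow> (\<forall>p\<in>grid r n. P (fst p * n + snd p))"
proof
  assume on_grid: "\<forall>p\<in>grid r n. P (fst p * n + snd p)"
  show "\<forall>a<r * n. P a"
  proof (intro allI impI)
    fix a assume "a < r * n"
    then show "P a" using bspec[OF on_grid, of "(a div n, a mod n)"] by (simp add: div_mod_less)
  qed
qed (auto simp: grid_index_less)

lemma bip_kernel_one: "bip_kernel n (1\<^sub>m (r * n)) \<simeq>\<^bsub>grid r n\<^esub> one_kernel"
proof (rule kernel_eqI)
  fix p q assume indices: "p \<in> grid r n" "q \<in> grid r n"
  have "fst p * n + snd p = fst q * n + snd q \<longleftrightarrow> p = q"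
  proof
    assume index_eq: "fst p * n + snd p = fst q * n + snd q"
    have "(fst p * n + snd p) div n = (fst q * n + snd q) div n"
      "(fst p * n + snd p) mod n = (fst q * n + snd q) mod n"
      by (simp_all only: index_eq)
    then show "p = q" using indices by (auto simp: prod_eq_iff)
  qed simp
  then show "bip_kernel n (1\<^sub>m (r * n)) p q = one_kernel p q"
    using indices by (simp add: bip_kernel_def one_kernel_def mem_Times_iff grid_index_less)
qed

lemma measurement_iff:
  "measurement (r * n) k M \<longleftrightarrow> (\<forall>i<k. psd (r * n) (M i)) \<and> (\<Sum>i<k. bip_kernel n (M i)) \<simeq>\<^bsub>grid r n\<^esub>
      one_kernel"
proof -
  have "(\<Sum>i<k. bip_kernel n (M i)) \<simeq>\<^bsub>grid r n\<^esub> one_kernel \<longleftrightarrow>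
      (\<Sum>i<k. bip_kernel n (M i)) \<simeq>\<^bsub>grid r n\<^esub> bip_kernel n (1\<^sub>m (r * n))"
    by (rule kernel_eq_cong[OF kernel_eq_refl kernel_eq_sym[OF bip_kernel_one]])
  then show ?thesis
    by (simp only: measurement_def ball_grid kernel_eq_def bip_kernel_def sum_fun_apply)
qed

lemma measurement_carrier: "measurement d k M \<Longrightarrow> i < k \<Longrightarrow> M i \<in> carrier_mat d d"
  by (simp add: measurement_def psd_carrier)

lemma ensemble_carrier: "ensemble d k lam rho \<Longrightarrow> i < k \<Longrightarrow> rho i \<in> carrier_mat d d"
  by (simp add: ensemble_def state_def psd_carrier)

lemma psucc_eq_kernel_pair:
  assumes "\<And>i. i < k \<Longrightarrow> rho i \<in> carrier_mat (r * n) (r * n)"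
    "\<And>i. i < k \<Longrightarrow> M i \<in> carrier_mat (r * n) (r * n)"
  shows "psucc k lam rho M =
    (\<Sum>i<k. lam i * Re (kernel_pair (grid r n) (bip_kernel n (rho i))
          (kernel_transpose (bip_kernel n (M i)))))"
  unfolding psucc_def using assms by (intro sum.cong refl) (simp add: mtrace_mult[of _ r n])

lemma psucc_le_dim:
  assumes ensemble: "ensemble (r * n) k lam rho" and measurement_M: "measurement (r * n) k M"
  shows "psucc k lam rho M \<le> r * n"
proof -
  have weight: "0 \<le> lam i" "lam i \<le> 1" if "i < k" for i
    using ensemble that member_le_sum[of i "{..<k}" lam] by (auto simp: ensemble_def)
  have pos: "pos_kernel (grid r n) (bip_kernel n (M i))" if "i < k" for i
    using measurement_M that by (simp add: measurement_iff psd_iff_pos_kernel)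
  have "psucc k lam rho M \<le> (\<Sum>i<k. Re (kernel_trace (grid r n) (bip_kernel n (M i))))"
    unfolding psucc_def
  proof (rule sum_mono)
    fix i assume "i \<in> {..<k}"
    then have index: "i < k" by simp
    have "Re (mtrace (rho i * M i)) =
        Re (kernel_pair (grid r n) (bip_kernel n (rho i)) (kernel_transpose (bip_kernel n (M i))))"
      using ensemble_carrier[OF ensemble index] measurement_carrier[OF measurement_M index]
      by (simp add: mtrace_mult[of _ r n])
    also have "\<dots> \<le> Re (kernel_trace (grid r n) (bip_kernel n (rho i))) * Re
          (kernel_trace (grid r n) (kernel_transpose (bip_kernel n (M i))))"
      using ensemble index pos[OF index] by (intro kernel_pair_le_trace pos_kernel_transpose)
        (auto simp: ensemble_def state_iff_density_kernel density_kernel_def)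
    finally have "Re (mtrace (rho i * M i)) \<le> Re (kernel_trace (grid r n) (bip_kernel n (M i)))"
      using ensemble index
      by (simp add: ensemble_def state_iff_density_kernel density_kernel_def kernel_trace_transpose)
    then have "lam i * Re (mtrace (rho i * M i)) \<le>
        lam i * Re (kernel_trace (grid r n) (bip_kernel n (M i)))"
      by (rule mult_left_mono[OF _ weight(1)[OF index]])
    also have "\<dots> \<le> Re (kernel_trace (grid r n) (bip_kernel n (M i)))"
      using pos_kernel_trace_nonneg[OF _ pos[OF index]] weight[OF index]
      by (simp add: mult_left_le_one_le less_eq_complex_def)
    finally show "lam i * Re (mtrace (rho i * M i)) \<le>
        Re (kernel_trace (grid r n) (bip_kernel n (M i)))" .
  qed
  also have "\<dots> = Re (kernel_trace (grid r n) (\<Sum>i<k. bip_kernel n (M i)))"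
    by (simp only: kernel_trace_sum Re_sum)
  also have "\<dots> = r * n"
    using measurement_M kernel_trace_cong[of "\<Sum>i<k. bip_kernel n (M i)" "grid r n" one_kernel]
    by (simp add: measurement_iff kernel_trace_one)
  finally show ?thesis .
qed

lemma psucc_opt_upper:
  assumes "ensemble (r * n) k lam rho" "measurement (r * n) k M"
  shows "psucc k lam rho M \<le> psucc_opt (r * n) k lam rho"
  unfolding psucc_opt_def
proof (rule cSup_upper)
  show "bdd_above {psucc k lam rho M | M. measurement (r * n) k M}"
    using psucc_le_dim[OF assms(1)] by (intro bdd_aboveI[of _ "real (r * n)"]) blast
qed (use assms(2) in blast)

lemma measurement_uniform:
  assumes "0 < k"
  shows "measurement (r * n) k (\<lambda>i. kernel_mat r n ((1 / k) *\<^sub>R one_kernel))"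
proof -
  have "(\<Sum>i<k. bip_kernel n (kernel_mat r n ((1 / k) *\<^sub>R one_kernel))) \<simeq>\<^bsub>grid r n\<^esub>
      (\<Sum>i<k. (1 / k) *\<^sub>R one_kernel)"
    by (rule kernel_eq_sum[OF bip_kernel_kernel_mat])
  moreover have "(\<Sum>i<k. (1 / k) *\<^sub>R (one_kernel :: (nat \<times> nat) kernel)) = one_kernel"
    using assms by (simp only: sum_constant_scaleR) simp
  ultimately have "(\<Sum>i<k. bip_kernel n (kernel_mat r n ((1 / k) *\<^sub>R one_kernel))) \<simeq>\<^bsub>grid r n\<^esub>
      one_kernel"
    by (simp only:)
  then show ?thesis
    unfolding measurement_iff
    by (intro conjI allI impI psd_kernel_mat pos_kernel_scaleR pos_kernel_one) simp_all
qed

lemma psucc_opt_least: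
  assumes "0 < k" "\<And>M. measurement (r * n) k M \<Longrightarrow> psucc k lam rho M \<le> b"
  shows "psucc_opt (r * n) k lam rho \<le> b"
  unfolding psucc_opt_def by (rule cSup_least)
    (use measurement_uniform[OF assms(1)] assms(2) in blast)+

subsection \<open>The kernel of an ensemble and a measurement\<close>

text \<open>Chosen so that the success probability of the ensemble sent through a map \<open>\<phi>\<close> is the pairing
  of this kernel with the Choi kernel of \<open>\<phi>\<close>.\<close>

definition ensemble_kernel ::
    "nat \<Rightarrow> nat \<Rightarrow> (nat \<Rightarrow> real) \<Rightarrow> (nat \<Rightarrow> complex mat) \<Rightarrow> (nat \<Rightarrow> complex mat) \<Rightarrow> (nat \<times> nat) kernel"
  where
  "ensemble_kernel n k lam rho M =
    (\<Sum>i<k. lam i *\<^sub>R link {..<n} (bip_kernel n (rho i))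
          (swap_kernel (kernel_transpose (bip_kernel n (M i)))))"

lemma kernel_pair_ensemble_kernel:
  "kernel_pair (grid r n) (ensemble_kernel n k lam rho M) c =
    (\<Sum>i<k. lam i *\<^sub>R kernel_pair (grid r n) (bip_kernel n (rho i))
          (link {..<n} c (kernel_transpose (bip_kernel n (M i)))))"
  unfolding ensemble_kernel_def
  by (simp only: kernel_pair_sum_left kernel_pair_scaleR_left kernel_pair_link_right)

lemma pos_kernel_ensemble_kernel:
  assumes "ensemble (r * n) k lam rho" "measurement (n * n) k M"
  shows "pos_kernel (grid r n) (ensemble_kernel n k lam rho M)"
  unfolding ensemble_kernel_def using assms
  by (intro pos_kernel_sum pos_kernel_scaleR pos_kernel_link pos_kernel_swap pos_kernel_transpose)
    (auto simp: ensemble_def state_def measurement_def psd_iff_pos_kernel)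

lemma psucc_tensor_id:
  assumes lin: "lin_map r n \<phi>" and measurement_M: "measurement (n * n) k M"
  shows "psucc k lam (\<lambda>i. tensor_id r n n \<phi> (rho i)) M =
    Re (kernel_pair (grid r n) (ensemble_kernel n k lam rho M) (choi_kernel r \<phi>))"
proof -
  have "kernel_pair (grid n n) (bip_kernel n (tensor_id r n n \<phi> (rho i)))
        (kernel_transpose (bip_kernel n (M i))) =
      kernel_pair (grid r n) (bip_kernel n (rho i))
            (link {..<n} (choi_kernel r \<phi>) (kernel_transpose (bip_kernel n (M i))))" for i
    unfolding kernel_pair_cong[OF bip_kernel_tensor_id[OF lin] kernel_eq_refl]
    by (simp only: kernel_pair_link_left)
  then show ?thesis
    using measurement_carrier[OF measurement_M]
    by (simp add: psucc_eq_kernel_pair[of _ _ n n] kernel_pair_ensemble_kernel)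
qed

lemma measurement_link_channel:
  assumes chan_c: "chan_kernel {..<r} {..<n} c" and measurement_M: "measurement (n * n) k M"
  shows "measurement (r * n) k (\<lambda>i. kernel_mat r n (link {..<n} c (bip_kernel n (M i))))"
  unfolding measurement_iff
proof (intro conjI allI impI)
  fix i assume "i < k"
  then show "psd (r * n) (kernel_mat r n (link {..<n} c (bip_kernel n (M i))))"
    using measurement_M chan_c by (intro psd_kernel_mat pos_kernel_link)
      (auto simp: chan_kernel_def measurement_def psd_iff_pos_kernel)
next
  have "(\<Sum>i<k. bip_kernel n (kernel_mat r n (link {..<n} c (bip_kernel n (M i))))) \<simeq>\<^bsub>grid r n\<^esub>
      link {..<n} c (\<Sum>i<k. bip_kernel n (M i))"
    unfolding link_sum_right by (rule kernel_eq_sum[OF bip_kernel_kernel_mat])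
  also have "\<dots> \<simeq>\<^bsub>grid r n\<^esub> link {..<n} c one_kernel"
    using measurement_M by (intro link_cong[OF kernel_eq_refl]) (simp add: measurement_iff)
  also have "\<dots> \<simeq>\<^bsub>grid r n\<^esub> one_kernel"
    by (rule link_chan_kernel_one[OF finite_lessThan chan_c])
  finally show "(\<Sum>i<k. bip_kernel n (kernel_mat r n (link {..<n} c (bip_kernel n (M i)))))
      \<simeq>\<^bsub>grid r n\<^esub> one_kernel" .
qed

theorem cond_norm_ensemble_kernel_le:
  assumes "0 < n" and ensemble: "ensemble (r * n) k lam rho"
    and measurement_M: "measurement (n * n) k M"
  shows "cond_norm {..<r} {..<n} (ensemble_kernel n k lam rho M) \<le> psucc_opt (r * n) k lam rho"
proof (rule cond_norm_least)
  fix c assume "chan_kernel {..<r} {..<n} c"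
  define N where
    "N i = kernel_mat r n (link {..<n} (kernel_transpose c) (bip_kernel n (M i)))" for i
  have measurement_N: "measurement (r * n) k N"
    unfolding N_def by (rule measurement_link_channel[OF chan_kernel_transpose measurement_M]) fact
  have "kernel_pair (grid r n) (bip_kernel n (rho i))
        (link {..<n} c (kernel_transpose (bip_kernel n (M i)))) =
      kernel_pair (grid r n) (bip_kernel n (rho i)) (kernel_transpose (bip_kernel n (N i)))" for i
    unfolding N_def kernel_pair_cong[OF kernel_eq_refl
        kernel_transpose_cong[OF bip_kernel_kernel_mat]]
    by (simp add: kernel_transpose_link)
  then have "Re (kernel_pair (grid r n) (ensemble_kernel n k lam rho M) c) = psucc k lam rho N"
    using ensemble_carrier[OF ensemble] measurement_carrier[OF measurement_N]
    by (simp add: psucc_eq_kernel_pair[of k rho r n N] kernel_pair_ensemble_kernel)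
  also have "\<dots> \<le> psucc_opt (r * n) k lam rho" by (rule psucc_opt_upper[OF ensemble measurement_N])
  finally show "Re (kernel_pair (grid r n) (ensemble_kernel n k lam rho M) c) \<le>
      psucc_opt (r * n) k lam rho" .
qed (use assms(1) in \<open>auto simp: lessThan_empty_iff\<close>)

section \<open>The teleportation ensemble\<close>

definition unitary_kernel :: "'i set \<Rightarrow> 'i kernel \<Rightarrow> bool" where
  "unitary_kernel I W \<longleftrightarrow> kernel_mult I W (kernel_adjoint W) \<simeq>\<^bsub>I\<^esub> one_kernel \<and>
     kernel_mult I (kernel_adjoint W) W \<simeq>\<^bsub>I\<^esub> one_kernel"

lemma chan_kernel_conj_kernel:
  assumes "unitary_kernel I W"
  shows "chan_kernel I I (conj_kernel W)"
proof -
  have "ptrace I (conj_kernel W) = kernel_mult I W (kernel_adjoint W)"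
    by (simp add: ptrace_def conj_kernel_def outer_def kernel_mult_def kernel_adjoint_def
        fun_eq_iff)
  then show ?thesis using assms
    by (simp add: chan_kernel_def pos_kernel_conj_kernel unitary_kernel_def)
qed

lemma swap_conj_kernel: "swap_kernel (conj_kernel W) = conj_kernel (kernel_transpose W)"
  by (simp add: swap_kernel_def conj_kernel_def outer_def kernel_transpose_def fun_eq_iff)

lemma swap_transpose_conj_kernel: "swap_kernel (kernel_transpose (conj_kernel W)) =
    conj_kernel (kernel_adjoint W)"
  by (simp add: swap_kernel_def conj_kernel_def outer_def kernel_transpose_def kernel_adjoint_def
      fun_eq_iff)

lemma kernel_transpose_mult: "kernel_transpose (kernel_mult I A B) =
    kernel_mult I (kernel_transpose B) (kernel_transpose A)"
  by (simp add: kernel_transpose_def kernel_mult_def fun_eq_iff mult.commute)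

lemma kernel_transpose_adjoint: "kernel_transpose (kernel_adjoint A) =
    kernel_adjoint (kernel_transpose A)"
  by (simp add: kernel_transpose_def kernel_adjoint_def fun_eq_iff)

lemma unitary_kernel_transpose: "unitary_kernel I W \<Longrightarrow> unitary_kernel I (kernel_transpose W)"
  unfolding unitary_kernel_def
  using kernel_transpose_cong[of "kernel_mult I W (kernel_adjoint W)" I one_kernel]
    kernel_transpose_cong[of "kernel_mult I (kernel_adjoint W) W" I one_kernel]
  by (simp add: kernel_transpose_mult kernel_transpose_adjoint)

subsection \<open>Weyl operators\<close>

definition root1 :: "nat \<Rightarrow> nat \<Rightarrow> complex" where
  "root1 n k = cis (2 * pi * k / n)"

definition weyl :: "nat \<Rightarrow> nat \<Rightarrow> nat kernel" where
  "weyl n i x y = of_bool (x = (y + i div n) mod n) * root1 n y ^ (i mod n)"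

lemma root1_unit: "root1 n a * cnj (root1 n a) = 1"
  by (simp add: root1_def cis_cnj cis_mult)

lemma sum_root1_orthogonal:
  assumes "a < n" "b < n"
  shows "(\<Sum>l<n. root1 n b ^ l * cnj (root1 n a) ^ l) = of_nat n * of_bool (a = b)"
proof (cases "a = b")
  case True
  then show ?thesis by (simp add: root1_unit flip: power_mult_distrib)
next
  case False
  define z where "z = root1 n b * cnj (root1 n a)"
  have "inj_on (root1 n) {..<n}"
    using bij_betw_roots_unity[of n] assms(1) unfolding root1_def by (auto simp: bij_betw_def)
  then have "root1 n b \<noteq> root1 n a" using False assms by (auto dest: inj_onD)
  moreover have "z * root1 n a = root1 n b"
    using root1_unit[of n a] by (simp add: z_def mult.assoc mult.commute)
  ultimately have "z \<noteq> 1" by auto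
  have root_power: "root1 n c ^ n = 1" for c
    using assms(1) cis_multiple_2pi[of "real c"] by (simp add: root1_def DeMoivre)
  have "z ^ n = 1" unfolding z_def power_mult_distrib
    by (simp add: root_power flip: complex_cnj_power)
  with \<open>z \<noteq> 1\<close> have "(\<Sum>l<n. z ^ l) = 0" by (simp add: geometric_sum)
  then show ?thesis using False by (simp add: z_def power_mult_distrib)
qed

lemma add_mod_cancel_right:
  assumes "(a + k) mod n = (b + k) mod n" "a < n" "b < (n :: nat)"
  shows "a = b"
proof -
  obtain q r where "a + k + n * q = b + k + n * r" using assms(1) by (auto simp: nat_mod_eq_iff)
  then have "(a + n * q) mod n = (b + n * r) mod n" by simp
  then show ?thesis using assms(2,3) by simp
qed

lemma sum_shift_mod:
  fixes g :: "nat \<Rightarrow> 'a :: comm_monoid_add"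
  shows "(\<Sum>a<n. g ((a + k) mod n)) = (\<Sum>x<n. g x)"
proof (rule sum.reindex_bij_betw)
  have inj: "inj_on (\<lambda>a. (a + k) mod n) {..<n}"
    by (auto intro!: inj_onI dest: add_mod_cancel_right)
  moreover have "(\<lambda>a. (a + k) mod n) ` {..<n} \<subseteq> {..<n}" by (cases "n = 0") auto
  ultimately have "(\<lambda>a. (a + k) mod n) ` {..<n} = {..<n}" by (intro endo_inj_surj) auto
  then show "bij_betw (\<lambda>a. (a + k) mod n) {..<n} {..<n}" using inj by (simp add: bij_betw_def)
qed

lemma weyl_mult_cnj:
  "weyl n i x a * cnj (weyl n i y a) =
      of_bool (x = (a + i div n) mod n) * of_bool (y = (a + i div n) mod n)"
  by (auto simp: weyl_def root1_unit simp flip: power_mult_distrib)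

lemma unitary_kernel_weyl: "unitary_kernel {..<n} (weyl n i)"
  unfolding unitary_kernel_def
proof (intro conjI kernel_eqI)
  fix x y assume "x \<in> {..<n}" "y \<in> {..<n}"
  have "kernel_mult {..<n} (weyl n i) (kernel_adjoint (weyl n i)) x y =
      (\<Sum>a<n. of_bool (x = (a + i div n) mod n) * of_bool (y = (a + i div n) mod n))"
    by (simp add: kernel_mult_def kernel_adjoint_def weyl_mult_cnj)
  also have "\<dots> = (\<Sum>z<n. of_bool (x = z) * of_bool (y = z))"
    by (rule sum_shift_mod)
  finally show "kernel_mult {..<n} (weyl n i) (kernel_adjoint (weyl n i)) x y = one_kernel x y"
    using \<open>x \<in> {..<n}\<close> by (auto simp: one_kernel_def)
next
  fix a b assume indices: "a \<in> {..<n}" "b \<in> {..<n}"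
  have "kernel_mult {..<n} (kernel_adjoint (weyl n i)) (weyl n i) a b =
      (\<Sum>x<n. if x = (a + i div n) mod n then of_bool (a = b) else 0)"
    unfolding kernel_mult_def kernel_adjoint_def
  proof (intro sum.cong refl)
    fix x
    show "cnj (weyl n i x a) * weyl n i x b =
        (if x = (a + i div n) mod n then of_bool (a = b) else 0)"
    proof (cases "a = b")
      case True
      then show ?thesis using weyl_mult_cnj[of n i x a x] by (simp add: mult.commute)
    next
      case False
      then show ?thesis using add_mod_cancel_right[of a "i div n" n b] indices
        by (auto simp: weyl_def)
    qed
  qed
  then show "kernel_mult {..<n} (kernel_adjoint (weyl n i)) (weyl n i) a b = one_kernel a b"
    using indices by (simp add: one_kernel_def)
qed

lemma sum_conj_kernel_weyl:
  "(\<Sum>i<n * n. conj_kernel (weyl n i)) \<simeq>\<^bsub>grid n n\<^esub> real n *\<^sub>R one_kernel"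
proof (rule kernel_eqI)
  fix p q assume indices: "p \<in> grid n n" "q \<in> grid n n"
  obtain x a y b where p_eq: "p = (x, a)" and q_eq: "q = (y, b)" by (metis surj_pair)
  have "(\<Sum>i<n * n. conj_kernel (weyl n i)) p q =
      (\<Sum>k<n. \<Sum>l<n. weyl n (k * n + l) x a * cnj (weyl n (k * n + l) y b))"
    unfolding sum_fun_apply sum_grid sum.cartesian_product'
    by (simp add: p_eq q_eq conj_kernel_def outer_def)
  also have "\<dots> = (\<Sum>k<n. of_bool (x = (a + k) mod n) * of_bool (y = (b + k) mod n) *
       (\<Sum>l<n. root1 n a ^ l * cnj (root1 n b) ^ l))"
    unfolding sum_distrib_left by (intro sum.cong refl) (auto simp: weyl_def)
  also have "\<dots> = (\<Sum>k<n. of_bool (x =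
      (k + a) mod n) * of_bool (y = (k + a) mod n) * (of_nat n * of_bool (a = b)))"
    using indices by (intro sum.cong refl) (auto simp: p_eq q_eq sum_root1_orthogonal add.commute)
  also have "\<dots> = (\<Sum>z<n. of_bool (x = z) * of_bool (y = z) * (of_nat n * of_bool (a = b)))"
    by (rule sum_shift_mod[of "\<lambda>z. of_bool (x =
        z) * of_bool (y = z) * (of_nat n * of_bool (a = b))"])
  also have "\<dots> = (\<Sum>z<n. if z = x then of_bool (x = y) * (of_nat n * of_bool (a = b)) else 0)"
    by (intro sum.cong refl) auto
  finally show "(\<Sum>i<n * n. conj_kernel (weyl n i)) p q = (real n *\<^sub>R one_kernel) p q"
    using indices by (auto simp: p_eq q_eq one_kernel_def scaleR_conv_of_real)
qed

subsection \<open>Rotated copies of a state\<close>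

text \<open>Every outcome of the measurement in the maximally entangled basis reproduces \<open>C / n\<close>, as in
  teleportation, while a measurement of the rotated copies, rotated back and summed, is \<open>n\<close> times a
  channel.\<close>

definition rotated_state :: "nat \<Rightarrow> nat \<Rightarrow> (nat \<times> nat) kernel \<Rightarrow> nat \<Rightarrow> complex mat" where
  "rotated_state r n C i = kernel_mat r n (link {..<n} C (conj_kernel (weyl n i)))"

definition weyl_basis_measurement :: "nat \<Rightarrow> nat \<Rightarrow> complex mat" where
  "weyl_basis_measurement n i = kernel_mat n n ((1 / n) *\<^sub>R conj_kernel (weyl n i))"

lemma rotated_state_carrier [simp]: "rotated_state r n C i \<in> carrier_mat (r * n) (r * n)"
  by (simp add: rotated_state_def)

lemma bip_kernel_rotated_state:
  "bip_kernel n (rotated_state r n C i) \<simeq>\<^bsub>grid r n\<^esub> link {..<n} C (conj_kernel (weyl n i))"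
  unfolding rotated_state_def by (rule bip_kernel_kernel_mat)

lemma bip_kernel_weyl_basis_measurement:
  "bip_kernel n (weyl_basis_measurement n i) \<simeq>\<^bsub>grid n n\<^esub> (1 / n) *\<^sub>R conj_kernel (weyl n i)"
  unfolding weyl_basis_measurement_def by (rule bip_kernel_kernel_mat)

lemma ensemble_rotated_state:
  assumes "0 < n" and density_C: "density_kernel (grid r n) C"
  shows "ensemble (r * n) (n * n) (\<lambda>i. 1 / real (n * n)) (rotated_state r n C)"
proof -
  have "density_kernel (grid r n) (link {..<n} C (conj_kernel (weyl n i)))" for i
    using density_C chan_kernel_conj_kernel[OF unitary_kernel_weyl[of n i]]
    by (simp add: density_kernel_def chan_kernel_def pos_kernel_link kernel_trace_prod ptrace_link)
  then have "state (r * n) (rotated_state r n C i)" for i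
    by (simp add: state_def rotated_state_def psd_kernel_mat mtrace_kernel_mat density_kernel_def)
  then show ?thesis using assms(1) by (simp add: ensemble_def)
qed

lemma measurement_weyl_basis:
  assumes "0 < n"
  shows "measurement (n * n) (n * n) (weyl_basis_measurement n)"
  unfolding measurement_iff
proof (intro conjI allI impI)
  show "psd (n * n) (weyl_basis_measurement n i)" for i
    unfolding weyl_basis_measurement_def
    by (intro psd_kernel_mat pos_kernel_scaleR pos_kernel_conj_kernel) simp
  have "(\<Sum>i<n * n. bip_kernel n (weyl_basis_measurement n i)) \<simeq>\<^bsub>grid n n\<^esub>
      (1 / n) *\<^sub>R (real n *\<^sub>R one_kernel)"
    by (rule kernel_eq_trans[OF kernel_eq_sum[OF bip_kernel_weyl_basis_measurement]
          kernel_eq_scaleR[OF sum_conj_kernel_weyl, unfolded scaleR_sum_right]])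
  moreover have "1 / real n * real n = 1" using assms by simp
  ultimately show "(\<Sum>i<n * n. bip_kernel n (weyl_basis_measurement n i)) \<simeq>\<^bsub>grid n n\<^esub> one_kernel"
    by (simp only: scaleR_scaleR scaleR_one)
qed

lemma link_rotated_state_weyl_basis_measurement:
  "link {..<n} (bip_kernel n (rotated_state r n C i))
        (swap_kernel (kernel_transpose (bip_kernel n (weyl_basis_measurement n i))))
    \<simeq>\<^bsub>grid r n\<^esub> (1 / n) *\<^sub>R C"
proof -
  let ?U = "conj_kernel (weyl n i)"
  have "link {..<n} (bip_kernel n (rotated_state r n C i))
        (swap_kernel (kernel_transpose (bip_kernel n (weyl_basis_measurement n i))))
      \<simeq>\<^bsub>grid r n\<^esub> link {..<n} (link {..<n} C ?U) (swap_kernel (kernel_transpose ((1 / n) *\<^sub>R ?U)))"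
    by (rule link_cong[OF bip_kernel_rotated_state
          swap_kernel_cong[OF kernel_transpose_cong[OF bip_kernel_weyl_basis_measurement]]])
  moreover have "link {..<n} (link {..<n} C ?U) (swap_kernel (kernel_transpose ((1 / n) *\<^sub>R ?U))) =
      (1 / n) *\<^sub>R link {..<n} C
            (conj_kernel (kernel_mult {..<n} (weyl n i) (kernel_adjoint (weyl n i))))"
    by (simp add: kernel_transpose_scaleR swap_kernel_scaleR link_scaleR_right
        swap_transpose_conj_kernel link_assoc link_conj_kernel)
  moreover have "link {..<n} C
        (conj_kernel (kernel_mult {..<n} (weyl n i) (kernel_adjoint (weyl n i)))) \<simeq>\<^bsub>grid r n\<^esub>
      link {..<n} C id_kernel"
    using unitary_kernel_weyl[of n i] unfolding conj_kernel_one[symmetric]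
    by (intro link_cong[OF kernel_eq_refl] conj_kernel_cong) (simp add: unitary_kernel_def)
  moreover have "link {..<n} C id_kernel \<simeq>\<^bsub>grid r n\<^esub> C" by (rule link_id_right) simp
  ultimately show ?thesis by (simp add: kernel_eq_def)
qed

lemma ensemble_kernel_rotated_state:
  assumes "0 < n"
  shows "ensemble_kernel n (n * n) (\<lambda>i. 1 / real (n * n)) (rotated_state r n C)
        (weyl_basis_measurement n) \<simeq>\<^bsub>grid r n\<^esub>
    (1 / n) *\<^sub>R C"
proof -
  have "(\<Sum>i<n * n. (1 / real (n * n)) *\<^sub>R ((1 / n) *\<^sub>R C)) = (1 / n) *\<^sub>R C"
    using assms by (simp only: sum_constant_scaleR) simp
  moreover have "ensemble_kernel n (n * n) (\<lambda>i. 1 / real (n * n)) (rotated_state r n C)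
        (weyl_basis_measurement n) \<simeq>\<^bsub>grid r n\<^esub>
      (\<Sum>i<n * n. (1 / real (n * n)) *\<^sub>R ((1 / n) *\<^sub>R C))"
    unfolding ensemble_kernel_def
    by (intro kernel_eq_sum kernel_eq_scaleR link_rotated_state_weyl_basis_measurement)
  ultimately show ?thesis by (simp only:)
qed

lemma kernel_pair_rotated_state:
  "kernel_pair (grid r n) (bip_kernel n (rotated_state r n C i)) R =
    kernel_pair (grid r n) C (link {..<n} R (swap_kernel (conj_kernel (weyl n i))))"
  unfolding kernel_pair_cong[OF bip_kernel_rotated_state kernel_eq_refl] kernel_pair_commute[of _ C]
  by (subst kernel_pair_commute) (rule kernel_pair_link_right)

lemma chan_kernel_sum_rotated_measurement:
  assumes "0 < n" and measurement_N: "measurement (r * n) k N"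
  shows "chan_kernel {..<r} {..<n}
    ((1 / n) *\<^sub>R (\<Sum>i<k. link {..<n} (kernel_transpose (bip_kernel n (N i)))
          (swap_kernel (conj_kernel (weyl n i)))))"
    (is "chan_kernel _ _ ?c")
proof -
  have chan_U: "chan_kernel {..<n} {..<n} (swap_kernel (conj_kernel (weyl n i)))" for i
    unfolding swap_conj_kernel
    by (intro chan_kernel_conj_kernel unitary_kernel_transpose unitary_kernel_weyl)
  have "pos_kernel (grid r n) ?c"
    using measurement_N chan_U
    by (intro pos_kernel_scaleR pos_kernel_sum pos_kernel_link pos_kernel_transpose)
      (auto simp: measurement_def psd_iff_pos_kernel chan_kernel_def)
  moreover have "ptrace {..<n} ?c =
      (1 / n) *\<^sub>R ptrace {..<n} (kernel_transpose (\<Sum>i<k. bip_kernel n (N i)))"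
    unfolding ptrace_scaleR ptrace_sum kernel_transpose_sum
    using chan_U by (simp add: ptrace_link chan_kernel_def)
  moreover have "ptrace {..<n} (kernel_transpose (\<Sum>i<k. bip_kernel n (N i))) \<simeq>\<^bsub>{..<r}\<^esub>
      ptrace {..<n} (kernel_transpose one_kernel)"
    using measurement_N by (intro ptrace_cong kernel_transpose_cong) (simp add: measurement_iff)
  ultimately show ?thesis
    using assms(1) by (simp add: chan_kernel_def kernel_eq_def ptrace_one)
qed

lemma psucc_opt_rotated_state_le:
  assumes "0 < n" and density_C: "density_kernel (grid r n) C"
  shows "psucc_opt (r * n) (n * n) (\<lambda>i. 1 / real (n * n)) (rotated_state r n C) \<le>
      cond_norm {..<r} {..<n} C / n"
proof (rule psucc_opt_least)
  fix N assume measurement_N: "measurement (r * n) (n * n) N"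
  let ?c = "(1 / n) *\<^sub>R (\<Sum>i<n * n. link {..<n} (kernel_transpose (bip_kernel n (N i)))
        (swap_kernel (conj_kernel (weyl n i))))"
  have "psucc (n * n) (\<lambda>i. 1 / real (n * n)) (rotated_state r n C) N =
      Re (kernel_pair (grid r n) C ?c) / n"
    using measurement_carrier[OF measurement_N]
    by (simp add: psucc_eq_kernel_pair[of _ _ r n] kernel_pair_rotated_state
        kernel_pair_scaleR_right kernel_pair_sum_right sum_divide_distrib sum_distrib_left)
  also have "\<dots> \<le> cond_norm {..<r} {..<n} C / n"
    using cond_norm_upper[OF _ _ _ chan_kernel_sum_rotated_measurement[OF assms(1) measurement_N],
        of C] density_C
    by (simp add: density_kernel_def divide_right_mono)
  finally show "psucc (n * n) (\<lambda>i. 1 / real (n * n)) (rotated_state r n C) N \<le>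
      cond_norm {..<r} {..<n} C / n" .
qed (use assms(1) in simp)

section \<open>Equivalence of the conditions\<close>

lemma Sup_psucc_eq_cond_norm:
  assumes "0 < r" "channel s n \<phi>" "measurement (n * n) k M"
  shows "Sup {psucc k lam (\<lambda>i. tensor_id r n n (\<lambda>X. \<phi> (\<alpha> X)) (rho i)) M | \<alpha>. channel r s \<alpha>} =
    cond_norm {..<r} {..<s} (link {..<n} (ensemble_kernel n k lam rho M)
          (swap_kernel (choi_kernel s \<phi>)))"
proof -
  let ?E = "ensemble_kernel n k lam rho M" and ?J = "choi_kernel s \<phi>"
  have "psucc k lam (\<lambda>i. tensor_id r n n (\<lambda>X. \<phi> (\<alpha> X)) (rho i)) M =
      Re (kernel_pair (grid r s) (link {..<n} ?E (swap_kernel ?J)) (choi_kernel r \<alpha>))"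
        if "channel r s \<alpha>" for \<alpha>
  proof -
    have lin: "lin_map r s \<alpha>" "lin_map s n \<phi>" using that assms(2) by (simp_all add: channel_def)
    then show ?thesis
      by (simp add: psucc_tensor_id[OF lin_map_compose[OF lin] assms(3)]
          kernel_pair_cong[OF kernel_eq_refl choi_kernel_compose[OF lin]] kernel_pair_link_right)
  qed
  then have "{psucc k lam (\<lambda>i. tensor_id r n n (\<lambda>X. \<phi> (\<alpha> X)) (rho i)) M | \<alpha>. channel r s \<alpha>} =
      {Re (kernel_pair (grid r s) (link {..<n} ?E (swap_kernel ?J)) (choi_kernel r \<alpha>)) |
          \<alpha>. channel r s \<alpha>}"
    by (intro Collect_cong) metis
  also have "\<dots> = {Re (kernel_pair (grid r s) (link {..<n} ?E (swap_kernel ?J)) c) |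
      c. chan_kernel {..<r} {..<s} c}"
    by (intro choi_kernels_of_channels assms(1) arg_cong[where f = Re] kernel_pair_cong
        kernel_eq_refl)
  finally show ?thesis by (simp add: cond_norm_def)
qed

context channel_pair
begin

lemma cond_ii_iff_norm_bound:
  assumes "0 < r"
  shows "cond_ii d0 d0' d1 \<Phi>1 \<Phi>2 \<epsilon> r \<longleftrightarrow>
      (\<forall>\<rho>. state (r * d1) \<rho> \<longrightarrow> norm_bound \<epsilon> {..<r} (bip_kernel d1 \<rho>))"
proof -
  have "\<rho> \<in> carrier_mat (r * d1) (r * d1)" if "state (r * d1) \<rho>" for \<rho>
    using that by (simp add: state_def psd_carrier)
  then show ?thesis
    unfolding cond_ii_def norm_bound_def cond_dnorm_id_tensor_map_transp[OF assms dims(1) \<Phi>1]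
      cond_dnorm_id_tensor_map_transp[OF assms dims(2) \<Phi>2]
    by (simp add: cond_dnorm_eq_cond_norm[OF assms])
qed

lemma cond_iii_iff_cond_norm:
  assumes "0 < r"
  shows "cond_iii d0 d0' d1 \<Phi>1 \<Phi>2 \<epsilon> r \<longleftrightarrow>
    (\<forall>k lam rho M. ensemble (r * d1) k lam rho \<longrightarrow> measurement (d1 * d1) k M \<longrightarrow>
      cond_norm {..<r} {..<d0'} (link {..<d1} (ensemble_kernel d1 k lam rho M) (swap_kernel J2)) \<le>
      cond_norm {..<r} {..<d0} (link {..<d1} (ensemble_kernel d1 k lam rho M) (swap_kernel J1)) +
        \<epsilon> / 2 * psucc_opt (r * d1) k lam rho)"
  unfolding cond_iii_def by (simp add: Sup_psucc_eq_cond_norm[OF assms \<Phi>1]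
      Sup_psucc_eq_cond_norm[OF assms \<Phi>2])

lemma cond_ii_if_delta_pre_le:
  assumes "delta_pre d0 d0' d1 \<Phi>1 \<Phi>2 \<le> \<epsilon>" "0 < r"
  shows "cond_ii d0 d0' d1 \<Phi>1 \<Phi>2 \<epsilon> r"
  unfolding cond_ii_iff_norm_bound[OF assms(2)]
  by (auto simp: state_def psd_iff_pos_kernel intro!: norm_bound_if_delta_pre_le[OF assms(1)])

lemma cond_iii_if_delta_pre_le:
  assumes "0 \<le> \<epsilon>" "delta_pre d0 d0' d1 \<Phi>1 \<Phi>2 \<le> \<epsilon>" "0 < r"
  shows "cond_iii d0 d0' d1 \<Phi>1 \<Phi>2 \<epsilon> r"
  unfolding cond_iii_iff_cond_norm[OF assms(3)]
proof (intro allI impI)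
  fix k lam rho M assume ensemble: "ensemble (r * d1) k lam rho"
    and measurement_M: "measurement (d1 * d1) k M"
  let ?E = "ensemble_kernel d1 k lam rho M"
  have "norm_bound \<epsilon> {..<r} ?E"
    by (rule norm_bound_if_delta_pre_le[OF assms(2) finite_lessThan
        pos_kernel_ensemble_kernel[OF ensemble measurement_M]])
  moreover have "\<epsilon> / 2 * cond_norm {..<r} {..<d1} ?E \<le> \<epsilon> / 2 * psucc_opt (r * d1) k lam rho"
    using assms(1) by (intro mult_left_mono
        cond_norm_ensemble_kernel_le[OF dims(3) ensemble measurement_M]) simp
  ultimately show "cond_norm {..<r} {..<d0'} (link {..<d1} ?E (swap_kernel J2)) \<le>
      cond_norm {..<r} {..<d0} (link {..<d1} ?E (swap_kernel J1)) +
          \<epsilon> / 2 * psucc_opt (r * d1) k lam rho"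
    unfolding norm_bound_def by linarith
qed

lemma kernel_pair_J2_le_cond_norm:
  assumes "pos_kernel (grid d0' d1) C"
  shows "Re (kernel_pair (grid d0' d1) C J2) \<le>
      cond_norm {..<d0'} {..<d0'} (link {..<d1} C (swap_kernel J2))"
proof -
  have "kernel_pair (grid d0' d1) C J2 = kernel_pair (grid d0' d1) C (link {..<d0'} id_kernel J2)"
    by (rule kernel_pair_cong[OF kernel_eq_refl kernel_eq_sym[OF link_id_left[OF finite_lessThan]]])
  also have "\<dots> = kernel_pair (grid d0' d0') (link {..<d1} C (swap_kernel J2)) id_kernel"
    by (rule kernel_pair_link_right)
  finally show ?thesis
    using cond_norm_upper[OF _ _ pos_kernel_link_swap_choi_kernel[OF dims(2) \<Phi>2 _ assms]
        chan_kernel_id] by simp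
qed

lemma delta_pre_le_if_cond_ii:
  assumes "0 \<le> \<epsilon>" and condition: "cond_ii d0 d0' d1 \<Phi>1 \<Phi>2 \<epsilon> d0'"
  shows "delta_pre d0 d0' d1 \<Phi>1 \<Phi>2 \<le> \<epsilon>"
proof (rule delta_pre_le_if_norm_bound[OF assms(1)])
  fix C assume density_C: "density_kernel (grid d0' d1) C"
  let ?\<rho> = "kernel_mat d0' d1 C"
  have "state (d0' * d1) ?\<rho>"
    using density_C by (simp add: state_def psd_kernel_mat mtrace_kernel_mat density_kernel_def)
  then have "norm_bound \<epsilon> {..<d0'} (bip_kernel d1 ?\<rho>)"
    using condition by (simp add: cond_ii_iff_norm_bound[OF dims(2)])
  moreover have "bip_kernel d1 ?\<rho> \<simeq>\<^bsub>grid d0' d1\<^esub> C" by (rule bip_kernel_kernel_mat)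
  ultimately have "norm_bound \<epsilon> {..<d0'} C" by (simp only: norm_bound_cong)
  then show "Re (kernel_pair (grid d0' d1) C J2) \<le>
      cond_norm {..<d0'} {..<d0} (link {..<d1} C (swap_kernel J1)) +
          \<epsilon> / 2 * cond_norm {..<d0'} {..<d1} C"
    using kernel_pair_J2_le_cond_norm density_C
    unfolding norm_bound_def density_kernel_def by fastforce
qed

lemma delta_pre_le_if_cond_iii:
  assumes "0 \<le> \<epsilon>" and condition: "cond_iii d0 d0' d1 \<Phi>1 \<Phi>2 \<epsilon> d0'"
  shows "delta_pre d0 d0' d1 \<Phi>1 \<Phi>2 \<le> \<epsilon>"
proof (rule delta_pre_le_if_norm_bound[OF assms(1)])
  fix C assume density_C: "density_kernel (grid d0' d1) C"
  then have pos: "pos_kernel (grid d0' d1) C" by (simp add: density_kernel_def)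
  let ?lam = "\<lambda>i. 1 / real (d1 * d1)" and ?rho = "rotated_state d0' d1 C"
    and ?M = "weyl_basis_measurement d1"
  define E where "E = ensemble_kernel d1 (d1 * d1) ?lam ?rho ?M"
  have cond_norm_E: "cond_norm {..<d0'} {..<s} (link {..<d1} E (swap_kernel (choi_kernel s \<phi>))) =
      cond_norm {..<d0'} {..<s} (link {..<d1} C (swap_kernel (choi_kernel s \<phi>))) / d1"
    if "0 < s" "channel s d1 \<phi>" for s \<phi>
    unfolding E_def link_scaleR_left
      cond_norm_cong[OF link_cong[OF ensemble_kernel_rotated_state[OF dims(3)] kernel_eq_refl]]
    using dims pos that by (subst cond_norm_scaleR)
      (simp_all add: pos_kernel_link_swap_choi_kernel lessThan_empty_iff)
  have "cond_norm {..<d0'} {..<d0'} (link {..<d1} E (swap_kernel J2)) \<le>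
      cond_norm {..<d0'} {..<d0} (link {..<d1} E (swap_kernel J1)) +
          \<epsilon> / 2 * psucc_opt (d0' * d1) (d1 * d1) ?lam ?rho"
    using condition ensemble_rotated_state[OF dims(3) density_C] measurement_weyl_basis[OF dims(3)]
    unfolding cond_iii_iff_cond_norm[OF dims(2)] E_def by blast
  also have "\<epsilon> / 2 * psucc_opt (d0' * d1) (d1 * d1) ?lam ?rho \<le>
      \<epsilon> / 2 * (cond_norm {..<d0'} {..<d1} C / d1)"
    using assms(1) by (intro mult_left_mono psucc_opt_rotated_state_le[OF dims(3) density_C]) simp
  finally have "cond_norm {..<d0'} {..<d0'} (link {..<d1} C (swap_kernel J2)) \<le>
      cond_norm {..<d0'} {..<d0} (link {..<d1} C (swap_kernel J1)) +
          \<epsilon> / 2 * cond_norm {..<d0'} {..<d1} C"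
    using dims(3) by (simp add: cond_norm_E[OF dims(1) \<Phi>1] cond_norm_E[OF dims(2) \<Phi>2] field_simps)
  then show "Re (kernel_pair (grid d0' d1) C J2) \<le>
      cond_norm {..<d0'} {..<d0} (link {..<d1} C (swap_kernel J1)) +
          \<epsilon> / 2 * cond_norm {..<d0'} {..<d1} C"
    using kernel_pair_J2_le_cond_norm[OF pos] by linarith
qed

end

theorem theorem6:
  fixes dA0 dA0' dA1 :: nat and \<Phi>1 \<Phi>2 :: cmap and \<epsilon> :: real
  assumes "0 < dA0" and "0 < dA0'" and "0 < dA1"
    and "channel dA0 dA1 \<Phi>1" and "channel dA0' dA1 \<Phi>2"
    and "0 \<le> \<epsilon>"
  shows "(delta_pre dA0 dA0' dA1 \<Phi>1 \<Phi>2 \<le> \<epsilon> \<longleftrightarrow>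
            (\<forall>dR>0. cond_ii dA0 dA0' dA1 \<Phi>1 \<Phi>2 \<epsilon> dR))
       \<and> (delta_pre dA0 dA0' dA1 \<Phi>1 \<Phi>2 \<le> \<epsilon> \<longleftrightarrow>
            (\<forall>dR>0. cond_iii dA0 dA0' dA1 \<Phi>1 \<Phi>2 \<epsilon> dR))
       \<and> (delta_pre dA0 dA0' dA1 \<Phi>1 \<Phi>2 \<le> \<epsilon> \<longleftrightarrow>
            cond_ii dA0 dA0' dA1 \<Phi>1 \<Phi>2 \<epsilon> dA0')
       \<and> (delta_pre dA0 dA0' dA1 \<Phi>1 \<Phi>2 \<le> \<epsilon> \<longleftrightarrow>
            cond_iii dA0 dA0' dA1 \<Phi>1 \<Phi>2 \<epsilon> dA0')"
proof -
  interpret channel_pair dA0 dA0' dA1 \<Phi>1 \<Phi>2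
    using assms by unfold_locales
  show ?thesis
    using cond_ii_if_delta_pre_le cond_iii_if_delta_pre_le[OF \<open>0 \<le> \<epsilon>\<close>]
      delta_pre_le_if_cond_ii[OF \<open>0 \<le> \<epsilon>\<close>] delta_pre_le_if_cond_iii[OF \<open>0 \<le> \<epsilon>\<close>] \<open>0 < dA0'\<close>
    by blast
qed

end
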